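(* Let $n$ be a positive integer and let $\mathbf{a}=(a_1,\dots,a_n)\in(\mathbb{C}^* )^n$ (all $a_i\neq 0$). Let $\mathbb{C}_{\mathbf{a}}=\mathbb{C}1_{\mathbf{a}}$ be the one dimensional $U(\Delta_n)$-module with $\partial_i1_{\mathbf{a}}=a_i1_{\mathbf{a}}$ for all $i$, let $Q_{\mathbf{a}}=U(W_n)\otimes_{U(\Delta_n)}\mathbb{C}_{\mathbf{a}}$ be the induced $W_n$-module, and let $H_{\mathbf{a}}=\mathrm{End}_{W_n}(Q_{\mathbf{a}})^{\mathrm{op}}$, so that $Q_{\mathbf{a}}$ is a left $U(W_n)$-module and a right $H_{\mathbf{a}}$-module. Then: (a) As a right $H_{\mathbf{a}}$-module, $Q_{\mathbf{a}}$ is free; more precisely, $\{h^{\mathbf{m}}\otimes 1_{\mathbf{a}}\mid \mathbf{m}\in\mathbb{Z}_{\ge0}^n\}$ is a basis of $Q_{\mathbf{a}}$ as a right $H_{\mathbf{a}}$-module. (b) The functors $M\mapsto\mathrm{Wh}_{\mathbf{a}}(M)$ and $V\mapsto Q_{\mathbf{a}}\otimes_{H_{\mathbf{a}}}V$ are mutually (quasi-)inverse equivalences between $\Omega_{\mathbf{a}}^W$ and the category $H_{\mathbf{a}}\text{-mod}$ of finite dimensional (left) $H_{\mathbf{a}}$-modules.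
   Context: Notation: $A_n=\mathbb{C}[t_1,\dots,t_n]$, $\partial_i=\partial/\partial t_i$, $W_n=\mathrm{Der}(A_n)=\bigoplus_{i=1}^n A_n\partial_i$ is the Lie algebra of derivations of $A_n$, $\Delta_n=\mathrm{Span}\{\partial_1,\dots,\partial_n\}$ (an abelian subalgebra), $h_i=t_i\partial_i\in W_n$, and $h^{\mathbf{m}}=h_1^{m_1}\cdots h_n^{m_n}\in U(W_n)$ for $\mathbf{m}\in\mathbb{Z}_{\ge0}^n$. $\phi_{\mathbf{a}}:\Delta_n\to\mathbb{C}$ is the linear map with $\phi_{\mathbf{a}}(\partial_i)=a_i$. A $W_n$-module $M$ is a Whittaker module of type $\phi_{\mathbf{a}}$ if for any $v\in M$ there is $k\in\mathbb{N}$ with $(x-\phi_{\mathbf{a}}(x))^kv=0$ for all $x\in\Delta_n$. Put $\mathrm{Wh}_{\mathbf{a}}(M)=\{v\in M\mid \partial_i v=a_i v,\ i=1,\dots,n\}$. $\Omega_{\mathbf{a}}^W$ is the category of Whittaker $W_n$-modules $M$ of type $\phi_{\mathbf{a}}$ with $\dim\mathrm{Wh}_{\mathbf{a}}(M)<\infty$ (morphisms are $W_n$-module homomorphisms). The right action of $H_{\mathbf{a}}$ on $Q_{\mathbf{a}}$ is $q\cdot h=h(q)$. The left $H_{\mathbf{a}}$-module structure on $\mathrm{Wh}_{\mathbf{a}}(M)$ comes from the identification $\mathrm{Hom}_{W_n}(Q_{\mathbf{a}},M)\cong\mathrm{Wh}_{\mathbf{a}}(M)$, $f\mapsto f(1\otimes1_{\mathbf{a}})$,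 with $H_{\mathbf{a}}$ acting on $\mathrm{Hom}_{W_n}(Q_{\mathbf{a}},M)$ by $h\cdot f=f\circ h$. *)

theory Defs
  imports "HOL-Library.Poly_Mapping" "HOL-Algebra.Algebraic_Closure_Type"
begin

section \<open>Complex vector spaces, algebras and modules\<close>

abbreviation complex_field :: "complex ring" where
  "complex_field \<equiv> ring_of_type_algebra"

text \<open>
  A complex vector space is a HOL-Algebra module over the field of complex numbers. Since the
  record of modules extends that of rings, the same record type serves for complex algebras; for
  plain vector spaces the fields \<open>mult\<close> and \<open>one\<close> carry no meaning.
\<close>

locale complex_algebra = ring A + module complex_field A
  for A :: "(complex, 'a, 'x) module_scheme" (structure) +
  assumes smult_mult_left: "x \<in> carrier A \<Longrightarrow> y \<in> carrier A \<Longrightarrow> (c \<odot> x) \<otimes> y = c \<odot> (x \<otimes> y)"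
    and smult_mult_right: "x \<in> carrier A \<Longrightarrow> y \<in> carrier A \<Longrightarrow> x \<otimes> (c \<odot> y) = c \<odot> (x \<otimes> y)"

record 'l lie = "(complex, 'l) module" +
  bracket :: "'l \<Rightarrow> 'l \<Rightarrow> 'l"

locale lie_algebra = module complex_field L for L :: "'l lie" (structure) +
  assumes bracket_closed: "x \<in> carrier L \<Longrightarrow> y \<in> carrier L \<Longrightarrow> bracket L x y \<in> carrier L"
    and bracket_add_left: "x \<in> carrier L \<Longrightarrow> y \<in> carrier L \<Longrightarrow> z \<in> carrier L \<Longrightarrow>
      bracket L (x \<oplus> y) z = bracket L x z \<oplus> bracket L y z"
    and bracket_add_right: "x \<in> carrier L \<Longrightarrow> y \<in> carrier L \<Longrightarrow> z \<in> carrier L \<Longrightarrow>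
      bracket L x (y \<oplus> z) = bracket L x y \<oplus> bracket L x z"
    and bracket_smult_left: "x \<in> carrier L \<Longrightarrow> y \<in> carrier L \<Longrightarrow>
      bracket L (c \<odot> x) y = c \<odot> bracket L x y"
    and bracket_smult_right: "x \<in> carrier L \<Longrightarrow> y \<in> carrier L \<Longrightarrow>
      bracket L x (c \<odot> y) = c \<odot> bracket L x y"
    and bracket_self: "x \<in> carrier L \<Longrightarrow> bracket L x x = \<zero>"
    and jacobi: "x \<in> carrier L \<Longrightarrow> y \<in> carrier L \<Longrightarrow> z \<in> carrier L \<Longrightarrow>
      bracket L x (bracket L y z) \<oplus> bracket L y (bracket L z x) \<oplus> bracket L z (bracket L x y) = \<zero>"

text \<open>
  A vector space with an action of a set of operators. It is used for modules over Lie algebras and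
  for left and right modules over associative algebras; for right modules, \<open>act M r m\<close> is
  \<open>m \<cdot> r\<close>.
\<close>

record ('r, 'm) act_module = "(complex, 'm) module" +
  act :: "'r \<Rightarrow> 'm \<Rightarrow> 'm"

locale bilinear_action = R: module complex_field R + M: module complex_field M
  for R :: "(complex, 'r, 'x) module_scheme" and M :: "('r, 'm) act_module" +
  assumes act_closed: "r \<in> carrier R \<Longrightarrow> m \<in> carrier M \<Longrightarrow> act M r m \<in> carrier M"
    and act_add_left: "r \<in> carrier R \<Longrightarrow> s \<in> carrier R \<Longrightarrow> m \<in> carrier M \<Longrightarrow>
      act M (r \<oplus>\<^bsub>R\<^esub> s) m = act M r m \<oplus>\<^bsub>M\<^esub> act M s m"
    and act_add_right: "r \<in> carrier R \<Longrightarrow> m \<in> carrier M \<Longrightarrow> m' \<in> carrier M \<Longrightarrow>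
      act M r (m \<oplus>\<^bsub>M\<^esub> m') = act M r m \<oplus>\<^bsub>M\<^esub> act M r m'"
    and act_smult_left: "r \<in> carrier R \<Longrightarrow> m \<in> carrier M \<Longrightarrow>
      act M (c \<odot>\<^bsub>R\<^esub> r) m = c \<odot>\<^bsub>M\<^esub> act M r m"
    and act_smult_right: "r \<in> carrier R \<Longrightarrow> m \<in> carrier M \<Longrightarrow>
      act M r (c \<odot>\<^bsub>M\<^esub> m) = c \<odot>\<^bsub>M\<^esub> act M r m"

locale lie_module = lie_algebra L + bilinear_action L M
  for L :: "'l lie" and M :: "('l, 'm) act_module" +
  assumes act_bracket: "x \<in> carrier L \<Longrightarrow> y \<in> carrier L \<Longrightarrow> m \<in> carrier M \<Longrightarrow>
      act M (bracket L x y) m = act M x (act M y m) \<ominus>\<^bsub>M\<^esub> act M y (act M x m)"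

locale left_module = complex_algebra A + bilinear_action A M
  for A :: "(complex, 'a, 'x) module_scheme" and M :: "('a, 'm) act_module" +
  assumes act_one: "m \<in> carrier M \<Longrightarrow> act M \<one>\<^bsub>A\<^esub> m = m"
    and act_mult: "a \<in> carrier A \<Longrightarrow> b \<in> carrier A \<Longrightarrow> m \<in> carrier M \<Longrightarrow>
      act M (a \<otimes>\<^bsub>A\<^esub> b) m = act M a (act M b m)"

locale right_module = complex_algebra A + bilinear_action A M
  for A :: "(complex, 'a, 'x) module_scheme" and M :: "('a, 'm) act_module" +
  assumes act_one: "m \<in> carrier M \<Longrightarrow> act M \<one>\<^bsub>A\<^esub> m = m"
    and act_mult: "a \<in> carrier A \<Longrightarrow> b \<in> carrier A \<Longrightarrow> m \<in> carrier M \<Longrightarrow>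
      act M (a \<otimes>\<^bsub>A\<^esub> b) m = act M b (act M a m)"

definition with_act :: "(complex, 'm, 'x) module_scheme \<Rightarrow> ('r \<Rightarrow> 'm \<Rightarrow> 'm) \<Rightarrow> ('r, 'm) act_module"
  where "with_act M f =
    \<lparr>carrier = carrier M, monoid.mult = monoid.mult M, monoid.one = monoid.one M,
     ring.zero = ring.zero M, ring.add = ring.add M,
     module.smult = module.smult M, act = f\<rparr>"

definition lin_span :: "(complex, 'm, 'x) module_scheme \<Rightarrow> 'm set \<Rightarrow> 'm set" where
  "lin_span M S = \<Inter>{K. submodule K complex_field M \<and> S \<subseteq> K}"

definition finite_dim :: "(complex, 'm, 'x) module_scheme \<Rightarrow> bool" where
  "finite_dim M \<longleftrightarrow> (\<exists>S. finite S \<and> S \<subseteq> carrier M \<and> lin_span M S = carrier M)"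

text \<open>
  Homomorphisms commuting with the action of the elements of \<open>R\<close>. They are extensional functions,
  so that two of them are equal iff they agree on the carrier of the source.
\<close>

definition act_hom :: "'r set \<Rightarrow> ('r, 'm) act_module \<Rightarrow> ('r, 'n) act_module \<Rightarrow> ('m \<Rightarrow> 'n) set" where
  "act_hom R M N = {f \<in> carrier M \<rightarrow>\<^sub>E carrier N.
     (\<forall>x\<in>carrier M. \<forall>y\<in>carrier M. f (x \<oplus>\<^bsub>M\<^esub> y) = f x \<oplus>\<^bsub>N\<^esub> f y) \<and>
     (\<forall>c. \<forall>x\<in>carrier M. f (c \<odot>\<^bsub>M\<^esub> x) = c \<odot>\<^bsub>N\<^esub> f x) \<and>
     (\<forall>r\<in>R. \<forall>x\<in>carrier M. f (act M r x) = act N r (f x))}"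

definition act_iso :: "'r set \<Rightarrow> ('r, 'm) act_module \<Rightarrow> ('r, 'n) act_module \<Rightarrow> ('m \<Rightarrow> 'n) set" where
  "act_iso R M N = {f \<in> act_hom R M N. bij_betw f (carrier M) (carrier N)}"

definition End_algebra :: "'r set \<Rightarrow> ('r, 'm) act_module \<Rightarrow> (complex, 'm \<Rightarrow> 'm) module" where
  "End_algebra R M =
    \<lparr>carrier = act_hom R M M,
     monoid.mult = (\<lambda>f g. compose (carrier M) f g),
     monoid.one = (\<lambda>x\<in>carrier M. x),
     ring.zero = (\<lambda>x\<in>carrier M. \<zero>\<^bsub>M\<^esub>),
     ring.add = (\<lambda>f g. \<lambda>x\<in>carrier M. f x \<oplus>\<^bsub>M\<^esub> g x),
     module.smult = (\<lambda>c f. \<lambda>x\<in>carrier M. c \<odot>\<^bsub>M\<^esub> f x)\<rparr>"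

definition opposite :: "(complex, 'a) module \<Rightarrow> (complex, 'a) module" where
  "opposite A = A\<lparr>monoid.mult := (\<lambda>x y. y \<otimes>\<^bsub>A\<^esub> x)\<rparr>"

definition right_module_basis ::
  "(complex, 'a, 'x) module_scheme \<Rightarrow> ('a, 'm) act_module \<Rightarrow> 'i set \<Rightarrow> ('i \<Rightarrow> 'm) \<Rightarrow> bool" where
  "right_module_basis A M I b \<longleftrightarrow>
     right_module A M \<and> b \<in> I \<rightarrow> carrier M \<and>
     (\<forall>x\<in>carrier M. \<exists>J c. finite J \<and> J \<subseteq> I \<and> c \<in> J \<rightarrow> carrier A \<and>
        x = (\<Oplus>\<^bsub>M\<^esub>j\<in>J. act M (c j) (b j))) \<and>
     (\<forall>J c. finite J \<and> J \<subseteq> I \<and> c \<in> J \<rightarrow> carrier A \<and>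
        (\<Oplus>\<^bsub>M\<^esub>j\<in>J. act M (c j) (b j)) = \<zero>\<^bsub>M\<^esub> \<longrightarrow> (\<forall>j\<in>J. c j = \<zero>\<^bsub>A\<^esub>))"


section \<open>Tensor products over an algebra\<close>

definition free_space :: "'x set \<Rightarrow> (complex, 'x \<Rightarrow>\<^sub>0 complex) module" where
  "free_space B =
    \<lparr>carrier = {F. Poly_Mapping.keys F \<subseteq> B}, monoid.mult = undefined, monoid.one = undefined,
     ring.zero = 0, ring.add = (+), module.smult = (\<lambda>c. Poly_Mapping.map ((*) c))\<rparr>"

abbreviation pt :: "'x \<Rightarrow> 'x \<Rightarrow>\<^sub>0 complex" where
  "pt x \<equiv> Poly_Mapping.single x 1"

definition free_map :: "('x \<Rightarrow> 'y) \<Rightarrow> ('x \<Rightarrow>\<^sub>0 complex) \<Rightarrow> ('y \<Rightarrow>\<^sub>0 complex)" where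
  "free_map f F = (\<Sum>x\<in>Poly_Mapping.keys F. Poly_Mapping.single (f x) (Poly_Mapping.lookup F x))"

text \<open>
  The map into the quotient by \<open>K\<close> induced by \<open>f\<close>, applied to a coset \<open>B\<close>
  (compare \<^const>\<open>rcoset_mult\<close>).
\<close>

definition coset_map :: "('y, 'z) ring_scheme \<Rightarrow> 'y set \<Rightarrow> ('x \<Rightarrow> 'y) \<Rightarrow> 'x set \<Rightarrow> 'y set" where
  "coset_map S K f B = (\<Union>x\<in>B. K +>\<^bsub>S\<^esub> f x)"

definition quotient_space :: "(complex, 'm) module \<Rightarrow> 'm set \<Rightarrow> (complex, 'm set) module" where
  "quotient_space V K =
    \<lparr>carrier = a_rcosets\<^bsub>V\<^esub> K, monoid.mult = undefined, monoid.one = undefined,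
     ring.zero = K, ring.add = set_add V,
     module.smult = (\<lambda>c. coset_map V K (\<lambda>v. c \<odot>\<^bsub>V\<^esub> v))\<rparr>"

definition tensor_relations ::
  "(complex, 'a) module \<Rightarrow> ('a, 'm) act_module \<Rightarrow> ('a, 'n) act_module \<Rightarrow> ('m \<times> 'n \<Rightarrow>\<^sub>0 complex) set"
  where
  "tensor_relations A M N =
     {pt (x \<oplus>\<^bsub>M\<^esub> x', y) - pt (x, y) - pt (x', y) | x x' y.
        x \<in> carrier M \<and> x' \<in> carrier M \<and> y \<in> carrier N} \<union>
     {pt (x, y \<oplus>\<^bsub>N\<^esub> y') - pt (x, y) - pt (x, y') | x y y'.
        x \<in> carrier M \<and> y \<in> carrier N \<and> y' \<in> carrier N} \<union>
     {pt (c \<odot>\<^bsub>M\<^esub> x, y) - Poly_Mapping.single (x, y) c | c x y. x \<in> carrier M \<and> y \<in> carrier N} \<union>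
     {pt (x, c \<odot>\<^bsub>N\<^esub> y) - Poly_Mapping.single (x, y) c | c x y. x \<in> carrier M \<and> y \<in> carrier N} \<union>
     {pt (act M a x, y) - pt (x, act N a y) | a x y.
        a \<in> carrier A \<and> x \<in> carrier M \<and> y \<in> carrier N}"

definition tensor_kernel ::
  "(complex, 'a) module \<Rightarrow> ('a, 'm) act_module \<Rightarrow> ('a, 'n) act_module \<Rightarrow> ('m \<times> 'n \<Rightarrow>\<^sub>0 complex) set"
  where
  "tensor_kernel A M N = lin_span (free_space (carrier M \<times> carrier N)) (tensor_relations A M N)"

text \<open>The tensor product over \<open>A\<close> of a right module \<open>M\<close> and a left module \<open>N\<close>.\<close>

definition tensor ::
  "(complex, 'a) module \<Rightarrow> ('a, 'm) act_module \<Rightarrow> ('a, 'n) act_module \<Rightarrow>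
   (complex, ('m \<times> 'n \<Rightarrow>\<^sub>0 complex) set) module" where
  "tensor A M N = quotient_space (free_space (carrier M \<times> carrier N)) (tensor_kernel A M N)"

definition pure_tensor ::
  "(complex, 'a) module \<Rightarrow> ('a, 'm) act_module \<Rightarrow> ('a, 'n) act_module \<Rightarrow> 'm \<Rightarrow> 'n \<Rightarrow>
   ('m \<times> 'n \<Rightarrow>\<^sub>0 complex) set" where
  "pure_tensor A M N x y = tensor_kernel A M N +>\<^bsub>free_space (carrier M \<times> carrier N)\<^esub> pt (x, y)"

text \<open>The map \<open>x \<otimes> y \<mapsto> f x \<otimes> g y\<close> from any tensor product over \<open>A\<close> into the one of \<open>M\<close> and \<open>N\<close>.\<close>

definition tensor_map ::
  "(complex, 'a) module \<Rightarrow> ('a, 'm) act_module \<Rightarrow> ('a, 'n) act_module \<Rightarrow>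
   ('k \<Rightarrow> 'm) \<Rightarrow> ('l \<Rightarrow> 'n) \<Rightarrow> ('k \<times> 'l \<Rightarrow>\<^sub>0 complex) set \<Rightarrow> ('m \<times> 'n \<Rightarrow>\<^sub>0 complex) set" where
  "tensor_map A M N f g =
     coset_map (free_space (carrier M \<times> carrier N)) (tensor_kernel A M N) (free_map (map_prod f g))"


section \<open>Universal enveloping algebras\<close>

text \<open>
  Words with concatenation form a monoid, written additively, so that \<open>'l fword \<Rightarrow>\<^sub>0 complex\<close>
  with its convolution product is the free associative algebra on \<open>'l\<close>.
\<close>

datatype 'l fword = FWord (letters: "'l list")

instantiation fword :: (type) monoid_add
begin

definition zero_fword :: "'a fword" where
  "0 = FWord []"

definition plus_fword :: "'a fword \<Rightarrow> 'a fword \<Rightarrow> 'a fword" where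
  "v + w = FWord (letters v @ letters w)"

instance
  by standard (auto simp: zero_fword_def plus_fword_def)

end

definition free_algebra :: "'l set \<Rightarrow> (complex, 'l fword \<Rightarrow>\<^sub>0 complex) module" where
  "free_algebra B =
    \<lparr>carrier = {F. \<forall>w\<in>Poly_Mapping.keys F. set (letters w) \<subseteq> B}, monoid.mult = (*), monoid.one = 1,
     ring.zero = 0,
     ring.add = (+), module.smult = (\<lambda>c. Poly_Mapping.map ((*) c))\<rparr>"

abbreviation letter :: "'l \<Rightarrow> 'l fword \<Rightarrow>\<^sub>0 complex" where
  "letter x \<equiv> pt (FWord [x])"

definition uea_ideal :: "'l lie \<Rightarrow> ('l fword \<Rightarrow>\<^sub>0 complex) set" where
  "uea_ideal L = Idl\<^bsub>free_algebra (carrier L)\<^esub>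
     ({letter (x \<oplus>\<^bsub>L\<^esub> y) - letter x - letter y | x y. x \<in> carrier L \<and> y \<in> carrier L} \<union>
      {letter (c \<odot>\<^bsub>L\<^esub> x) - Poly_Mapping.single (FWord [x]) c | c x. x \<in> carrier L} \<union>
      {letter x * letter y - letter y * letter x - letter (bracket L x y) | x y.
         x \<in> carrier L \<and> y \<in> carrier L})"

definition UEA :: "'l lie \<Rightarrow> (complex, ('l fword \<Rightarrow>\<^sub>0 complex) set) module" where
  "UEA L = ring.extend (free_algebra (carrier L) Quot uea_ideal L)
     (module.fields (\<lambda>c. coset_map (free_algebra (carrier L)) (uea_ideal L)
        (\<lambda>F. c \<odot>\<^bsub>free_algebra (carrier L)\<^esub> F)))"

definition uea_incl :: "'l lie \<Rightarrow> 'l \<Rightarrow> ('l fword \<Rightarrow>\<^sub>0 complex) set" where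
  "uea_incl L x = uea_ideal L +>\<^bsub>free_algebra (carrier L)\<^esub> letter x"

text \<open>
  A module over a Lie algebra as a module over its enveloping algebra: a word \<open>x\<^sub>1 \<dots> x\<^sub>k\<close> acts by
  \<open>v \<mapsto> x\<^sub>1 (\<dots> (x\<^sub>k v))\<close>.
\<close>

definition uea_module ::
  "('l, 'm) act_module \<Rightarrow> (('l fword \<Rightarrow>\<^sub>0 complex) set, 'm) act_module" where
  "uea_module M = with_act M (\<lambda>B v. the_elem
     ((\<lambda>F. \<Oplus>\<^bsub>M\<^esub>w\<in>Poly_Mapping.keys F. Poly_Mapping.lookup F w \<odot>\<^bsub>M\<^esub> foldr (act M) (letters w) v) ` B))"

text \<open>
  For a Lie subalgebra \<open>K\<close> of \<open>L\<close>, \<open>U(L)\<close> is a right \<open>U(K)\<close>-module through the homomorphism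
  \<open>U(K) \<rightarrow> U(L)\<close> induced by the inclusion; both algebras consist of cosets of elements of the free
  algebra on the same type.
\<close>

definition uea_right_module ::
  "'l lie \<Rightarrow> (('l fword \<Rightarrow>\<^sub>0 complex) set, ('l fword \<Rightarrow>\<^sub>0 complex) set) act_module" where
  "uea_right_module L = with_act (UEA L)
     (\<lambda>s u. u \<otimes>\<^bsub>UEA L\<^esub> coset_map (free_algebra (carrier L)) (uea_ideal L) (\<lambda>F. F) s)"

type_synonym ('l, 'm) induced = "(('l fword \<Rightarrow>\<^sub>0 complex) set \<times> 'm \<Rightarrow>\<^sub>0 complex) set"

text \<open>The \<open>L\<close>-module \<open>U(L) \<otimes>\<^bsub>U(K)\<^esub> M\<close> induced from a module \<open>M\<close> over a Lie subalgebra \<open>K\<close>.\<close>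

definition induced_module ::
  "'l lie \<Rightarrow> 'l lie \<Rightarrow> ('l, 'm) act_module \<Rightarrow> ('l, ('l, 'm) induced) act_module" where
  "induced_module L K M =
     with_act (tensor (UEA K) (uea_right_module L) (uea_module M))
       (\<lambda>x. tensor_map (UEA K) (uea_right_module L) (uea_module M)
          (\<lambda>u. uea_incl L x \<otimes>\<^bsub>UEA L\<^esub> u) (\<lambda>v. v))"


section \<open>Derivations of the polynomial ring\<close>

text \<open>
  The index set \<open>{1, \<dots>, n}\<close> is a finite linearly ordered type \<^typ>\<open>'n\<close>; it is nonempty, as all types
  are. Polynomials in \<open>t\<^sub>i\<close> are finitely supported families of coefficients indexed by exponents.
\<close>

type_synonym 'n cpoly = "('n \<Rightarrow>\<^sub>0 nat) \<Rightarrow>\<^sub>0 complex"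
type_synonym 'n der = "'n cpoly \<Rightarrow> 'n cpoly"

definition const :: "complex \<Rightarrow> 'n cpoly" where
  "const c = Poly_Mapping.single 0 c"

definition var :: "'n \<Rightarrow> 'n cpoly" where
  "var i = Poly_Mapping.single (Poly_Mapping.single i 1) 1"

definition partial :: "'n \<Rightarrow> 'n der" where
  "partial i p = (\<Sum>m\<in>Poly_Mapping.keys p. Poly_Mapping.single (m - Poly_Mapping.single i 1)
     (of_nat (Poly_Mapping.lookup m i) * Poly_Mapping.lookup p m))"

definition is_derivation :: "'n der \<Rightarrow> bool" where
  "is_derivation D \<longleftrightarrow>
     (\<forall>p q. D (p + q) = D p + D q) \<and>
     (\<forall>c p. D (const c * p) = const c * D p) \<and>
     (\<forall>p q. D (p * q) = D p * q + p * D q)"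

definition Wn :: "'n der lie" where
  "Wn = \<lparr>carrier = {D. is_derivation D}, monoid.mult = undefined, monoid.one = undefined,
     ring.zero = (\<lambda>p. 0), ring.add = (\<lambda>D E p. D p + E p), module.smult = (\<lambda>c D p. const c * D p),
     bracket = (\<lambda>D E p. D (E p) - E (D p))\<rparr>"

definition Delta :: "('n::finite) der lie" where
  "Delta = Wn\<lparr>carrier := lin_span Wn (range partial)\<rparr>"

definition euler :: "'n \<Rightarrow> 'n der" where
  "euler i p = var i * partial i p"

text \<open>
  The coefficient of \<open>\<partial>\<^sub>i\<close> in \<open>x \<in> \<Delta>\<close> is the constant polynomial \<open>x t\<^sub>i\<close>; hence \<open>phi a\<close> is the linear
  map on \<open>\<Delta>\<close> sending each \<open>\<partial>\<^sub>i\<close> to \<open>a i\<close>.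
\<close>

definition phi :: "('n::finite \<Rightarrow> complex) \<Rightarrow> 'n der \<Rightarrow> complex" where
  "phi a x = (\<Sum>i\<in>UNIV. a i * Poly_Mapping.lookup (x (var i)) 0)"

text \<open>The factors of \<open>h\<^sup>m\<close> commute, but \<open>U(Wn)\<close> does not, so they are multiplied in increasing order.\<close>

definition euler_monomial ::
  "('n::{finite,linorder} \<Rightarrow> nat) \<Rightarrow> ('n der fword \<Rightarrow>\<^sub>0 complex) set" where
  "euler_monomial m =
     foldr (\<lambda>i u. (uea_incl Wn (euler i) [^]\<^bsub>UEA Wn\<^esub> m i) \<otimes>\<^bsub>UEA Wn\<^esub> u)
       (sorted_list_of_set UNIV) \<one>\<^bsub>UEA Wn\<^esub>"


section \<open>Whittaker modules\<close>

definition one_dim :: "('n::finite \<Rightarrow> complex) \<Rightarrow> ('n der, complex) act_module" where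
  "one_dim a =
    \<lparr>carrier = UNIV, monoid.mult = (*), monoid.one = 1,
     ring.zero = 0, ring.add = (+), module.smult = (*),
     act = (\<lambda>x z. phi a x * z)\<rparr>"

type_synonym 'n qtype = "('n der, complex) induced"

definition Qa :: "('n::finite \<Rightarrow> complex) \<Rightarrow> ('n der, 'n qtype) act_module" where
  "Qa a = induced_module Wn Delta (one_dim a)"

definition q_tensor ::
  "('n::finite \<Rightarrow> complex) \<Rightarrow> ('n der fword \<Rightarrow>\<^sub>0 complex) set \<Rightarrow> complex \<Rightarrow> 'n qtype" where
  "q_tensor a = pure_tensor (UEA Delta) (uea_right_module Wn) (uea_module (one_dim a))"

definition Ha :: "('n::finite \<Rightarrow> complex) \<Rightarrow> (complex, 'n qtype \<Rightarrow> 'n qtype) module" where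
  "Ha a = opposite (End_algebra (carrier Wn) (Qa a))"

definition Q_right :: "('n::finite \<Rightarrow> complex) \<Rightarrow> ('n qtype \<Rightarrow> 'n qtype, 'n qtype) act_module" where
  "Q_right a = with_act (Qa a) (\<lambda>h q. h q)"

definition whittaker_module :: "('n::finite \<Rightarrow> complex) \<Rightarrow> ('n der, 'm) act_module \<Rightarrow> bool" where
  "whittaker_module a M \<longleftrightarrow> lie_module Wn M \<and>
     (\<forall>v\<in>carrier M. \<exists>k. \<forall>x\<in>carrier Delta.
        ((\<lambda>u. act M x u \<ominus>\<^bsub>M\<^esub> phi a x \<odot>\<^bsub>M\<^esub> u) ^^ k) v = \<zero>\<^bsub>M\<^esub>)"

definition whittaker_vectors :: "('n::finite \<Rightarrow> complex) \<Rightarrow> ('n der, 'm) act_module \<Rightarrow> 'm set" where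
  "whittaker_vectors a M = {v \<in> carrier M. \<forall>i. act M (partial i) v = a i \<odot>\<^bsub>M\<^esub> v}"

text \<open>
  The left \<open>Ha\<close>-module of Whittaker vectors. A vector \<open>w\<close> corresponds to the homomorphism \<open>f\<close> from
  \<open>Qa a\<close> to \<open>M\<close> with \<open>f (1 \<otimes> 1) = w\<close>, and \<open>h \<cdot> w\<close> is the vector corresponding to \<open>f \<circ> h\<close>.
\<close>

definition Wh ::
  "('n::finite \<Rightarrow> complex) \<Rightarrow> ('n der, 'm) act_module \<Rightarrow> ('n qtype \<Rightarrow> 'n qtype, 'm) act_module" where
  "Wh a M = with_act (M\<lparr>carrier := whittaker_vectors a M\<rparr>)
     (\<lambda>h w. (THE f. f \<in> act_hom (carrier Wn) (Qa a) M \<and> f (q_tensor a \<one>\<^bsub>UEA Wn\<^esub> 1) = w)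
        (h (q_tensor a \<one>\<^bsub>UEA Wn\<^esub> 1)))"

definition Wh_map ::
  "('n::finite \<Rightarrow> complex) \<Rightarrow> ('n der, 'm) act_module \<Rightarrow> ('n der, 'k) act_module \<Rightarrow>
   ('m \<Rightarrow> 'k) \<Rightarrow> 'm \<Rightarrow> 'k" where
  "Wh_map a M N f = restrict f (carrier (Wh a M))"

type_synonym ('n, 'v) ttype = "('n qtype \<times> 'v \<Rightarrow>\<^sub>0 complex) set"

definition QT ::
  "('n::finite \<Rightarrow> complex) \<Rightarrow> ('n qtype \<Rightarrow> 'n qtype, 'v) act_module \<Rightarrow>
   ('n der, ('n, 'v) ttype) act_module" where
  "QT a V = with_act (tensor (Ha a) (Q_right a) V)
     (\<lambda>x. tensor_map (Ha a) (Q_right a) V (act (Qa a) x) (\<lambda>v. v))"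

definition QT_map ::
  "('n::finite \<Rightarrow> complex) \<Rightarrow> ('n qtype \<Rightarrow> 'n qtype, 'v) act_module \<Rightarrow>
   ('n qtype \<Rightarrow> 'n qtype, 'w) act_module \<Rightarrow> ('v \<Rightarrow> 'w) \<Rightarrow> ('n, 'v) ttype \<Rightarrow> ('n, 'w) ttype" where
  "QT_map a V V' g = restrict (tensor_map (Ha a) (Q_right a) V' (\<lambda>q. q) g) (carrier (QT a V))"

text \<open>
  The objects of the category of Whittaker modules with finite dimensional space of Whittaker
  vectors, and of the category of finite dimensional \<open>Ha\<close>-modules.
\<close>

definition Omega :: "('n::finite \<Rightarrow> complex) \<Rightarrow> ('n der, 'm) act_module set" where
  "Omega a = {M. whittaker_module a M \<and> finite_dim (M\<lparr>carrier := whittaker_vectors a M\<rparr>)}"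

definition H_mod :: "('n::finite \<Rightarrow> complex) \<Rightarrow> ('n qtype \<Rightarrow> 'n qtype, 'v) act_module set" where
  "H_mod a = {V. left_module (Ha a) V \<and> finite_dim V}"


section \<open>Functors between categories of modules\<close>

text \<open>
  A pair of a set \<open>C\<close> of objects and a set \<open>R\<close> of operators stands for the category with objects \<open>C\<close>
  and morphisms \<^term>\<open>act_hom R\<close>; composition is composition of functions. The isomorphisms that
  make up a natural transformation may relate modules with carriers in different types.
\<close>

definition module_functor ::
  "('r, 'm) act_module set \<Rightarrow> 'r set \<Rightarrow> ('s, 'n) act_module set \<Rightarrow> 's set \<Rightarrow>
   (('r, 'm) act_module \<Rightarrow> ('s, 'n) act_module) \<Rightarrow>
   (('r, 'm) act_module \<Rightarrow> ('r, 'm) act_module \<Rightarrow> ('m \<Rightarrow> 'm) \<Rightarrow> 'n \<Rightarrow> 'n) \<Rightarrow> bool" where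
  "module_functor C R D S F Fm \<longleftrightarrow>
     (\<forall>M\<in>C. F M \<in> D) \<and>
     (\<forall>M\<in>C. \<forall>N\<in>C. \<forall>f\<in>act_hom R M N. Fm M N f \<in> act_hom S (F M) (F N)) \<and>
     (\<forall>M\<in>C. Fm M M (\<lambda>x\<in>carrier M. x) = (\<lambda>y\<in>carrier (F M). y)) \<and>
     (\<forall>M\<in>C. \<forall>N\<in>C. \<forall>P\<in>C. \<forall>f\<in>act_hom R M N. \<forall>g\<in>act_hom R N P.
        Fm M P (compose (carrier M) g f) = compose (carrier (F M)) (Fm N P g) (Fm M N f))"

definition natural_iso ::
  "('r, 'm) act_module set \<Rightarrow> 'r set \<Rightarrow> 's set \<Rightarrow>
   (('r, 'm) act_module \<Rightarrow> ('s, 'n) act_module) \<Rightarrow>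
   (('r, 'm) act_module \<Rightarrow> ('r, 'm) act_module \<Rightarrow> ('m \<Rightarrow> 'm) \<Rightarrow> 'n \<Rightarrow> 'n) \<Rightarrow>
   (('r, 'm) act_module \<Rightarrow> ('s, 'k) act_module) \<Rightarrow>
   (('r, 'm) act_module \<Rightarrow> ('r, 'm) act_module \<Rightarrow> ('m \<Rightarrow> 'm) \<Rightarrow> 'k \<Rightarrow> 'k) \<Rightarrow>
   (('r, 'm) act_module \<Rightarrow> 'n \<Rightarrow> 'k) \<Rightarrow> bool" where
  "natural_iso C R S F Fm G Gm \<eta> \<longleftrightarrow>
     (\<forall>M\<in>C. \<eta> M \<in> act_iso S (F M) (G M)) \<and>
     (\<forall>M\<in>C. \<forall>N\<in>C. \<forall>f\<in>act_hom R M N.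
        compose (carrier (F M)) (\<eta> N) (Fm M N f) = compose (carrier (F M)) (Gm M N f) (\<eta> M))"

end

theory Submission
  imports Defs
begin

text \<open>
  On a Whittaker module the operators \<open>D\<^sub>i = \<partial>\<^sub>i - a\<^sub>i\<close> are locally nilpotent, commute with each
  other and with \<open>h\<^sub>j\<close> for \<open>j \<noteq> i\<close>, and satisfy \<open>D\<^sub>i h\<^sub>i = h\<^sub>i D\<^sub>i + D\<^sub>i + a\<^sub>i\<close>. Hence \<open>D\<^sub>i\<^sup>k h\<^sub>i\<^sup>k\<close> acts on the
  Whittaker vectors as the scalar \<open>k! a\<^sub>i\<^sup>k\<close>, which is nonzero since \<open>a\<^sub>i \<noteq> 0\<close>, and it follows that every
  element \<open>v\<close> of a Whittaker module \<open>M\<close> has a unique finite expansion \<open>v = \<Sum>\<^sub>m h\<^sup>m w\<^sub>m\<close> with Whittaker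
  vectors \<open>w\<^sub>m\<close>. The module \<open>Q\<close> is itself a Whittaker module, because \<open>\<partial>\<^sub>i\<close> acts locally nilpotently
  on \<open>W\<^sub>n\<close> by the adjoint action, and by the universal property of \<open>Q\<close> its Whittaker vectors are
  the \<open>h (1 \<otimes> 1)\<close> for \<open>h\<close> in \<open>H\<close>; so its expansion is part (a), and no Poincare-Birkhoff-Witt theorem is needed.
  Expansions are preserved by homomorphisms, so a homomorphism of Whittaker modules is bijective
  as soon as it is so on Whittaker vectors. The Whittaker vectors of \<open>Q \<otimes>\<^bsub>H\<^esub> V\<close> are the \<open>1 \<otimes> v\<close>
  for unique \<open>v\<close> in \<open>V\<close>, which yields both natural isomorphisms of part (b).
\<close>

text \<open>The relation between D_i and h_i is [\<open>partial i\<close>, h_i] =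
  \<open>partial i\<close>, rewritten with \<open>partial i\<close> = D_i + a_i. On a vector killed
  by D_i the commutator is the scalar a_i, so up to terms of lower order D_i differentiates powers
  of h_i. Only such operator identities enter the decomposition, which is therefore proved for
  abstract families of linear operators and then instantiated for M, for Q and for the tensor
  product. The obstacle is that Q and its tensor products are quotients by generated subspaces,
  where nonvanishing cannot be read off from the relations. Linear independence is instead forced by
  applying the D_i, and injectivity of v to 1 tensor v comes from an explicit retraction: q tensor v
  is sent to the coefficient of q at exponent 0, viewed as an element of H, applied to v. Equations
  in H become equations between Whittaker vectors, since an endomorphism of the cyclic module Q is
  determined by its value at 1 tensor 1.\<close>

lemma complex_field_simps [simp]:
  "carrier complex_field = UNIV"
  "x \<oplus>\<^bsub>complex_field\<^esub> y = x + y"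
  "x \<otimes>\<^bsub>complex_field\<^esub> y = x * y"
  "\<zero>\<^bsub>complex_field\<^esub> = 0"
  "\<one>\<^bsub>complex_field\<^esub> = 1"
  by (simp_all add: ring_of_type_algebra_def)

section \<open>Complex vector spaces, subspaces and linear maps\<close>

locale cspace = module complex_field M for M :: "(complex, 'm, 'x) module_scheme" (structure)
begin

lemma smult_in [simp, intro]: "x \<in> carrier M \<Longrightarrow> c \<odot> x \<in> carrier M"
  by simp

lemma smult_add_left: "x \<in> carrier M \<Longrightarrow> (c + d) \<odot> x = c \<odot> x \<oplus> d \<odot> x"
  using smult_l_distr[of c d x] by simp

lemma smult_add_right: "x \<in> carrier M \<Longrightarrow> y \<in> carrier M \<Longrightarrow> c \<odot> (x \<oplus> y) = c \<odot> x \<oplus> c \<odot> y"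
  using smult_r_distr[of c x y] by simp

lemma smult_smult: "x \<in> carrier M \<Longrightarrow> c \<odot> (d \<odot> x) = (c * d) \<odot> x"
  using smult_assoc1[of c d x] by simp

lemma smult_1 [simp]: "x \<in> carrier M \<Longrightarrow> 1 \<odot> x = x"
  using smult_one[of x] by simp

lemma smult_0 [simp]: "x \<in> carrier M \<Longrightarrow> 0 \<odot> x = \<zero>"
  using smult_l_null[of x] by simp

lemma smult_zero_right [simp]: "c \<odot> \<zero> = \<zero>"
  using smult_r_null[of c] by simp

lemma minus_eq_smult: "x \<in> carrier M \<Longrightarrow> \<ominus> x = (- 1) \<odot> x"
  by (rule minus_equality) (use smult_add_left[of x "-1" 1] in simp_all)

lemma diff_eq_smult: "x \<in> carrier M \<Longrightarrow> y \<in> carrier M \<Longrightarrow> x \<ominus> y = x \<oplus> (- 1) \<odot> y"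
  by (simp add: a_minus_def minus_eq_smult)

lemma diff_eq_zero_iff:
  assumes "x \<in> carrier M" "y \<in> carrier M" shows "x \<ominus> y = \<zero> \<longleftrightarrow> x = y"
proof
  assume "x \<ominus> y = \<zero>"
  then have "(x \<ominus> y) \<oplus> y = \<zero> \<oplus> y" by simp
  then show "x = y" using assms by (simp add: a_minus_def a_assoc l_neg)
qed (use assms in \<open>simp add: a_minus_def r_neg\<close>)

lemma add_diff_cancel:
  assumes "x \<in> carrier M" "y \<in> carrier M" shows "y \<oplus> (x \<ominus> y) = x"
  using assms a_comm[of y "x \<ominus> y"] by (simp add: a_minus_def a_assoc l_neg)

lemma add_diff_diff:
  assumes "x \<in> carrier M" "y \<in> carrier M" shows "(x \<oplus> y) \<ominus> x \<ominus> y = \<zero>"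
proof -
  have "(x \<oplus> y) \<ominus> x = y"
    using assms a_comm[of x y] by (simp add: a_minus_def a_assoc r_neg)
  then show ?thesis using assms by (simp add: diff_eq_zero_iff)
qed

lemma subspaceI:
  assumes "S \<subseteq> carrier M" "\<zero> \<in> S" "\<And>x y. x \<in> S \<Longrightarrow> y \<in> S \<Longrightarrow> x \<oplus> y \<in> S"
    "\<And>c x. x \<in> S \<Longrightarrow> c \<odot> x \<in> S"
  shows "submodule S complex_field M"
  using assms minus_eq_smult by (intro submoduleI) (auto simp: subset_iff)

lemma subspace_zero: "submodule S complex_field M \<Longrightarrow> \<zero> \<in> S"
  using subgroup.one_closed[OF submodule.axioms(1)] by fastforce

lemma subspace_smult: "submodule S complex_field M \<Longrightarrow> x \<in> S \<Longrightarrow> c \<odot> x \<in> S"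
  using submodule.smult_closed[of S complex_field M c x] by simp

lemma lin_span_submodule:
  assumes "S \<subseteq> carrier M" shows "submodule (lin_span M S) complex_field M"
proof (rule subspaceI)
  show "lin_span M S \<subseteq> carrier M"
    unfolding lin_span_def using assms carrier_is_submodule by blast
qed (auto simp: lin_span_def submoduleE(5) subspace_zero subspace_smult)

lemma lin_span_superset: "S \<subseteq> lin_span M S"
  unfolding lin_span_def by blast

lemma lin_span_least: "submodule K complex_field M \<Longrightarrow> S \<subseteq> K \<Longrightarrow> lin_span M S \<subseteq> K"
  unfolding lin_span_def by blast

lemma lin_span_in: "S \<subseteq> carrier M \<Longrightarrow> x \<in> lin_span M S \<Longrightarrow> x \<in> carrier M"
  using submoduleE(1)[OF lin_span_submodule] by blast

lemma lin_span_induct [consumes 2, case_names base zero add smult]: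
  assumes "x \<in> lin_span M S" "S \<subseteq> carrier M" "\<And>x. x \<in> S \<Longrightarrow> P x" "P \<zero>"
    "\<And>x y. x \<in> carrier M \<Longrightarrow> y \<in> carrier M \<Longrightarrow> P x \<Longrightarrow> P y \<Longrightarrow> P (x \<oplus> y)"
    "\<And>c x. x \<in> carrier M \<Longrightarrow> P x \<Longrightarrow> P (c \<odot> x)"
  shows "P x"
proof -
  have "submodule {x \<in> carrier M. P x} complex_field M"
    using assms by (intro subspaceI) auto
  then have "lin_span M S \<subseteq> {x \<in> carrier M. P x}"
    using assms by (intro lin_span_least) auto
  then show ?thesis using assms(1) by blast
qed

end

lemma cspaceI: "module complex_field M \<Longrightarrow> cspace M"
  by (rule cspace.intro)

text \<open>Additive inverses come for free: (-1) times x is one, by distributivity and the laws for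
  the scalars 1 and 0.\<close>

lemma cspace_fieldsI:
  fixes M (structure)
  assumes "\<And>x y. x \<in> carrier M \<Longrightarrow> y \<in> carrier M \<Longrightarrow> x \<oplus> y \<in> carrier M"
    and "\<zero> \<in> carrier M"
    and "\<And>x y z. x \<in> carrier M \<Longrightarrow> y \<in> carrier M \<Longrightarrow> z \<in> carrier M \<Longrightarrow> (x \<oplus> y) \<oplus> z = x \<oplus> (y \<oplus> z)"
    and "\<And>x y. x \<in> carrier M \<Longrightarrow> y \<in> carrier M \<Longrightarrow> x \<oplus> y = y \<oplus> x"
    and zero: "\<And>x. x \<in> carrier M \<Longrightarrow> \<zero> \<oplus> x = x"
    and sm: "\<And>c x. x \<in> carrier M \<Longrightarrow> c \<odot> x \<in> carrier M"
    and l: "\<And>c d x. x \<in> carrier M \<Longrightarrow> (c + d) \<odot> x = c \<odot> x \<oplus> d \<odot> x"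
    and "\<And>c x y. x \<in> carrier M \<Longrightarrow> y \<in> carrier M \<Longrightarrow> c \<odot> (x \<oplus> y) = c \<odot> x \<oplus> c \<odot> y"
    and "\<And>c d x. x \<in> carrier M \<Longrightarrow> (c * d) \<odot> x = c \<odot> (d \<odot> x)"
    and one: "\<And>x. x \<in> carrier M \<Longrightarrow> 1 \<odot> x = x"
    and nul: "\<And>x. x \<in> carrier M \<Longrightarrow> 0 \<odot> x = \<zero>"
  shows "cspace M"
proof (rule cspaceI, rule moduleI)
  show "abelian_group M"
  proof (rule abelian_groupI)
    fix x assume x: "x \<in> carrier M"
    have "(- 1) \<odot> x \<oplus> x = \<zero>"
      using l[OF x, of "-1" 1] one[OF x] nul[OF x] by simp
    then show "\<exists>y\<in>carrier M. y \<oplus> x = \<zero>" using sm[OF x] by blast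
  qed (use assms in auto)
qed (use assms cring_from_type_algebra in auto)

text \<open>In contrast to members of \<open>act_hom\<close>, the map need not be extensional, so
  lambda terms and composites qualify as they stand; a restriction to the carrier is taken only when
  a morphism of one of the categories is formed.\<close>

locale clin = M: cspace M + N: cspace N
  for M :: "(complex, 'm, 'x) module_scheme" and N :: "(complex, 'n, 'y) module_scheme"
    and f :: "'m \<Rightarrow> 'n" +
  assumes closed [simp, intro]: "x \<in> carrier M \<Longrightarrow> f x \<in> carrier N"
    and add: "x \<in> carrier M \<Longrightarrow> y \<in> carrier M \<Longrightarrow> f (x \<oplus>\<^bsub>M\<^esub> y) = f x \<oplus>\<^bsub>N\<^esub> f y"
    and smult: "x \<in> carrier M \<Longrightarrow> f (c \<odot>\<^bsub>M\<^esub> x) = c \<odot>\<^bsub>N\<^esub> f x"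
begin

lemma zero: "f \<zero>\<^bsub>M\<^esub> = \<zero>\<^bsub>N\<^esub>"
  using smult[of "\<zero>\<^bsub>M\<^esub>" 0] by simp

lemma diff: "x \<in> carrier M \<Longrightarrow> y \<in> carrier M \<Longrightarrow> f (x \<ominus>\<^bsub>M\<^esub> y) = f x \<ominus>\<^bsub>N\<^esub> f y"
  by (simp add: M.diff_eq_smult N.diff_eq_smult add smult)

lemma finsum: "g \<in> A \<rightarrow> carrier M \<Longrightarrow> f (\<Oplus>\<^bsub>M\<^esub>i\<in>A. g i) = (\<Oplus>\<^bsub>N\<^esub>i\<in>A. f (g i))"
  by (induction A rule: infinite_finite_induct) (auto simp: zero add Pi_iff)

lemma kernel_submodule: "submodule {x \<in> carrier M. f x = \<zero>\<^bsub>N\<^esub>} complex_field M"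
  by (rule M.subspaceI) (auto simp: zero add smult)

lemma vimage_submodule:
  assumes "submodule K complex_field N"
  shows "submodule {x \<in> carrier M. f x \<in> K} complex_field M"
  by (rule M.subspaceI)
    (auto simp: zero add smult N.submoduleE(5)[OF assms] N.subspace_smult[OF assms] N.subspace_zero[OF assms])

lemma inj_onI: "(\<And>x. x \<in> carrier M \<Longrightarrow> f x = \<zero>\<^bsub>N\<^esub> \<Longrightarrow> x = \<zero>\<^bsub>M\<^esub>) \<Longrightarrow> inj_on f (carrier M)"
  by (rule inj_onI) (metis M.diff_eq_zero_iff N.diff_eq_zero_iff closed diff M.minus_closed)

text \<open>The preimage of the span of the image of \<open>S\<close> is a subspace containing
  \<open>S\<close>, hence everything.\<close>

lemma finite_dim_image:
  assumes "f ` carrier M = carrier N" "finite_dim M"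
  shows "finite_dim N"
proof -
  obtain S where S: "finite S" "S \<subseteq> carrier M" "lin_span M S = carrier M"
    using assms(2) by (auto simp: finite_dim_def)
  have S': "f ` S \<subseteq> carrier N" using S by auto
  have "lin_span M S \<subseteq> {x \<in> carrier M. f x \<in> lin_span N (f ` S)}"
    using S N.lin_span_superset[of "f ` S"]
    by (intro M.lin_span_least vimage_submodule N.lin_span_submodule S') auto
  then have "carrier N \<subseteq> lin_span N (f ` S)" using S(3) unfolding assms(1)[symmetric] by blast
  then have "lin_span N (f ` S) = carrier N"
    using N.lin_span_in[OF S'] by blast
  then show ?thesis using S' S unfolding finite_dim_def by blast
qed

end

lemma clin_comp: "clin M N f \<Longrightarrow> clin N P g \<Longrightarrow> clin M P (\<lambda>x. g (f x))"
  unfolding clin_def clin_axioms_def by simp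

lemma clin_id: "cspace M \<Longrightarrow> clin M M (\<lambda>x. x)"
  unfolding clin_def clin_axioms_def by simp

lemma clin_zero: "cspace M \<Longrightarrow> cspace N \<Longrightarrow> clin M N (\<lambda>x. \<zero>\<^bsub>N\<^esub>)"
  unfolding clin_def clin_axioms_def by (simp add: cspace.smult_zero_right
    abelian_monoid.zero_closed abelian_monoid.l_zero cspace_def module_def abelian_group_def)

lemma clin_funpow: "clin M M f \<Longrightarrow> clin M M (f ^^ k)"
proof (induction k)
  case 0 then show ?case using clin_id[OF clin.axioms(1)[OF 0]] by (simp add: id_def)
next
  case (Suc k) then show ?case using clin_comp[of M M "f ^^ k" M f] by (simp add: o_def)
qed

lemma clin_add:
  assumes "clin M N f" "clin M N g" shows "clin M N (\<lambda>x. f x \<oplus>\<^bsub>N\<^esub> g x)"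
proof -
  interpret f: clin M N f by fact
  interpret g: clin M N g by fact
  show ?thesis
    by unfold_locales (auto simp: f.add g.add f.smult g.smult f.N.smult_add_right f.N.a_ac)
qed

lemma clin_smult:
  assumes "clin M N f" shows "clin M N (\<lambda>x. c \<odot>\<^bsub>N\<^esub> f x)"
proof -
  interpret f: clin M N f by fact
  show ?thesis
    by unfold_locales (auto simp: f.add f.smult f.N.smult_add_right f.N.smult_smult mult.commute)
qed

lemma clin_diff:
  assumes "clin M N f" "clin M N g" shows "clin M N (\<lambda>x. f x \<ominus>\<^bsub>N\<^esub> g x)"
proof -
  interpret f: clin M N f by fact
  interpret g: clin M N g by fact
  interpret h: clin M N "\<lambda>x. f x \<oplus>\<^bsub>N\<^esub> (- 1) \<odot>\<^bsub>N\<^esub> g x"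
    by (rule clin_add[OF assms(1) clin_smult[OF assms(2)]])
  have eq: "f x \<ominus>\<^bsub>N\<^esub> g x = f x \<oplus>\<^bsub>N\<^esub> (- 1) \<odot>\<^bsub>N\<^esub> g x" if "x \<in> carrier M" for x
    using that by (simp add: f.N.diff_eq_smult)
  show ?thesis
    by unfold_locales (simp_all add: eq h.add h.smult)
qed

lemma clin_cong:
  assumes "clin M N f" "\<And>x. x \<in> carrier M \<Longrightarrow> g x = f x" shows "clin M N g"
proof -
  interpret f: clin M N f by fact
  show ?thesis by unfold_locales (auto simp: assms(2) f.add f.smult)
qed

text \<open>Serves for maps out of a quotient: \<open>f\<close> is the projection, and linearity of
  \<open>g\<close> is read off on representatives, where \<open>g\<close> becomes the linear map
  \<open>h\<close>.\<close>

lemma clin_image_linear: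
  assumes "clin M N f" "cspace P" "\<And>x. x \<in> carrier M \<Longrightarrow> g (f x) = h x" "f ` carrier M = carrier N"
    "clin M P h"
  shows "clin N P g"
proof -
  interpret f: clin M N f by fact
  interpret h: clin M P h by fact
  interpret P: cspace P by fact
  show ?thesis
  proof unfold_locales
    fix x y c assume "x \<in> carrier N" 
    then obtain x' where x: "x' \<in> carrier M" "x = f x'" using assms(4) by blast
    show "g x \<in> carrier P" using x assms(3) by auto
    show "g (c \<odot>\<^bsub>N\<^esub> x) = c \<odot>\<^bsub>P\<^esub> g x"
      using x assms(3) h.smult f.smult[symmetric] by auto
    assume "y \<in> carrier N" 
    then obtain y' where y: "y' \<in> carrier M" "y = f y'" using assms(4) by blast
    show "g (x \<oplus>\<^bsub>N\<^esub> y) = g x \<oplus>\<^bsub>P\<^esub> g y"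
      using x y assms(3) h.add f.add[symmetric] by auto
  qed
qed

lemma act_hom_clin: "f \<in> act_hom R M N \<Longrightarrow> cspace M \<Longrightarrow> cspace N \<Longrightarrow> clin M N f"
  unfolding act_hom_def clin_def clin_axioms_def by (auto simp: PiE_iff)

lemma act_homD: "f \<in> act_hom R M N \<Longrightarrow> r \<in> R \<Longrightarrow> x \<in> carrier M \<Longrightarrow> f (act M r x) = act N r (f x)"
  unfolding act_hom_def by auto

lemma act_homI:
  assumes "clin M N f" "\<And>r x. r \<in> R \<Longrightarrow> x \<in> carrier M \<Longrightarrow> f (act M r x) = act N r (f x)"
    "f \<in> extensional (carrier M)"
  shows "f \<in> act_hom R M N"
  using assms unfolding act_hom_def clin_def clin_axioms_def by (auto simp: PiE_iff)

lemma act_hom_restrictI: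
  assumes "clin M N f" "\<And>r x. r \<in> R \<Longrightarrow> x \<in> carrier M \<Longrightarrow> f (act M r x) = act N r (f x)"
    "\<And>r x. r \<in> R \<Longrightarrow> x \<in> carrier M \<Longrightarrow> act M r x \<in> carrier M"
  shows "restrict f (carrier M) \<in> act_hom R M N"
  using assms by (intro act_homI) (auto intro: clin_cong)

lemma act_hom_ext:
  assumes "f \<in> act_hom R M N" "g \<in> act_hom R M N'" "\<And>x. x \<in> carrier M \<Longrightarrow> f x = g x"
  shows "f = g"
  using assms unfolding act_hom_def by (auto simp: PiE_iff intro: extensionalityI)

section \<open>Free spaces, quotients and tensor products\<close>

text \<open>
  The locale lists the fields so that it also applies to the space underlying \<^const>\<open>free_algebra\<close>;
  likewise \<open>qspace\<close> below covers both \<^const>\<open>quotient_space\<close> and \<^const>\<open>UEA\<close>.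
\<close>

locale fspace =
  fixes M :: "(complex, 'x \<Rightarrow>\<^sub>0 complex, 'y) module_scheme" and B :: "'x set"
  assumes carrier_eq: "carrier M = {F. Poly_Mapping.keys F \<subseteq> B}"
    and zero_eq: "\<zero>\<^bsub>M\<^esub> = 0"
    and add_eq: "F \<oplus>\<^bsub>M\<^esub> G = F + G"
    and smult_eq: "c \<odot>\<^bsub>M\<^esub> F = Poly_Mapping.map ((*) c) F"
begin

lemma lookup_smult [simp]: "Poly_Mapping.lookup (c \<odot>\<^bsub>M\<^esub> F) x = c * Poly_Mapping.lookup F x"
  by (simp add: smult_eq Poly_Mapping.map.rep_eq when_def)

lemma single_in: "x \<in> B \<Longrightarrow> Poly_Mapping.single x c \<in> carrier M"
  by (simp add: carrier_eq)

sublocale cspace M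
proof (rule cspace_fieldsI)
  fix c F assume "F \<in> carrier M"
  then show "c \<odot>\<^bsub>M\<^esub> F \<in> carrier M"
    by (auto simp: carrier_eq subset_iff in_keys_iff)
qed (use keys_add in \<open>auto simp: carrier_eq zero_eq add_eq add.assoc add.commute lookup_add
       distrib_left distrib_right intro!: poly_mapping_eqI, fast\<close>)

lemma minus_eq: "F \<in> carrier M \<Longrightarrow> G \<in> carrier M \<Longrightarrow> F \<ominus>\<^bsub>M\<^esub> G = F - G"
  by (auto simp: diff_eq_smult add_eq lookup_add lookup_minus intro!: poly_mapping_eqI)

lemma smult_single: "c \<odot>\<^bsub>M\<^esub> Poly_Mapping.single x d = Poly_Mapping.single x (c * d)"
  by (rule poly_mapping_eqI) (simp add: lookup_single when_def)

lemma induct [consumes 1, case_names zero single add]: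
  assumes "F \<in> carrier M" and zero: "P 0" and single: "\<And>x c. x \<in> B \<Longrightarrow> P (Poly_Mapping.single x c)"
    and add: "\<And>F G. F \<in> carrier M \<Longrightarrow> G \<in> carrier M \<Longrightarrow> P F \<Longrightarrow> P G \<Longrightarrow> P (F + G)"
  shows "P F"
proof -
  have "Poly_Mapping.keys F \<subseteq> B \<longrightarrow> P F"
  proof (induction F rule: update_induct)
    case const
    then show ?case using zero by simp
  next
    case (update F x c)
    have eq: "Poly_Mapping.update x c F = Poly_Mapping.single x c + F"
      using update(1) by (intro poly_mapping_eqI)
        (auto simp: lookup_update lookup_add lookup_single in_keys_iff when_def)
    show ?case
      using update unfolding eq[symmetric] keys_update
      by (auto simp: eq carrier_eq intro!: add single)
  qed
  then show ?thesis using assms(1) by (simp add: carrier_eq)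
qed

end

text \<open>The sums written out in \<open>free_map\<close> and \<open>uea_module\<close> are both
  of this form, so one proof of linearity covers them.\<close>

definition extend_linear ::
  "(complex, 'p, 'z) module_scheme \<Rightarrow> ('x \<Rightarrow> 'p) \<Rightarrow> ('x \<Rightarrow>\<^sub>0 complex) \<Rightarrow> 'p" where
  "extend_linear P g F = (\<Oplus>\<^bsub>P\<^esub>k\<in>Poly_Mapping.keys F. Poly_Mapping.lookup F k \<odot>\<^bsub>P\<^esub> g k)"

context fspace
begin

context
  fixes P :: "(complex, 'p, 'z) module_scheme" and g
  assumes P: "cspace P" and g: "g \<in> B \<rightarrow> carrier P"
begin

interpretation P: cspace P by (rule P)

text \<open>Provides a common finite index set for several supports; cancellation may make the
  support of \<open>F + G\<close> smaller than the union of the two.\<close>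

lemma extend_linear_superset:
  assumes "Poly_Mapping.keys F \<subseteq> S" "S \<subseteq> B" "finite S"
  shows "extend_linear P g F = (\<Oplus>\<^bsub>P\<^esub>k\<in>S. Poly_Mapping.lookup F k \<odot>\<^bsub>P\<^esub> g k)"
  unfolding extend_linear_def using assms g
  by (intro P.add.finprod_mono_neutral_cong_left) (auto simp: in_keys_iff Pi_iff subset_iff)

lemma extend_linear_clin: "clin M P (extend_linear P g)"
proof unfold_locales
  fix F G c assume F: "F \<in> carrier M"
  then have FB: "Poly_Mapping.keys F \<subseteq> B" by (simp add: carrier_eq)
  have gF: "g k \<in> carrier P" if "k \<in> Poly_Mapping.keys F" for k using FB g that by auto
  show "extend_linear P g F \<in> carrier P"
    unfolding extend_linear_def using gF by (auto intro!: P.finsum_closed)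
  have "extend_linear P g (c \<odot>\<^bsub>M\<^esub> F)
      = (\<Oplus>\<^bsub>P\<^esub>k\<in>Poly_Mapping.keys F. Poly_Mapping.lookup (c \<odot>\<^bsub>M\<^esub> F) k \<odot>\<^bsub>P\<^esub> g k)"
    using FB by (intro extend_linear_superset) (auto simp: in_keys_iff)
  also have "\<dots> = (\<Oplus>\<^bsub>P\<^esub>k\<in>Poly_Mapping.keys F. c \<odot>\<^bsub>P\<^esub> (Poly_Mapping.lookup F k \<odot>\<^bsub>P\<^esub> g k))"
    using gF by (intro P.finsum_cong') (auto simp: P.smult_smult)
  also have "\<dots> = c \<odot>\<^bsub>P\<^esub> extend_linear P g F"
    unfolding extend_linear_def using gF by (subst P.finsum_smult_ldistr) auto
  finally show "extend_linear P g (c \<odot>\<^bsub>M\<^esub> F) = c \<odot>\<^bsub>P\<^esub> extend_linear P g F" .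
  assume G: "G \<in> carrier M"
  then have GB: "Poly_Mapping.keys G \<subseteq> B" by (simp add: carrier_eq)
  have gG: "g k \<in> carrier P" if "k \<in> Poly_Mapping.keys G" for k using GB g that by auto
  let ?S = "Poly_Mapping.keys F \<union> Poly_Mapping.keys G"
  have "extend_linear P g (F \<oplus>\<^bsub>M\<^esub> G)
      = (\<Oplus>\<^bsub>P\<^esub>k\<in>?S. Poly_Mapping.lookup (F \<oplus>\<^bsub>M\<^esub> G) k \<odot>\<^bsub>P\<^esub> g k)"
    using FB GB keys_add[of F G] by (intro extend_linear_superset) (simp_all add: add_eq)
  also have "\<dots> = (\<Oplus>\<^bsub>P\<^esub>k\<in>?S. Poly_Mapping.lookup F k \<odot>\<^bsub>P\<^esub> g k \<oplus>\<^bsub>P\<^esub> Poly_Mapping.lookup G k \<odot>\<^bsub>P\<^esub> g k)"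
    using gF gG by (intro P.finsum_cong') (auto simp: add_eq lookup_add P.smult_add_left)
  also have "\<dots> = (\<Oplus>\<^bsub>P\<^esub>k\<in>?S. Poly_Mapping.lookup F k \<odot>\<^bsub>P\<^esub> g k)
      \<oplus>\<^bsub>P\<^esub> (\<Oplus>\<^bsub>P\<^esub>k\<in>?S. Poly_Mapping.lookup G k \<odot>\<^bsub>P\<^esub> g k)"
    using gF gG by (intro P.finsum_addf) auto
  also have "\<dots> = extend_linear P g F \<oplus>\<^bsub>P\<^esub> extend_linear P g G"
    using FB GB by (simp add: extend_linear_superset[of F ?S] extend_linear_superset[of G ?S])
  finally show "extend_linear P g (F \<oplus>\<^bsub>M\<^esub> G) = extend_linear P g F \<oplus>\<^bsub>P\<^esub> extend_linear P g G" .
qed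

lemma extend_linear_single: "x \<in> B \<Longrightarrow> extend_linear P g (Poly_Mapping.single x c) = c \<odot>\<^bsub>P\<^esub> g x"
  using g by (subst extend_linear_superset[of _ "{x}"]) (auto simp: Pi_iff)

end

end

lemma free_space_fspace: "fspace (free_space B) B"
  by (simp add: fspace_def free_space_def)

text \<open>With the full type as index set every carrier condition is trivial, so the type class
  sum agrees with \<open>finsum\<close>. That the image lies over a smaller set is checked
  separately in \<open>free_map_clin\<close>.\<close>

lemma free_map_eq:
  fixes f :: "'a \<Rightarrow> 'b"
  shows "free_map f F = extend_linear (free_space UNIV) (\<lambda>x. pt (f x)) F"
proof -
  interpret fspace "free_space UNIV" UNIV by (rule free_space_fspace)
  have "finsum (free_space UNIV) h S = sum h S" if "finite S"
    for h :: "'a \<Rightarrow> 'b \<Rightarrow>\<^sub>0 complex" and S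
    using that by (induction S rule: finite_induct)
      (auto simp: zero_eq add_eq Pi_iff carrier_eq)
  then show ?thesis
    unfolding free_map_def extend_linear_def by (simp add: smult_single carrier_eq Pi_iff)
qed

lemma free_map_single: "free_map f (Poly_Mapping.single x c) = Poly_Mapping.single (f x) c"
  by (simp add: free_map_def)

lemma free_map_clin:
  assumes "f \<in> B \<rightarrow> C"
  shows "clin (free_space B) (free_space C) (free_map f)"
proof -
  interpret B: fspace "free_space B" B by (rule free_space_fspace)
  interpret C: fspace "free_space C" C by (rule free_space_fspace)
  interpret U: fspace "free_space UNIV :: (complex, 'b \<Rightarrow>\<^sub>0 complex) module" UNIV
    by (rule free_space_fspace)
  interpret f: clin "free_space B" "free_space UNIV" "free_map f"
    unfolding free_map_eq[abs_def]
    by (rule B.extend_linear_clin) (auto simp: U.cspace_axioms U.carrier_eq)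
  show ?thesis
  proof unfold_locales
    fix F assume "F \<in> carrier (free_space B)"
    then show "free_map f F \<in> carrier (free_space C)"
    proof (induction rule: B.induct)
      case zero then show ?case by (simp add: free_map_def C.carrier_eq)
    next
      case (single x c) then show ?case using assms by (auto simp: free_map_single C.carrier_eq)
    next
      case (add F G)
      have "free_map f (F + G) = free_map f F + free_map f G"
        using f.add[of F G] add by (simp add: B.add_eq U.add_eq)
      then show ?case using add C.add.m_closed[of "free_map f F" "free_map f G"] by (simp add: C.add_eq)
    qed
  qed (use f.add f.smult in \<open>auto simp: C.add_eq U.add_eq C.smult_eq U.smult_eq\<close>)
qed

section \<open>Quotient spaces and maps on cosets\<close>

locale qspace = V: cspace V
  for V :: "(complex, 'm, 'x) module_scheme" and K and Q :: "(complex, 'm set, 'y) module_scheme" +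
  assumes K: "submodule K complex_field V"
    and carrier_eq: "carrier Q = a_rcosets\<^bsub>V\<^esub> K"
    and zero_eq: "\<zero>\<^bsub>Q\<^esub> = K"
    and add_eq: "ring.add Q = set_add V"
    and smult_eq: "module.smult Q = (\<lambda>c. coset_map V K (\<lambda>v. c \<odot>\<^bsub>V\<^esub> v))"
begin

lemma K_sub: "K \<subseteq> carrier V" by (rule V.submoduleE(1)[OF K])

sublocale abelian_subgroup K V
  by (intro abelian_subgroupI3 additive_subgroupI submodule.axioms(1)[OF K] V.abelian_group_axioms)

lemma carrier_image: "carrier Q = (\<lambda>v. K +>\<^bsub>V\<^esub> v) ` carrier V"
  by (auto simp: carrier_eq A_RCOSETS_def')

lemma coset_eq_iff:
  assumes "v \<in> carrier V" "w \<in> carrier V"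
  shows "K +>\<^bsub>V\<^esub> v = K +>\<^bsub>V\<^esub> w \<longleftrightarrow> v \<ominus>\<^bsub>V\<^esub> w \<in> K"
  using V.a_coset_add_inv1[of K v w] V.a_coset_add_inv2[of K v w] assms K_sub
    V.a_coset_join1[of K "v \<ominus>\<^bsub>V\<^esub> w"] V.a_coset_join2[of "v \<ominus>\<^bsub>V\<^esub> w" K] submodule.axioms(1)[OF K]
  by (metis V.minus_closed a_minus_def)

lemma coset_cases:
  assumes "B \<in> carrier Q" obtains v where "v \<in> carrier V" "B = K +>\<^bsub>V\<^esub> v"
  using assms carrier_image by blast

lemma in_coset_iff:
  assumes "v \<in> carrier V" shows "w \<in> K +>\<^bsub>V\<^esub> v \<longleftrightarrow> w \<in> carrier V \<and> w \<ominus>\<^bsub>V\<^esub> v \<in> K"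
proof
  assume w: "w \<in> K +>\<^bsub>V\<^esub> v"
  then have wV: "w \<in> carrier V" using V.a_r_coset_subset_G[OF K_sub assms] by blast
  then show "w \<in> carrier V \<and> w \<ominus>\<^bsub>V\<^esub> v \<in> K"
    using V.a_repr_independence[OF w assms submodule.axioms(1)[OF K]] coset_eq_iff[OF wV assms] by simp
next
  assume "w \<in> carrier V \<and> w \<ominus>\<^bsub>V\<^esub> v \<in> K"
  then show "w \<in> K +>\<^bsub>V\<^esub> v"
    using a_rcos_self[of w] coset_eq_iff[of w v] assms by simp
qed

text \<open>\<open>coset_map\<close> is a union over all representatives. As \<open>f\<close> maps
  \<open>K\<close> into \<open>K'\<close>, the cosets of their images coincide and the union is a
  single coset.\<close>

lemma UN_coset:
  assumes "clin V S f" "\<And>k. k \<in> K \<Longrightarrow> f k \<in> K'" "submodule K' complex_field S" "v \<in> carrier V"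
  shows "coset_map S K' f (K +>\<^bsub>V\<^esub> v) = K' +>\<^bsub>S\<^esub> f v"
proof -
  interpret f: clin V S f by fact
  have "K' +>\<^bsub>S\<^esub> f w = K' +>\<^bsub>S\<^esub> f v" if w: "w \<in> K +>\<^bsub>V\<^esub> v" for w
  proof -
    have w': "w \<in> carrier V" "w \<ominus>\<^bsub>V\<^esub> v \<in> K" using w in_coset_iff[OF assms(4)] by auto
    have "f w \<ominus>\<^bsub>S\<^esub> f v \<in> K'" using assms(2)[OF w'(2)] f.diff[OF w'(1) assms(4)] by simp
    moreover have "f w = (f w \<ominus>\<^bsub>S\<^esub> f v) \<oplus>\<^bsub>S\<^esub> f v"
      using w'(1) assms(4) by (simp add: a_minus_def f.N.a_assoc f.N.l_neg)
    ultimately have "f w \<in> K' +>\<^bsub>S\<^esub> f v" unfolding a_r_coset_def' by blast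
    then show ?thesis
      using f.N.a_repr_independence[OF _ _ submodule.axioms(1)[OF assms(3)]] assms(4) by auto
  qed
  then show ?thesis
    unfolding coset_map_def using a_rcos_self[OF assms(4)] by blast
qed

lemma coset_smult:
  assumes "v \<in> carrier V" shows "c \<odot>\<^bsub>Q\<^esub> (K +>\<^bsub>V\<^esub> v) = K +>\<^bsub>V\<^esub> (c \<odot>\<^bsub>V\<^esub> v)"
  unfolding smult_eq
  by (rule UN_coset) (auto intro: clin_smult[OF clin_id] V.cspace_axioms K assms V.subspace_smult[OF K])

lemma coset_add: "v \<in> carrier V \<Longrightarrow> w \<in> carrier V \<Longrightarrow>
  (K +>\<^bsub>V\<^esub> v) \<oplus>\<^bsub>Q\<^esub> (K +>\<^bsub>V\<^esub> w) = K +>\<^bsub>V\<^esub> (v \<oplus>\<^bsub>V\<^esub> w)"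
  by (simp add: add_eq a_rcos_sum)

lemma coset_zero: "\<zero>\<^bsub>Q\<^esub> = K +>\<^bsub>V\<^esub> \<zero>\<^bsub>V\<^esub>"
  using K_sub by (simp add: zero_eq)

sublocale Q: cspace Q
  by (rule cspace_fieldsI)
    (auto simp: carrier_image coset_add coset_smult coset_zero V.a_ac V.smult_add_left
       V.smult_add_right V.smult_smult)

lemma coset_clin: "clin V Q (\<lambda>v. K +>\<^bsub>V\<^esub> v)"
  by unfold_locales (auto simp: carrier_image coset_add coset_smult)

text \<open>A linear map that kills \<open>K\<close> is constant on each coset, so the image of a
  coset is a singleton and \<open>the_elem\<close> returns the common value.\<close>

lemma the_elem_coset:
  assumes "clin V P f" "\<And>k. k \<in> K \<Longrightarrow> f k = \<zero>\<^bsub>P\<^esub>" "v \<in> carrier V"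
  shows "the_elem (f ` (K +>\<^bsub>V\<^esub> v)) = f v"
proof -
  interpret f: clin V P f by fact
  have "f w = f v" if "w \<in> K +>\<^bsub>V\<^esub> v" for w
    using that in_coset_iff[OF assms(3)] assms(2)[of "w \<ominus>\<^bsub>V\<^esub> v"] f.diff[of w v] assms(3)
      f.N.diff_eq_zero_iff[of "f w" "f v"] by auto
  then have "f ` (K +>\<^bsub>V\<^esub> v) = {f v}" using a_rcos_self[OF assms(3)] by blast
  then show ?thesis by simp
qed

lemma the_elem_clin:
  assumes "clin V P f" "\<And>k. k \<in> K \<Longrightarrow> f k = \<zero>\<^bsub>P\<^esub>"
  shows "clin Q P (\<lambda>B. the_elem (f ` B))"
  using assms the_elem_coset[OF assms]
  by (intro clin_image_linear[OF coset_clin, of P _ f]) (auto simp: carrier_image clin_def)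

end

lemma quotient_qspace:
  "cspace V \<Longrightarrow> submodule K complex_field V \<Longrightarrow> qspace V K (quotient_space V K)"
  by (simp add: qspace_def qspace_axioms_def quotient_space_def)

section \<open>Tensor products and their universal property\<close>

locale balanced_pair = M: cspace M + N: cspace N
  for A :: "(complex, 'a) module" and M :: "('a, 'm) act_module" and N :: "('a, 'n) act_module" +
  assumes act_M: "r \<in> carrier A \<Longrightarrow> x \<in> carrier M \<Longrightarrow> act M r x \<in> carrier M"
    and act_N: "r \<in> carrier A \<Longrightarrow> y \<in> carrier N \<Longrightarrow> act N r y \<in> carrier N"
begin

abbreviation "F \<equiv> free_space (carrier M \<times> carrier N)"
abbreviation "K \<equiv> tensor_kernel A M N"
abbreviation "T \<equiv> tensor A M N"
abbreviation "pure \<equiv> pure_tensor A M N"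

sublocale F: fspace F "carrier M \<times> carrier N"
  by (rule free_space_fspace)

lemma F_diff: "G \<in> carrier F \<Longrightarrow> H \<in> carrier F \<Longrightarrow> G - H \<in> carrier F"
  using F.minus_closed F.minus_eq by metis

lemma F_add: "G \<in> carrier F \<Longrightarrow> H \<in> carrier F \<Longrightarrow> G + H \<in> carrier F"
  using F.add.m_closed[unfolded F.add_eq] .

lemma relations_subset: "tensor_relations A M N \<subseteq> carrier F"
  unfolding tensor_relations_def by (auto intro!: F_diff F.single_in act_M act_N)

lemma relations_kernel: "r \<in> tensor_relations A M N \<Longrightarrow> r \<in> K"
  unfolding tensor_kernel_def using F.lin_span_superset by blast

sublocale qspace F K T
  unfolding tensor_def tensor_kernel_def
  by (intro quotient_qspace F.cspace_axioms F.lin_span_submodule relations_subset)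

lemma coset_eqI: "G \<in> carrier F \<Longrightarrow> H \<in> carrier F \<Longrightarrow> G - H \<in> K \<Longrightarrow> K +>\<^bsub>F\<^esub> G = K +>\<^bsub>F\<^esub> H"
  using coset_eq_iff F.minus_eq by metis

lemma pure_in [simp]: "x \<in> carrier M \<Longrightarrow> y \<in> carrier N \<Longrightarrow> pure x y \<in> carrier T"
  unfolding pure_tensor_def carrier_image by (auto intro: F.single_in)

lemma pure_add_left:
  assumes "x \<in> carrier M" "x' \<in> carrier M" "y \<in> carrier N"
  shows "pure (x \<oplus>\<^bsub>M\<^esub> x') y = pure x y \<oplus>\<^bsub>T\<^esub> pure x' y"
proof -
  have "pt (x \<oplus>\<^bsub>M\<^esub> x', y) - pt (x, y) - pt (x', y) \<in> K"
    using assms by (intro relations_kernel) (auto simp: tensor_relations_def)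
  then show ?thesis
    unfolding pure_tensor_def using assms
    by (subst coset_add)
      (simp_all add: F.single_in F.add_eq, intro coset_eqI, simp_all add: F.single_in F_add diff_diff_eq)
qed

lemma pure_add_right:
  assumes "x \<in> carrier M" "y \<in> carrier N" "y' \<in> carrier N"
  shows "pure x (y \<oplus>\<^bsub>N\<^esub> y') = pure x y \<oplus>\<^bsub>T\<^esub> pure x y'"
proof -
  have "pt (x, y \<oplus>\<^bsub>N\<^esub> y') - pt (x, y) - pt (x, y') \<in> K"
    using assms by (intro relations_kernel) (auto simp: tensor_relations_def)
  then show ?thesis
    unfolding pure_tensor_def using assms
    by (subst coset_add)
      (simp_all add: F.single_in F.add_eq, intro coset_eqI, simp_all add: F.single_in F_add diff_diff_eq)
qed

lemma pure_smult_left: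
  assumes "x \<in> carrier M" "y \<in> carrier N"
  shows "pure (c \<odot>\<^bsub>M\<^esub> x) y = c \<odot>\<^bsub>T\<^esub> pure x y"
proof -
  have "pt (c \<odot>\<^bsub>M\<^esub> x, y) - Poly_Mapping.single (x, y) c \<in> K"
    using assms by (intro relations_kernel) (unfold tensor_relations_def, blast)
  then show ?thesis
    unfolding pure_tensor_def using assms
    by (subst coset_smult)
      (simp_all add: F.single_in F.smult_single, intro coset_eqI, simp_all add: F.single_in)
qed

lemma pure_smult_right:
  assumes "x \<in> carrier M" "y \<in> carrier N"
  shows "pure x (c \<odot>\<^bsub>N\<^esub> y) = c \<odot>\<^bsub>T\<^esub> pure x y"
proof -
  have "pt (x, c \<odot>\<^bsub>N\<^esub> y) - Poly_Mapping.single (x, y) c \<in> K"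
    using assms by (intro relations_kernel) (unfold tensor_relations_def, blast)
  then show ?thesis
    unfolding pure_tensor_def using assms
    by (subst coset_smult)
      (simp_all add: F.single_in F.smult_single, intro coset_eqI, simp_all add: F.single_in)
qed

lemma pure_balanced:
  assumes "r \<in> carrier A" "x \<in> carrier M" "y \<in> carrier N"
  shows "pure (act M r x) y = pure x (act N r y)"
proof -
  have "pt (act M r x, y) - pt (x, act N r y) \<in> K"
    using assms by (intro relations_kernel) (unfold tensor_relations_def, blast)
  then show ?thesis
    unfolding pure_tensor_def using assms
    by (intro coset_eqI) (simp_all add: F.single_in act_M act_N)
qed

text \<open>Scalars are absorbed into the left factor, so pure tensors and sums already reach every
  element.\<close>

lemma tensor_induct [consumes 1, case_names zero pure add]:
  assumes "z \<in> carrier T" "P \<zero>\<^bsub>T\<^esub>"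
    and pure: "\<And>x y. x \<in> carrier M \<Longrightarrow> y \<in> carrier N \<Longrightarrow> P (pure x y)"
    and add: "\<And>z w. z \<in> carrier T \<Longrightarrow> w \<in> carrier T \<Longrightarrow> P z \<Longrightarrow> P w \<Longrightarrow> P (z \<oplus>\<^bsub>T\<^esub> w)"
  shows "P z"
proof -
  have "P (K +>\<^bsub>F\<^esub> G)" if "G \<in> carrier F" for G
    using that
  proof (induction rule: F.induct)
    case zero
    then show ?case using assms(2) coset_zero by (simp add: F.zero_eq)
  next
    case (single k c)
    then obtain x y where k: "k = (x, y)" "x \<in> carrier M" "y \<in> carrier N" by auto
    have "K +>\<^bsub>F\<^esub> Poly_Mapping.single k c = c \<odot>\<^bsub>T\<^esub> pure x y"
      unfolding pure_tensor_def using k coset_smult[of "pt (x, y)" c]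
      by (simp add: F.single_in F.smult_single)
    then show ?case using pure[of "c \<odot>\<^bsub>M\<^esub> x" y] k by (simp add: pure_smult_left)
  next
    case (add G H)
    then show ?case
      using assms(4)[of "K +>\<^bsub>F\<^esub> G" "K +>\<^bsub>F\<^esub> H"] by (simp add: coset_add F.add_eq carrier_image)
  qed
  then show ?thesis using coset_cases[OF assms(1)] by metis
qed

definition lift :: "(complex, 'p, 'z) module_scheme \<Rightarrow> ('m \<Rightarrow> 'n \<Rightarrow> 'p) \<Rightarrow> ('m \<times> 'n \<Rightarrow>\<^sub>0 complex) set \<Rightarrow> 'p"
  where "lift P \<beta> B = the_elem (extend_linear P (case_prod \<beta>) ` B)"

text \<open>Linearity in each variable together with balancedness says that the linear extension to
  the free space kills the five families of relations, hence their span.\<close>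

lemma
  fixes P :: "(complex, 'p, 'z) module_scheme"
  assumes P: "cspace P"
    and left: "\<And>y. y \<in> carrier N \<Longrightarrow> clin M P (\<lambda>x. \<beta> x y)"
    and right: "\<And>x. x \<in> carrier M \<Longrightarrow> clin N P (\<beta> x)"
    and bal: "\<And>r x y. r \<in> carrier A \<Longrightarrow> x \<in> carrier M \<Longrightarrow> y \<in> carrier N \<Longrightarrow>
      \<beta> (act M r x) y = \<beta> x (act N r y)"
  shows lift_clin: "clin T P (lift P \<beta>)"
    and lift_pure: "x \<in> carrier M \<Longrightarrow> y \<in> carrier N \<Longrightarrow> lift P \<beta> (pure x y) = \<beta> x y"
proof -
  interpret P: cspace P by (rule P)
  let ?b = "case_prod \<beta>" let ?e = "extend_linear P ?b"
  have b: "?b \<in> carrier M \<times> carrier N \<rightarrow> carrier P"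
    using clin.closed[OF left] by auto
  interpret e: clin F P ?e by (rule F.extend_linear_clin[OF P b])
  have e_diff: "?e (G - H) = ?e G \<ominus>\<^bsub>P\<^esub> ?e H" if "G \<in> carrier F" "H \<in> carrier F" for G H
    using e.diff[OF that] F.minus_eq[OF that] by simp
  have e_single: "?e (Poly_Mapping.single (x, y) c) = c \<odot>\<^bsub>P\<^esub> \<beta> x y"
    if "x \<in> carrier M" "y \<in> carrier N" for x y c
    using F.extend_linear_single[OF P b] that by simp
  have \<beta>: "\<beta> x y \<in> carrier P" if "x \<in> carrier M" "y \<in> carrier N" for x y
    using clin.closed[OF left] that by auto
  have "?e r = \<zero>\<^bsub>P\<^esub>" if "r \<in> tensor_relations A M N" for r
    using that unfolding tensor_relations_def
    by (elim UnE CollectE exE conjE; hypsubst)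
      (simp_all add: e_diff e_single F_diff F.single_in \<beta> act_M act_N clin.add[OF left] clin.add[OF right]
        clin.smult[OF left] clin.smult[OF right] bal P.add_diff_diff P.diff_eq_zero_iff)
  then have "tensor_relations A M N \<subseteq> {G \<in> carrier F. ?e G = \<zero>\<^bsub>P\<^esub>}"
    using relations_subset by blast
  then have "K \<subseteq> {G \<in> carrier F. ?e G = \<zero>\<^bsub>P\<^esub>}"
    unfolding tensor_kernel_def by (intro F.lin_span_least e.kernel_submodule)
  then have K0: "?e k = \<zero>\<^bsub>P\<^esub>" if "k \<in> K" for k using that by blast
  show "clin T P (lift P \<beta>)"
    unfolding lift_def[abs_def] by (rule the_elem_clin[OF e.clin_axioms K0])
  show "lift P \<beta> (pure x y) = \<beta> x y" if "x \<in> carrier M" "y \<in> carrier N"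
    unfolding lift_def pure_tensor_def using that
    by (subst the_elem_coset[OF e.clin_axioms K0]) (simp_all add: F.single_in e_single \<beta>)
qed

lemma clin_eqI:
  assumes "clin T P f" "clin T P g" "\<And>x y. x \<in> carrier M \<Longrightarrow> y \<in> carrier N \<Longrightarrow> f (pure x y) = g (pure x y)"
    "z \<in> carrier T"
  shows "f z = g z"
proof -
  interpret f: clin T P f by fact
  interpret g: clin T P g by fact
  show ?thesis using assms(4)
    by (induction rule: tensor_induct) (auto simp: f.zero g.zero f.add g.add assms(3))
qed

end

text \<open>\<open>tensor_map\<close> is given on cosets through representatives rather than as a
  lift. It is well defined because \<open>free_map\<close> takes each generating relation to a
  relation of the same family, and so kernel to kernel.\<close>

lemma
  assumes "balanced_pair A M N" "balanced_pair A M' N'"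
    and f: "clin M M' f" "\<And>r x. r \<in> carrier A \<Longrightarrow> x \<in> carrier M \<Longrightarrow> f (act M r x) = act M' r (f x)"
    and g: "clin N N' g" "\<And>r x. r \<in> carrier A \<Longrightarrow> x \<in> carrier N \<Longrightarrow> g (act N r x) = act N' r (g x)"
  shows tensor_map_clin: "clin (tensor A M N) (tensor A M' N') (tensor_map A M' N' f g)"
    and tensor_map_pure: "x \<in> carrier M \<Longrightarrow> y \<in> carrier N \<Longrightarrow>
      tensor_map A M' N' f g (pure_tensor A M N x y) = pure_tensor A M' N' (f x) (g y)"
proof -
  interpret S: balanced_pair A M N by fact
  interpret S': balanced_pair A M' N' by fact
  interpret f: clin M M' f by fact
  interpret g: clin N N' g by fact
  interpret h: clin S.F S'.F "free_map (map_prod f g)"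
    by (rule free_map_clin) auto
  have h_diff: "free_map (map_prod f g) (G - H) = free_map (map_prod f g) G - free_map (map_prod f g) H"
    if "G \<in> carrier S.F" "H \<in> carrier S.F" for G H
    using h.diff[OF that] S.F.minus_eq[OF that] S'.F.minus_eq that by simp
  have "free_map (map_prod f g) r \<in> tensor_relations A M' N'" if "r \<in> tensor_relations A M N" for r
    using that unfolding tensor_relations_def[of A M N]
  proof (elim UnE CollectE exE conjE; hypsubst)
    fix x x' y assume "x \<in> carrier M" "x' \<in> carrier M" "y \<in> carrier N"
    then show "free_map (map_prod f g) (pt (x \<oplus>\<^bsub>M\<^esub> x', y) - pt (x, y) - pt (x', y)) \<in> tensor_relations A M' N'"
      by (simp add: h_diff S.F_diff S.F.single_in free_map_single f.add tensor_relations_def) (use f.closed g.closed in blast)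
  next
    fix x y y' assume "x \<in> carrier M" "y \<in> carrier N" "y' \<in> carrier N"
    then show "free_map (map_prod f g) (pt (x, y \<oplus>\<^bsub>N\<^esub> y') - pt (x, y) - pt (x, y')) \<in> tensor_relations A M' N'"
      by (simp add: h_diff S.F_diff S.F.single_in free_map_single g.add tensor_relations_def) (use f.closed g.closed in blast)
  next
    fix c x y assume "x \<in> carrier M" "y \<in> carrier N"
    then show "free_map (map_prod f g) (pt (c \<odot>\<^bsub>M\<^esub> x, y) - Poly_Mapping.single (x, y) c) \<in> tensor_relations A M' N'"
      "free_map (map_prod f g) (pt (x, c \<odot>\<^bsub>N\<^esub> y) - Poly_Mapping.single (x, y) c) \<in> tensor_relations A M' N'"
      by (simp_all add: h_diff S.F_diff S.F.single_in free_map_single f.smult g.smult tensor_relations_def)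
        (use f.closed g.closed in blast)+
  next
    fix a x y assume "a \<in> carrier A" "x \<in> carrier M" "y \<in> carrier N"
    then show "free_map (map_prod f g) (pt (act M a x, y) - pt (x, act N a y)) \<in> tensor_relations A M' N'"
      by (simp add: h_diff S.F_diff S.F.single_in free_map_single f(2) g(2) S.act_M S.act_N tensor_relations_def)
        (use f.closed g.closed in blast)
  qed
  then have "tensor_relations A M N \<subseteq> {G \<in> carrier S.F. free_map (map_prod f g) G \<in> S'.K}"
    using S.relations_subset S'.relations_kernel by blast
  then have "S.K \<subseteq> {G \<in> carrier S.F. free_map (map_prod f g) G \<in> S'.K}"
    unfolding tensor_kernel_def[of A M N] by (intro S.F.lin_span_least h.vimage_submodule S'.K)
  then have K: "free_map (map_prod f g) k \<in> S'.K" if "k \<in> S.K" for k using that by blast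
  have coset: "tensor_map A M' N' f g (S.K +>\<^bsub>S.F\<^esub> G) = S'.K +>\<^bsub>S'.F\<^esub> free_map (map_prod f g) G"
    if "G \<in> carrier S.F" for G
    unfolding tensor_map_def by (rule S.UN_coset[OF h.clin_axioms K S'.K that])
  show "clin (tensor A M N) (tensor A M' N') (tensor_map A M' N' f g)"
    by (rule clin_image_linear[OF S.coset_clin S'.Q.cspace_axioms coset _
        clin_comp[OF h.clin_axioms S'.coset_clin]])
      (simp_all add: S.carrier_image)
  show "tensor_map A M' N' f g (pure_tensor A M N x y) = pure_tensor A M' N' (f x) (g y)"
    if "x \<in> carrier M" "y \<in> carrier N"
    unfolding pure_tensor_def using that by (subst coset) (auto simp: free_map_single intro: S.F.single_in)
qed

section \<open>Enveloping algebras and induced modules\<close>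

lemma letters_plus [simp]: "letters (v + w) = letters v @ letters w"
  by (simp add: plus_fword_def)

lemma letters_zero [simp]: "letters 0 = []"
  by (simp add: zero_fword_def)

lemma free_algebra_fspace: "fspace (free_algebra B) {w. set (letters w) \<subseteq> B}"
  by (auto simp: fspace_def free_algebra_def)

lemma free_algebra_mult: "F \<otimes>\<^bsub>free_algebra B\<^esub> G = F * G" "\<one>\<^bsub>free_algebra B\<^esub> = 1"
  by (simp_all add: free_algebra_def)

lemma free_algebra_mult_closed:
  assumes "F \<in> carrier (free_algebra B)" "G \<in> carrier (free_algebra B)"
  shows "F * G \<in> carrier (free_algebra B)"
proof -
  have "set (letters w) \<subseteq> B" if w: "w \<in> Poly_Mapping.keys (F * G)" for w
  proof -
    obtain u v where "w = u + v" "u \<in> Poly_Mapping.keys F" "v \<in> Poly_Mapping.keys G"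
      using keys_mult[of F G] w by blast
    then show ?thesis using assms unfolding free_algebra_def by simp
  qed
  then show ?thesis by (simp add: free_algebra_def)
qed

lemma free_algebra_ring: "ring (free_algebra B)"
proof -
  interpret fspace "free_algebra B" "{w. set (letters w) \<subseteq> B}" by (rule free_algebra_fspace)
  show ?thesis
  proof (rule ringI)
    show "abelian_group (free_algebra B)" by (rule abelian_group_axioms)
    show "Group.monoid (free_algebra B)"
      by (rule monoidI)
        (auto simp: free_algebra_mult free_algebra_mult_closed mult.assoc, simp add: carrier_eq)
  qed (simp_all add: free_algebra_mult add_eq distrib_left distrib_right)
qed

text \<open>Scalars sit in the algebra as multiples of the empty word, which are central. The
  operations do not see the alphabet, so the induction runs over the full one, where every element
  lies in the carrier.\<close>

lemma free_algebra_smult_eq: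
  "c \<odot>\<^bsub>free_algebra B\<^esub> F = Poly_Mapping.single 0 c * F"
  "c \<odot>\<^bsub>free_algebra B\<^esub> F = F * Poly_Mapping.single 0 c"
proof -
  interpret U: fspace "free_algebra UNIV :: (complex, 'a fword \<Rightarrow>\<^sub>0 complex) module"
      "{w. set (letters w) \<subseteq> UNIV}"
    by (rule free_algebra_fspace)
  have F: "F \<in> carrier (free_algebra UNIV)" by (simp add: free_algebra_def)
  have "c \<odot>\<^bsub>free_algebra UNIV\<^esub> F = Poly_Mapping.single 0 c * F \<and>
        c \<odot>\<^bsub>free_algebra UNIV\<^esub> F = F * Poly_Mapping.single 0 c"
    using F
  proof (induction rule: U.induct)
    case zero
    then show ?case using U.smult_zero_right[of c] by (simp add: U.zero_eq)
  next
    case (single x d)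
    then show ?case by (simp add: U.smult_single mult_single mult.commute)
  next
    case (add F G)
    then show ?case using U.smult_add_right[of F G c] by (simp add: U.add_eq distrib_left distrib_right) metis
  qed
  then show "c \<odot>\<^bsub>free_algebra B\<^esub> F = Poly_Mapping.single 0 c * F"
    "c \<odot>\<^bsub>free_algebra B\<^esub> F = F * Poly_Mapping.single 0 c"
    by (auto simp: free_algebra_def)
qed

sublocale lie_algebra \<subseteq> L: cspace L by (rule cspaceI) (rule module_axioms)

locale enveloping = lie_algebra L for L :: "'l lie" (structure)
begin

abbreviation "FA \<equiv> free_algebra (carrier L)"
abbreviation "I \<equiv> uea_ideal L"
abbreviation "U \<equiv> UEA L"
abbreviation "cls F \<equiv> I +>\<^bsub>FA\<^esub> F"
abbreviation "word ws \<equiv> cls (pt (FWord ws))"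

sublocale FA: fspace FA "{w. set (letters w) \<subseteq> carrier L}"
  by (rule free_algebra_fspace)

sublocale FR: ring FA by (rule free_algebra_ring)

lemma letter_in [simp]: "x \<in> carrier L \<Longrightarrow> letter x \<in> carrier FA"
  by (rule FA.single_in) simp

lemma FA_diff: "F \<in> carrier FA \<Longrightarrow> G \<in> carrier FA \<Longrightarrow> F - G \<in> carrier FA"
  using FA.minus_closed FA.minus_eq by metis

definition "uea_relations =
     {letter (x \<oplus> y) - letter x - letter y | x y. x \<in> carrier L \<and> y \<in> carrier L} \<union>
      {letter (c \<odot> x) - Poly_Mapping.single (FWord [x]) c | c x. x \<in> carrier L} \<union>
      {letter x * letter y - letter y * letter x - letter (bracket L x y) | x y.
         x \<in> carrier L \<and> y \<in> carrier L}"

lemma uea_ideal_eq: "I = Idl\<^bsub>FA\<^esub> uea_relations"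
  unfolding uea_ideal_def uea_relations_def by simp

lemma uea_relations_subset: "uea_relations \<subseteq> carrier FA"
  unfolding uea_relations_def
  by (auto intro!: FA_diff free_algebra_mult_closed FA.single_in bracket_closed)

sublocale UI: ideal I FA
  unfolding uea_ideal_eq by (rule FR.genideal_ideal[OF uea_relations_subset])

lemma uea_relations_ideal: "r \<in> uea_relations \<Longrightarrow> r \<in> I"
  unfolding uea_ideal_eq using FR.genideal_self[OF uea_relations_subset] by blast

lemma single0_in: "Poly_Mapping.single 0 c \<in> carrier FA"
  by (rule FA.single_in) simp

text \<open>An ideal is closed under scalars because \<open>c\<close> times \<open>F\<close> is the
  product of a multiple of the empty word with \<open>F\<close>. This allows the quotient ring to be
  treated as a \<open>qspace\<close>.\<close>

lemma ideal_submodule: "submodule I complex_field FA"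
proof (rule FA.subspaceI)
  show "c \<odot>\<^bsub>FA\<^esub> F \<in> I" if "F \<in> I" for c F
    using UI.I_l_closed[OF that single0_in[of c]] by (simp add: free_algebra_smult_eq(1) free_algebra_mult)
qed (use UI.a_subset in auto)

sublocale UQ: qspace FA I U
  by (intro qspace.intro qspace_axioms.intro FA.cspace_axioms)
    (simp_all add: ideal_submodule UEA_def ring.extend_def module.fields_def FactRing_def)

lemma uea_mult_one: "monoid.mult U = rcoset_mult FA I" "\<one>\<^bsub>U\<^esub> = cls 1"
  by (simp_all add: UEA_def ring.extend_def module.fields_def FactRing_def free_algebra_mult)

lemma cls_mult: "F \<in> carrier FA \<Longrightarrow> G \<in> carrier FA \<Longrightarrow> cls F \<otimes>\<^bsub>U\<^esub> cls G = cls (F * G)"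
  by (simp add: uea_mult_one UI.rcoset_mult_add free_algebra_mult)

lemma cls_in [simp]: "F \<in> carrier FA \<Longrightarrow> cls F \<in> carrier U"
  by (simp add: UQ.carrier_image)

lemma cls_eqI: "F \<in> carrier FA \<Longrightarrow> G \<in> carrier FA \<Longrightarrow> F - G \<in> I \<Longrightarrow> cls F = cls G"
  using UQ.coset_eq_iff FA.minus_eq by metis

lemma one_in_FA: "1 \<in> carrier FA"
  using FR.one_closed by (simp add: free_algebra_mult)

sublocale U: monoid U
  by (rule monoidI)
    (auto simp: UQ.carrier_image uea_mult_one(2) cls_mult one_in_FA free_algebra_mult_closed mult.assoc)

lemma U_distrib_left:
  "u \<in> carrier U \<Longrightarrow> v \<in> carrier U \<Longrightarrow> w \<in> carrier U \<Longrightarrow> u \<otimes>\<^bsub>U\<^esub> (v \<oplus>\<^bsub>U\<^esub> w) = u \<otimes>\<^bsub>U\<^esub> v \<oplus>\<^bsub>U\<^esub> u \<otimes>\<^bsub>U\<^esub> w"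
  by (auto simp: UQ.carrier_image cls_mult UQ.coset_add free_algebra_mult_closed FA.add_eq
     FA.add.m_closed[unfolded FA.add_eq] distrib_left)

lemma U_distrib_right:
  "u \<in> carrier U \<Longrightarrow> v \<in> carrier U \<Longrightarrow> w \<in> carrier U \<Longrightarrow> (v \<oplus>\<^bsub>U\<^esub> w) \<otimes>\<^bsub>U\<^esub> u = v \<otimes>\<^bsub>U\<^esub> u \<oplus>\<^bsub>U\<^esub> w \<otimes>\<^bsub>U\<^esub> u"
  by (auto simp: UQ.carrier_image cls_mult UQ.coset_add free_algebra_mult_closed FA.add_eq
     FA.add.m_closed[unfolded FA.add_eq] distrib_right)

lemma U_smult_left:
  assumes "u \<in> carrier U" "v \<in> carrier U" shows "(c \<odot>\<^bsub>U\<^esub> u) \<otimes>\<^bsub>U\<^esub> v = c \<odot>\<^bsub>U\<^esub> (u \<otimes>\<^bsub>U\<^esub> v)"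
proof -
  obtain F G where "F \<in> carrier FA" "G \<in> carrier FA" "u = cls F" "v = cls G"
    using assms by (auto simp: UQ.carrier_image)
  then show ?thesis
    using FA.smult_in[of F c] FA.smult_in[of "F * G" c]
    by (simp add: cls_mult UQ.coset_smult free_algebra_mult_closed)
      (simp add: free_algebra_smult_eq(1) mult.assoc)
qed

lemma U_smult_right:
  assumes "u \<in> carrier U" "v \<in> carrier U" shows "u \<otimes>\<^bsub>U\<^esub> (c \<odot>\<^bsub>U\<^esub> v) = c \<odot>\<^bsub>U\<^esub> (u \<otimes>\<^bsub>U\<^esub> v)"
proof -
  obtain F G where "F \<in> carrier FA" "G \<in> carrier FA" "u = cls F" "v = cls G"
    using assms by (auto simp: UQ.carrier_image)
  then show ?thesis
    using FA.smult_in[of G c] FA.smult_in[of "F * G" c]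
    by (simp add: cls_mult UQ.coset_smult free_algebra_mult_closed)
      (simp add: free_algebra_smult_eq(2) mult.assoc)
qed

lemma U_mult_left_clin: "u \<in> carrier U \<Longrightarrow> clin U U (\<lambda>v. u \<otimes>\<^bsub>U\<^esub> v)"
  by unfold_locales (simp_all add: U_distrib_left U_smult_right)

lemma U_mult_right_clin: "u \<in> carrier U \<Longrightarrow> clin U U (\<lambda>v. v \<otimes>\<^bsub>U\<^esub> u)"
  by unfold_locales (simp_all add: U_distrib_right U_smult_left)

lemma incl_in [simp]: "x \<in> carrier L \<Longrightarrow> uea_incl L x \<in> carrier U"
  by (simp add: uea_incl_def)

lemma incl_clin: "clin L U (uea_incl L)"
proof unfold_locales
  fix x y c assume x: "x \<in> carrier L"
  show "uea_incl L x \<in> carrier U" using x by simp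
  have "letter (c \<odot> x) - Poly_Mapping.single (FWord [x]) c \<in> I"
    using x by (intro uea_relations_ideal) (auto simp: uea_relations_def)
  then show "uea_incl L (c \<odot> x) = c \<odot>\<^bsub>U\<^esub> uea_incl L x"
    unfolding uea_incl_def using x
    by (subst UQ.coset_smult) (simp_all add: FA.smult_single, intro cls_eqI, simp_all add: FA.single_in)
  assume y: "y \<in> carrier L"
  have "letter (x \<oplus> y) - letter x - letter y \<in> I"
    using x y by (intro uea_relations_ideal) (auto simp: uea_relations_def)
  then show "uea_incl L (x \<oplus> y) = uea_incl L x \<oplus>\<^bsub>U\<^esub> uea_incl L y"
    unfolding uea_incl_def using x y FA.add.m_closed[of "letter x" "letter y"]
    by (subst UQ.coset_add) (simp_all add: FA.add_eq, intro cls_eqI, simp_all add: FA.single_in diff_diff_eq)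
qed

lemma incl_bracket:
  assumes "x \<in> carrier L" "y \<in> carrier L"
  shows "uea_incl L (bracket L x y) = uea_incl L x \<otimes>\<^bsub>U\<^esub> uea_incl L y \<ominus>\<^bsub>U\<^esub> uea_incl L y \<otimes>\<^bsub>U\<^esub> uea_incl L x"
proof -
  let ?xy = "letter x * letter y" and ?yx = "letter y * letter x"
  have in_FA: "?xy \<in> carrier FA" "?yx \<in> carrier FA"
    using assms by (simp_all add: free_algebra_mult_closed)
  have "?xy - ?yx - letter (bracket L x y) \<in> I"
    using assms by (intro uea_relations_ideal) (auto simp: uea_relations_def)
  then have "cls (?xy - ?yx) = cls (letter (bracket L x y))"
    using assms by (intro cls_eqI) (simp_all add: in_FA FA_diff bracket_closed)
  moreover have "cls (?xy - ?yx) = cls ?xy \<ominus>\<^bsub>U\<^esub> cls ?yx"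
    using clin.diff[OF UQ.coset_clin in_FA] FA.minus_eq[OF in_FA] by simp
  ultimately show ?thesis
    using assms by (simp add: uea_incl_def cls_mult)
qed

lemma word_Nil: "word [] = \<one>\<^bsub>U\<^esub>"
  using single_one[where 'a = "'l fword" and 'b = complex] by (simp add: uea_mult_one zero_fword_def)

lemma word_in_FA: "set ws \<subseteq> carrier L \<Longrightarrow> Poly_Mapping.single (FWord ws) c \<in> carrier FA"
  by (rule FA.single_in) simp

lemma word_Cons:
  assumes "x \<in> carrier L" "set ws \<subseteq> carrier L"
  shows "word (x # ws) = uea_incl L x \<otimes>\<^bsub>U\<^esub> word ws"
  using assms by (simp add: uea_incl_def cls_mult word_in_FA mult_single plus_fword_def)

lemma uea_induct [consumes 1, case_names zero smult_word add]:
  assumes "u \<in> carrier U" "P \<zero>\<^bsub>U\<^esub>"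
    and "\<And>c ws. set ws \<subseteq> carrier L \<Longrightarrow> P (c \<odot>\<^bsub>U\<^esub> word ws)"
    and "\<And>u v. u \<in> carrier U \<Longrightarrow> v \<in> carrier U \<Longrightarrow> P u \<Longrightarrow> P v \<Longrightarrow> P (u \<oplus>\<^bsub>U\<^esub> v)"
  shows "P u"
proof -
  have "P (cls F)" if "F \<in> carrier FA" for F
    using that
  proof (induction rule: FA.induct)
    case zero
    then show ?case using assms(2) UQ.coset_zero by (simp add: FA.zero_eq)
  next
    case (single w c)
    have "cls (Poly_Mapping.single w c) = c \<odot>\<^bsub>U\<^esub> cls (pt w)"
      using UQ.coset_smult[of "pt w" c] single by (simp add: FA.single_in FA.smult_single)
    then show ?case using assms(3)[of "letters w" c] single by simp
  next
    case (add F G)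
    then show ?case using assms(4)[of "cls F" "cls G"] by (simp add: UQ.coset_add FA.add_eq)
  qed
  then show ?thesis using UQ.coset_cases[OF assms(1)] by metis
qed

end

section \<open>Lie modules as modules over the enveloping algebra\<close>

context lie_module
begin

sublocale M: cspace M by (rule cspaceI) (rule M.module_axioms)

lemma act_clin: "x \<in> carrier L \<Longrightarrow> clin M M (act M x)"
  by unfold_locales (simp_all add: act_closed act_add_right act_smult_right)

end

locale enveloping_module = enveloping L + lie_module L M
  for L :: "'l lie" (structure) and M :: "('l, 'm) act_module"
begin

lemma foldr_act_clin: "set ws \<subseteq> carrier L \<Longrightarrow> clin M M (foldr (act M) ws)"
proof (induction ws)
  case Nil
  then show ?case using clin_id[OF M.cspace_axioms] by (simp add: id_def)
next
  case (Cons x ws)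
  then show ?case using clin_comp[of M M "foldr (act M) ws" M "act M x"] act_clin by (simp add: o_def)
qed

definition "ev F v = extend_linear M (\<lambda>w. foldr (act M) (letters w) v) F"

lemma foldr_in: "set ws \<subseteq> carrier L \<Longrightarrow> v \<in> carrier M \<Longrightarrow> foldr (act M) ws v \<in> carrier M"
  using clin.closed[OF foldr_act_clin] by blast

lemma ev_clin_left: "v \<in> carrier M \<Longrightarrow> clin FA M (\<lambda>F. ev F v)"
  unfolding ev_def[abs_def]
  by (rule FA.extend_linear_clin) (auto simp: M.cspace_axioms foldr_in)

lemma ev_single: "set (letters w) \<subseteq> carrier L \<Longrightarrow> v \<in> carrier M \<Longrightarrow>
    ev (Poly_Mapping.single w c) v = c \<odot>\<^bsub>M\<^esub> foldr (act M) (letters w) v"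
  unfolding ev_def by (subst FA.extend_linear_single) (auto simp: M.cspace_axioms foldr_in)

lemma ev_add: "F \<in> carrier FA \<Longrightarrow> G \<in> carrier FA \<Longrightarrow> v \<in> carrier M \<Longrightarrow> ev (F + G) v = ev F v \<oplus>\<^bsub>M\<^esub> ev G v"
  using clin.add[OF ev_clin_left] by (simp add: FA.add_eq)

lemma ev_diff: "F \<in> carrier FA \<Longrightarrow> G \<in> carrier FA \<Longrightarrow> v \<in> carrier M \<Longrightarrow> ev (F - G) v = ev F v \<ominus>\<^bsub>M\<^esub> ev G v"
  using clin.diff[OF ev_clin_left] FA.minus_eq by metis

lemma ev_zero: "v \<in> carrier M \<Longrightarrow> ev 0 v = \<zero>\<^bsub>M\<^esub>"
  using clin.zero[OF ev_clin_left] by (simp add: FA.zero_eq)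

lemma ev_in [simp]: "F \<in> carrier FA \<Longrightarrow> v \<in> carrier M \<Longrightarrow> ev F v \<in> carrier M"
  using clin.closed[OF ev_clin_left] by blast

lemma ev_clin_right: "F \<in> carrier FA \<Longrightarrow> clin M M (ev F)"
proof (induction rule: FA.induct)
  case zero
  show ?case by (rule clin_cong[OF clin_zero]) (simp_all add: M.cspace_axioms ev_zero)
next
  case (single w c)
  then have w: "set (letters w) \<subseteq> carrier L" by simp
  show ?case
    by (rule clin_cong[OF clin_smult[OF foldr_act_clin[OF w], of c]]) (simp add: ev_single w)
next
  case (add F G)
  show ?case by (rule clin_cong[OF clin_add[OF add(3,4)]]) (simp add: ev_add add(1,2))
qed

text \<open>On words this says that \<open>foldr\<close> over a concatenation composes the two
  actions; bilinearity does the rest through a double induction.\<close>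

lemma ev_mult:
  assumes "F \<in> carrier FA" "G \<in> carrier FA" "v \<in> carrier M"
  shows "ev (F * G) v = ev F (ev G v)"
  using assms(1)
proof (induction rule: FA.induct)
  case zero
  then show ?case using assms by (simp add: ev_zero)
next
  case (single w c)
  show ?case using assms(2)
  proof (induction rule: FA.induct)
    case zero
    then show ?case
      using assms single clin.zero[OF ev_clin_right, of "Poly_Mapping.single w c"]
      by (simp add: ev_zero FA.single_in)
  next
    case (single w' c')
    then show ?case
      using assms \<open>w \<in> _\<close> clin.smult[OF foldr_act_clin[of "letters w"]]
      by (simp add: ev_single mult_single foldr_in M.smult_smult)
  next
    case (add G H)
    then show ?case
      using assms \<open>w \<in> _\<close> clin.add[OF ev_clin_right, of "Poly_Mapping.single w c"]
      by (simp add: distrib_left ev_add free_algebra_mult_closed FA.single_in)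
  qed
next
  case (add F H)
  then show ?case using assms by (simp add: distrib_right ev_add free_algebra_mult_closed)
qed

text \<open>The elements of the free algebra that annihilate all of \<open>M\<close> form a
  two-sided ideal by \<open>ev_mult\<close>. The Lie module axioms put the defining relations of
  U(L) into it, so it contains the ideal they generate.\<close>

lemma ev_ideal:
  assumes "F \<in> I" "v \<in> carrier M" shows "ev F v = \<zero>\<^bsub>M\<^esub>"
proof -
  let ?J = "{F \<in> carrier FA. \<forall>v\<in>carrier M. ev F v = \<zero>\<^bsub>M\<^esub>}"
  have sub: "submodule ?J complex_field FA"
    using clin.zero[OF ev_clin_left] clin.add[OF ev_clin_left] clin.smult[OF ev_clin_left]
    by (intro FA.subspaceI) auto
  have "ideal ?J FA"
    using submodule.axioms(1)[OF sub] clin.zero[OF ev_clin_right]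
    by (intro idealI free_algebra_ring) (auto simp: free_algebra_mult free_algebra_mult_closed ev_mult)
  moreover have "uea_relations \<subseteq> ?J"
  proof
    fix r assume r: "r \<in> uea_relations"
    have ev_letter: "ev (letter x) v = act M x v" if "x \<in> carrier L" "v \<in> carrier M" for x v
      using that by (simp add: ev_single act_closed)
    have "\<forall>v\<in>carrier M. ev r v = \<zero>\<^bsub>M\<^esub>"
      using r unfolding uea_relations_def
    proof (elim UnE CollectE exE conjE; hypsubst; intro ballI)
      fix x y v assume "x \<in> carrier L" "y \<in> carrier L" "v \<in> carrier M"
      then show "ev (letter (x \<oplus>\<^bsub>L\<^esub> y) - letter x - letter y) v = \<zero>\<^bsub>M\<^esub>"
        "ev (letter x * letter y - letter y * letter x - letter (bracket L x y)) v = \<zero>\<^bsub>M\<^esub>"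
        by (simp_all add: ev_diff FA_diff ev_letter act_add_left M.add_diff_diff M.diff_eq_zero_iff act_closed ev_mult
              free_algebra_mult_closed bracket_closed act_bracket)
    next
      fix c x v assume "x \<in> carrier L" "v \<in> carrier M"
      then show "ev (letter (c \<odot>\<^bsub>L\<^esub> x) - Poly_Mapping.single (FWord [x]) c) v = \<zero>\<^bsub>M\<^esub>"
        by (simp add: ev_diff word_in_FA ev_letter ev_single act_smult_left act_closed M.diff_eq_zero_iff)
    qed
    then show "r \<in> ?J" using uea_relations_subset r by blast
  qed
  ultimately have "I \<subseteq> ?J"
    unfolding uea_ideal_eq by (rule FR.genideal_minimal)
  then show ?thesis using assms by blast
qed

abbreviation "uact \<equiv> act (uea_module M)"

lemma uact_def': "uact B v = the_elem ((\<lambda>F. ev F v) ` B)"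
  by (simp add: uea_module_def with_act_def ev_def extend_linear_def)

lemma uact_cls: "F \<in> carrier FA \<Longrightarrow> v \<in> carrier M \<Longrightarrow> uact (cls F) v = ev F v"
  unfolding uact_def' by (rule UQ.the_elem_coset[OF ev_clin_left]) (simp_all add: ev_ideal)

lemma uact_clin_left: "v \<in> carrier M \<Longrightarrow> clin U M (\<lambda>u. uact u v)"
  unfolding uact_def'[abs_def] by (rule UQ.the_elem_clin[OF ev_clin_left]) (simp_all add: ev_ideal)

lemma uact_clin_right: "u \<in> carrier U \<Longrightarrow> clin M M (uact u)"
  using UQ.coset_cases[of u] uact_cls ev_clin_right by (metis (no_types, lifting) clin_cong)

lemma uact_mult:
  "u \<in> carrier U \<Longrightarrow> u' \<in> carrier U \<Longrightarrow> v \<in> carrier M \<Longrightarrow> uact (u \<otimes>\<^bsub>U\<^esub> u') v = uact u (uact u' v)"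
  by (auto simp: UQ.carrier_image cls_mult uact_cls free_algebra_mult_closed ev_mult)

lemma uact_incl: "x \<in> carrier L \<Longrightarrow> v \<in> carrier M \<Longrightarrow> uact (uea_incl L x) v = act M x v"
  by (simp add: uea_incl_def uact_cls ev_single act_closed)

lemma uact_one: "v \<in> carrier M \<Longrightarrow> uact \<one>\<^bsub>U\<^esub> v = v"
  unfolding word_Nil[symmetric] by (subst uact_cls) (simp_all add: word_in_FA ev_single)

end

lemma with_act_simps [simp]:
  "carrier (with_act M f) = carrier M"
  "ring.add (with_act M f) = ring.add M"
  "ring.zero (with_act M f) = ring.zero M"
  "module.smult (with_act M f) = module.smult M"
  "act (with_act M f) = f"
  by (simp_all add: with_act_def)

lemma cspace_cong:
  assumes "cspace M" "carrier M' = carrier M" "ring.add M' = ring.add M" "\<zero>\<^bsub>M'\<^esub> = \<zero>\<^bsub>M\<^esub>"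
    "module.smult M' = module.smult M"
  shows "cspace M'"
proof -
  interpret cspace M by fact
  show ?thesis
    by (rule cspace_fieldsI)
      (simp_all add: assms(2-) a_ac smult_add_left smult_add_right smult_smult)
qed

lemma cspace_with_act [simp, intro]: "cspace M \<Longrightarrow> cspace (with_act M f)"
  by (erule cspace_cong) simp_all

lemma clin_with_act_right: "clin N M g \<Longrightarrow> clin N (with_act M f) g"
  unfolding clin_def clin_axioms_def by auto

lemma clin_with_act_left: "clin M N g \<Longrightarrow> clin (with_act M f) N g"
  unfolding clin_def clin_axioms_def by auto

lemma bilinear_actionI:
  assumes "cspace R" "cspace M" "\<And>r. r \<in> carrier R \<Longrightarrow> clin M M (act M r)"
    "\<And>v. v \<in> carrier M \<Longrightarrow> clin R M (\<lambda>r. act M r v)"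
  shows "bilinear_action R M"
proof (intro bilinear_action.intro bilinear_action_axioms.intro)
  show "module complex_field R" "module complex_field M"
    using assms by (simp_all add: cspace_def)
qed (simp_all add: clin.closed[OF assms(3)] clin.add[OF assms(3)] clin.smult[OF assms(3)]
    clin.add[OF assms(4)] clin.smult[OF assms(4)])

lemma lie_moduleI:
  fixes L (structure)
  assumes "lie_algebra L" "cspace M" "\<And>x. x \<in> carrier L \<Longrightarrow> clin M M (act M x)"
    "\<And>v. v \<in> carrier M \<Longrightarrow> clin L M (\<lambda>x. act M x v)"
    "\<And>x y v. x \<in> carrier L \<Longrightarrow> y \<in> carrier L \<Longrightarrow> v \<in> carrier M \<Longrightarrow>
      act M (bracket L x y) v = act M x (act M y v) \<ominus>\<^bsub>M\<^esub> act M y (act M x v)"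
  shows "lie_module L M"
  unfolding lie_module_def lie_module_axioms_def
  using bilinear_actionI[of L M] assms by (simp add: cspace_def lie_algebra_def)

text \<open>Operators on the left factor that commute with the action of \<open>A\<close> descend to
  the tensor product, and all identities are checked on pure tensors. Used for left multiplication
  on U(L) in the induced module, and for W_n acting on Q in \<open>QT\<close>.\<close>

lemma
  fixes L (structure)
  assumes T: "balanced_pair A M N" and L: "lie_algebra L"
    and f: "\<And>x. x \<in> carrier L \<Longrightarrow> clin M M (f x)" "\<And>m. m \<in> carrier M \<Longrightarrow> clin L M (\<lambda>x. f x m)"
    and commute: "\<And>x r m. x \<in> carrier L \<Longrightarrow> r \<in> carrier A \<Longrightarrow> m \<in> carrier M \<Longrightarrow>
      f x (act M r m) = act M r (f x m)"
    and bracket: "\<And>x y m. x \<in> carrier L \<Longrightarrow> y \<in> carrier L \<Longrightarrow> m \<in> carrier M \<Longrightarrow>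
      f (bracket L x y) m = f x (f y m) \<ominus>\<^bsub>M\<^esub> f y (f x m)"
  shows tensor_act_clin: "x \<in> carrier L \<Longrightarrow>
      clin (tensor A M N) (tensor A M N) (tensor_map A M N (f x) (\<lambda>v. v))"
    and tensor_act_pure: "x \<in> carrier L \<Longrightarrow> m \<in> carrier M \<Longrightarrow> n \<in> carrier N \<Longrightarrow>
      tensor_map A M N (f x) (\<lambda>v. v) (pure_tensor A M N m n) = pure_tensor A M N (f x m) n"
    and tensor_lie_module: "lie_module L (with_act (tensor A M N) (\<lambda>x. tensor_map A M N (f x) (\<lambda>v. v)))"
proof -
  interpret L: lie_algebra L by (rule L)
  interpret T: balanced_pair A M N by (rule T)
  note id = clin_id[OF T.N.cspace_axioms]
  let ?t = "\<lambda>x. tensor_map A M N (f x) (\<lambda>v. v)" and ?T = "with_act T.T (\<lambda>x. tensor_map A M N (f x) (\<lambda>v. v))"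
  show t: "clin T.T T.T (?t x)" if "x \<in> carrier L" for x
    by (rule tensor_map_clin[OF T T f(1) commute id]) (simp_all add: that)
  show pure: "?t x (T.pure m n) = T.pure (f x m) n"
    if "x \<in> carrier L" "m \<in> carrier M" "n \<in> carrier N" for x m n
    by (rule tensor_map_pure[OF T T f(1) commute id]) (simp_all add: that)
  have p: "clin M T.T (\<lambda>m. T.pure m n)" if "n \<in> carrier N" for n
    using that by unfold_locales (simp_all add: T.pure_add_left T.pure_smult_left)
  have T': "clin T.T ?T g" if "clin T.T T.T g" for g using that by (rule clin_with_act_right)
  show "lie_module L ?T"
  proof (rule lie_moduleI[OF L])
    show "cspace ?T" by (intro cspace_with_act T.Q.cspace_axioms)
    show "clin ?T ?T (act ?T x)" if "x \<in> carrier L" for x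
      using t[OF that] by (simp add: clin_with_act_left T')
    show "clin L ?T (\<lambda>x. act ?T x z)" if z: "z \<in> carrier ?T" for z
    proof (rule clin_with_act_right, unfold_locales)
      fix x y c assume x: "x \<in> carrier L"
      show "act ?T x z \<in> carrier T.T" using clin.closed[OF t[OF x]] z by simp
      show "act ?T (c \<odot> x) z = c \<odot>\<^bsub>T.T\<^esub> act ?T x z"
        using x z T.clin_eqI[OF t clin_smult[OF t], of "c \<odot> x" x c z]
        by (simp add: pure clin.smult[OF f(2)] clin.smult[OF p] clin.closed[OF f(1)])
      assume y: "y \<in> carrier L"
      show "act ?T (x \<oplus> y) z = act ?T x z \<oplus>\<^bsub>T.T\<^esub> act ?T y z"
        using x y z T.clin_eqI[OF t clin_add[OF t t], of "x \<oplus> y" x y z]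
        by (simp add: pure clin.add[OF f(2)] clin.add[OF p] clin.closed[OF f(1)])
    qed
    show "act ?T (bracket L x y) z = act ?T x (act ?T y z) \<ominus>\<^bsub>?T\<^esub> act ?T y (act ?T x z)"
      if x: "x \<in> carrier L" and y: "y \<in> carrier L" and z: "z \<in> carrier ?T" for x y z
    proof -
      have "?t (bracket L x y) z = ?t x (?t y z) \<ominus>\<^bsub>?T\<^esub> ?t y (?t x z)"
      proof (rule T.clin_eqI[OF T'[OF t] clin_diff[OF T'[OF clin_comp[OF t t]] T'[OF clin_comp[OF t t]]]])
        show "?t (bracket L x y) (T.pure m n) = ?t x (?t y (T.pure m n)) \<ominus>\<^bsub>?T\<^esub> ?t y (?t x (T.pure m n))"
          if "m \<in> carrier M" "n \<in> carrier N" for m n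
          using that x y clin.diff[OF clin_with_act_right[OF p], of n "f x (f y m)" "f y (f x m)" ?t]
          by (simp add: pure bracket L.bracket_closed clin.closed[OF f(1)])
      qed (use x y z in \<open>simp_all add: L.bracket_closed\<close>)
      then show ?thesis by simp
    qed
  qed
qed

section \<open>Lie subalgebras and induced modules\<close>

locale lie_subalgebra = enveloping L + K: enveloping K
  for L :: "'l lie" (structure) and K :: "'l lie" +
  assumes subset: "carrier K \<subseteq> carrier L"
    and ops: "ring.add K = ring.add L" "\<zero>\<^bsub>K\<^esub> = \<zero>" "module.smult K = module.smult L"
      "bracket K = bracket L"
begin

lemma K_FA_in: "F \<in> carrier K.FA \<Longrightarrow> F \<in> carrier FA"
  using subset by (auto simp: free_algebra_def)

text \<open>The part of \<open>I\<close> inside the smaller free algebra is an ideal there, and it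
  contains the relations of \<open>K\<close>, which are relations of \<open>L\<close> as well. This
  makes the map from U(K) to U(L) well defined.\<close>

lemma K_ideal: "K.I \<subseteq> I"
proof -
  let ?J = "{F \<in> carrier K.FA. F \<in> I}"
  have "x \<oplus>\<^bsub>K.FA\<^esub> y \<in> I" if "x \<in> I" "y \<in> I" for x y
    using UI.a_closed[OF that] by (simp add: FA.add_eq K.FA.add_eq)
  moreover have "\<zero>\<^bsub>K.FA\<^esub> \<in> I"
    using UI.zero_closed by (simp add: FA.zero_eq K.FA.zero_eq)
  moreover have "c \<odot>\<^bsub>K.FA\<^esub> x \<in> I" if "x \<in> I" for c x
    using FA.subspace_smult[OF ideal_submodule that, of c] by (simp add: FA.smult_eq K.FA.smult_eq)
  ultimately have sub: "submodule ?J complex_field K.FA"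
    by (intro K.FA.subspaceI) auto
  have "ideal ?J K.FA"
    using submodule.axioms(1)[OF sub] UI.I_l_closed UI.I_r_closed K_FA_in
    by (intro idealI free_algebra_ring) (auto simp: free_algebra_mult free_algebra_mult_closed)
  moreover have "K.uea_relations \<subseteq> uea_relations"
    unfolding K.uea_relations_def uea_relations_def ops using subset by blast
  then have "K.uea_relations \<subseteq> ?J"
    using K.uea_relations_subset uea_relations_ideal by blast
  ultimately show ?thesis
    unfolding K.uea_ideal_eq using K.FR.genideal_minimal by blast
qed

definition "uea_map s = coset_map FA I (\<lambda>F. F) s"

lemma uea_map_cls: assumes "F \<in> carrier K.FA" shows "uea_map (K.cls F) = cls F"
proof -
  have "clin K.FA FA (\<lambda>F. F)"
  proof (intro clin.intro clin_axioms.intro K.FA.cspace_axioms FA.cspace_axioms)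
    show "F \<in> carrier FA" if "F \<in> carrier K.FA" for F using that by (rule K_FA_in)
  qed (simp_all only: FA.add_eq K.FA.add_eq FA.smult_eq K.FA.smult_eq)
  from K.UQ.UN_coset[OF this _ ideal_submodule assms] show ?thesis
    unfolding uea_map_def using K_ideal by blast
qed

lemma uea_map_in: "s \<in> carrier K.U \<Longrightarrow> uea_map s \<in> carrier U"
  using uea_map_cls K_FA_in by (auto simp: K.UQ.carrier_image)

end

locale lie_induction = lie_subalgebra L K + N: enveloping_module K N
  for L :: "'l lie" (structure) and K and N :: "('l, 'm) act_module"
begin

abbreviation "R \<equiv> uea_right_module L"
abbreviation "NU \<equiv> uea_module N"
abbreviation "ind \<equiv> induced_module L K N"

lemma R_simps [simp]: "carrier R = carrier U" "ring.add R = ring.add U" "\<zero>\<^bsub>R\<^esub> = \<zero>\<^bsub>U\<^esub>"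
    "module.smult R = module.smult U" "act R s u = u \<otimes>\<^bsub>U\<^esub> uea_map s"
  by (simp_all add: uea_right_module_def uea_map_def)

lemma NU_simps [simp]: "carrier NU = carrier N" "ring.add NU = ring.add N" "\<zero>\<^bsub>NU\<^esub> = \<zero>\<^bsub>N\<^esub>"
    "module.smult NU = module.smult N"
  by (simp_all add: uea_module_def)

lemma NU_cspace: "cspace NU"
  unfolding uea_module_def by (intro cspace_with_act N.M.cspace_axioms)

lemma R_cspace: "cspace R"
  unfolding uea_right_module_def by (intro cspace_with_act UQ.Q.cspace_axioms)

lemma R_clin: "clin U M f \<Longrightarrow> clin R M f"
  unfolding uea_right_module_def by (rule clin_with_act_left)

lemma R_clin': "clin U U f \<Longrightarrow> clin R R f"
  unfolding uea_right_module_def by (intro clin_with_act_left clin_with_act_right)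

lemma NU_clin: "clin N M f \<Longrightarrow> clin NU M f"
  unfolding uea_module_def by (rule clin_with_act_left)

sublocale T: balanced_pair K.U R NU
  by (intro balanced_pair.intro balanced_pair_axioms.intro R_cspace NU_cspace)
    (simp_all add: uea_map_in clin.closed[OF N.uact_clin_right])

lemma ind_simps [simp]: "carrier ind = carrier T.T" "ring.add ind = ring.add T.T"
    "\<zero>\<^bsub>ind\<^esub> = \<zero>\<^bsub>T.T\<^esub>" "module.smult ind = module.smult T.T"
    "act ind x = tensor_map K.U R NU (\<lambda>u. uea_incl L x \<otimes>\<^bsub>U\<^esub> u) (\<lambda>v. v)"
  by (simp_all add: induced_module_def)

lemma ind_clin: "clin T.T M f \<Longrightarrow> clin ind M f"
  unfolding induced_module_def by (rule clin_with_act_left)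

lemma ind_cspace: "cspace ind"
  unfolding induced_module_def by (intro cspace_with_act T.Q.cspace_axioms)

lemma pure_clin_left: "m \<in> carrier N \<Longrightarrow> clin U T.T (\<lambda>u. T.pure u m)"
  using T.pure_add_left[where y = m] T.pure_smult_left[where y = m] T.pure_in[where y = m]
  by unfold_locales simp_all

lemma
  shows act_ind_clin: "x \<in> carrier L \<Longrightarrow> clin T.T T.T (act ind x)"
    and act_ind_pure: "x \<in> carrier L \<Longrightarrow> u \<in> carrier U \<Longrightarrow> m \<in> carrier N \<Longrightarrow>
      act ind x (T.pure u m) = T.pure (uea_incl L x \<otimes>\<^bsub>U\<^esub> u) m"
    and ind_lie_module: "lie_module L ind"
proof -
  let ?f = "\<lambda>x u. uea_incl L x \<otimes>\<^bsub>U\<^esub> u"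
  have U_R: "clin M R g" if "clin M U g" for M :: "'l lie" and g
    unfolding uea_right_module_def using that by (rule clin_with_act_right)
  have "clin U R (\<lambda>u. u)"
    unfolding uea_right_module_def by (intro clin_with_act_right clin_id UQ.Q.cspace_axioms)
  note diff = clin.diff[OF this]
  have f: "clin R R (?f x)" if "x \<in> carrier L" for x
    using that by (intro R_clin' U_mult_left_clin) simp
  have f': "clin L R (\<lambda>x. ?f x u)" if "u \<in> carrier R" for u
    using that by (intro U_R clin_comp[OF incl_clin U_mult_right_clin]) simp
  have commute: "?f x (act R s u) = act R s (?f x u)" if "x \<in> carrier L" "s \<in> carrier K.U" "u \<in> carrier R" for x s u
    using that by (simp add: U.m_assoc uea_map_in)
  have bracket: "?f (bracket L x y) u = ?f x (?f y u) \<ominus>\<^bsub>R\<^esub> ?f y (?f x u)"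
    if "x \<in> carrier L" "y \<in> carrier L" "u \<in> carrier R" for x y u
    using that clin.diff[OF U_mult_right_clin, of u] by (simp add: incl_bracket U.m_assoc diff)
  note [simp del] = R_simps NU_simps
  show "clin T.T T.T (act ind x)" if "x \<in> carrier L"
    using tensor_act_clin[OF T.balanced_pair_axioms lie_algebra_axioms f f' commute bracket that] by simp
  show "act ind x (T.pure u m) = T.pure (?f x u) m" if "x \<in> carrier L" "u \<in> carrier U" "m \<in> carrier N"
    using tensor_act_pure[OF T.balanced_pair_axioms lie_algebra_axioms f f' commute bracket that(1), of u m] that
    by (simp add: R_simps NU_simps)
  show "lie_module L ind"
    using tensor_lie_module[OF T.balanced_pair_axioms lie_algebra_axioms f f' commute bracket]
    unfolding induced_module_def by simp
qed

text \<open>Applying the letters of a word one after another to 1 tensor m yields that word tensor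
  m; words span U(L), and pure tensors span the module.\<close>

lemma ind_generated:
  assumes "submodule S complex_field ind" "\<And>x z. x \<in> carrier L \<Longrightarrow> z \<in> S \<Longrightarrow> act ind x z \<in> S"
    "\<And>m. m \<in> carrier N \<Longrightarrow> T.pure \<one>\<^bsub>U\<^esub> m \<in> S" "z \<in> carrier ind"
  shows "z \<in> S"
proof -
  interpret ind: cspace ind by (rule ind_cspace)
  note S = ind.submoduleE(5)[OF assms(1)] ind.subspace_smult[OF assms(1)] ind.subspace_zero[OF assms(1)]
  have word: "T.pure (word ws) m \<in> S" if "set ws \<subseteq> carrier L" "m \<in> carrier N" for ws m
    using that
  proof (induction ws)
    case Nil
    then show ?case by (simp only: word_Nil assms(3))
  next
    case (Cons x ws)
    then show ?case
      using assms(2)[of x "T.pure (word ws) m"]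
      by (simp add: act_ind_pure word_Cons word_in_FA del: ind_simps(5))
  qed
  have "T.pure u m \<in> S" if "u \<in> carrier U" "m \<in> carrier N" for u m
    using that(1)
  proof (induction rule: uea_induct)
    case zero
    then show ?case using clin.zero[OF pure_clin_left[OF that(2)]] S(3) by simp
  next
    case (smult_word c ws)
    then show ?case
      using clin.smult[OF pure_clin_left[OF that(2)]] S(2)[OF word[OF _ that(2)]]
      by (simp add: word_in_FA)
  next
    case (add u v)
    then show ?case using clin.add[OF pure_clin_left[OF that(2)]] S(1) by simp
  qed
  moreover have "z \<in> carrier T.T" using assms(4) by simp
  ultimately show ?thesis
    using S by (intro T.tensor_induct[of z "\<lambda>z. z \<in> S"]) simp_all
qed

lemma ind_hom_unique:
  assumes "cspace P" "f \<in> act_hom (carrier L) ind P" "g \<in> act_hom (carrier L) ind P"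
    "\<And>m. m \<in> carrier N \<Longrightarrow> f (T.pure \<one>\<^bsub>U\<^esub> m) = g (T.pure \<one>\<^bsub>U\<^esub> m)"
  shows "f = g"
proof (rule act_hom_ext[OF assms(2,3)])
  fix z assume z: "z \<in> carrier ind"
  interpret P: cspace P by fact
  interpret ind: lie_module L ind by (rule ind_lie_module)
  interpret f: clin ind P f by (rule act_hom_clin[OF assms(2) ind_cspace assms(1)])
  interpret g: clin ind P g by (rule act_hom_clin[OF assms(3) ind_cspace assms(1)])
  interpret d: clin ind P "\<lambda>z. f z \<ominus>\<^bsub>P\<^esub> g z"
    by (rule clin_diff[OF f.clin_axioms g.clin_axioms])
  have ker: "{z \<in> carrier ind. f z \<ominus>\<^bsub>P\<^esub> g z = \<zero>\<^bsub>P\<^esub>} = {z \<in> carrier ind. f z = g z}"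
    using f.closed g.closed P.diff_eq_zero_iff by blast
  have one: "T.pure \<one>\<^bsub>U\<^esub> m \<in> carrier ind" if "m \<in> carrier N" for m
    using that by simp
  have "z \<in> {z \<in> carrier ind. f z = g z}"
    by (rule ind_generated[OF d.kernel_submodule[unfolded ker] _ _ z])
      (use ind.act_closed act_homD[OF assms(2)] act_homD[OF assms(3)] assms(4) one in
        \<open>auto simp del: ind_simps\<close>)
  then show "f z = g z" by blast
qed

text \<open>Frobenius reciprocity: the homomorphism sends u tensor m to u acting on
  \<open>\<phi> m\<close>.\<close>

lemma ind_hom_exists:
  assumes P: "lie_module L P" and \<phi>: "clin N P \<phi>"
    "\<And>k m. k \<in> carrier K \<Longrightarrow> m \<in> carrier N \<Longrightarrow> \<phi> (act N k m) = act P k (\<phi> m)"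
  shows "\<exists>f \<in> act_hom (carrier L) ind P. \<forall>m\<in>carrier N. f (T.pure \<one>\<^bsub>U\<^esub> m) = \<phi> m"
proof -
  interpret P: enveloping_module L P by (intro enveloping_module.intro enveloping_axioms P)
  interpret phi: clin N P \<phi> by (rule \<phi>(1))
  let ?b = "\<lambda>u m. P.uact u (\<phi> m)"
  \<comment> \<open>Equivariance for single elements of \<open>K\<close> passes to words and then to
    all of U(K); balancedness of the bilinear map follows from it.\<close>
  have ev: "P.uact (cls F) (\<phi> m) = \<phi> (N.uact (K.cls F) m)" if "F \<in> carrier K.FA" "m \<in> carrier N" for F m
  proof -
    have "P.ev F (\<phi> m) = \<phi> (N.ev F m)"
      using that(1)
    proof (induction rule: K.FA.induct)
      case zero
      then show ?case using that by (simp add: P.ev_zero N.ev_zero phi.zero)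
    next
      case (single w c)
      have "foldr (act P) ws (\<phi> m) = \<phi> (foldr (act N) ws m)" if "set ws \<subseteq> carrier K" for ws
        using that \<open>m \<in> carrier N\<close> by (induction ws) (simp_all add: \<phi>(2) N.foldr_in)
      then show ?case using single that subset
        by (subst P.ev_single) (auto simp: N.ev_single phi.smult N.foldr_in)
    next
      case (add F G)
      then show ?case using that by (simp add: P.ev_add N.ev_add phi.add K_FA_in)
    qed
    then show ?thesis using that by (simp add: P.uact_cls N.uact_cls K_FA_in)
  qed
  have bal: "?b (act R s u) m = ?b u (act NU s m)"
    if s: "s \<in> carrier K.U" and "u \<in> carrier R" "m \<in> carrier NU" for s u m
  proof -
    obtain F where F: "F \<in> carrier K.FA" "s = K.cls F" using s by (rule K.UQ.coset_cases)
    then show ?thesis using that by (simp add: uea_map_cls P.uact_mult K_FA_in ev)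
  qed
  have left: "clin R P (\<lambda>u. ?b u m)" if "m \<in> carrier NU" for m
    using that by (intro R_clin P.uact_clin_left) simp
  have right: "clin NU P (?b u)" if "u \<in> carrier R" for u
    using that by (intro NU_clin clin_comp[OF \<phi>(1) P.uact_clin_right]) simp
  let ?f = "T.lift P ?b"
  have f: "clin T.T P ?f" "\<And>u m. u \<in> carrier R \<Longrightarrow> m \<in> carrier NU \<Longrightarrow> ?f (T.pure u m) = ?b u m"
    by (rule T.lift_clin[OF P.M.cspace_axioms left right bal]; assumption)
      (rule T.lift_pure[OF P.M.cspace_axioms left right bal])
  have equiv: "?f (act ind x z) = act P x (?f z)" if "x \<in> carrier L" "z \<in> carrier ind" for x z
  proof (rule T.clin_eqI[OF clin_comp[OF act_ind_clin f(1)] clin_comp[OF f(1) P.act_clin]])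
    show "?f (act ind x (T.pure u m)) = act P x (?f (T.pure u m))"
      if "u \<in> carrier R" "m \<in> carrier NU" for u m
      using that \<open>x \<in> carrier L\<close> by (simp add: act_ind_pure f(2) P.uact_mult P.uact_incl
          clin.closed[OF P.uact_clin_right] del: ind_simps(5))
  qed (use that in simp_all)
  show ?thesis
  proof
    show "restrict ?f (carrier ind) \<in> act_hom (carrier L) ind P"
      using equiv clin.closed[OF act_ind_clin]
      by (intro act_hom_restrictI ind_clin f(1)) (simp_all del: ind_simps(5))
    show "\<forall>m\<in>carrier N. restrict ?f (carrier ind) (T.pure \<one>\<^bsub>U\<^esub> m) = \<phi> m"
      by (simp add: f(2) P.uact_one)
  qed
qed

end

section \<open>Decomposition by shift operators\<close>

text \<open>For the intended D = \<open>partial i\<close> - a_i and h = h_i, the extra term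
  \<open>D v \<oplus> \<alpha> \<odot> v\<close> is the action of \<open>partial i\<close> itself on
  v.\<close>

locale shift_pair = cspace M
  for M :: "(complex, 'm, 'x) module_scheme" (structure) +
  fixes D h :: "'m \<Rightarrow> 'm" and \<alpha> :: complex
  assumes D_clin: "clin M M D" and h_clin: "clin M M h"
    and D_h: "v \<in> carrier M \<Longrightarrow> D (h v) = h (D v) \<oplus> (D v \<oplus> \<alpha> \<odot> v)"
begin

sublocale D: clin M M D by (rule D_clin)
sublocale h: clin M M h by (rule h_clin)

lemma Dk_in [simp]: "v \<in> carrier M \<Longrightarrow> (D ^^ k) v \<in> carrier M"
  using clin.closed[OF clin_funpow[OF D_clin]] by blast

lemma hk_in [simp]: "v \<in> carrier M \<Longrightarrow> (h ^^ k) v \<in> carrier M"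
  using clin.closed[OF clin_funpow[OF h_clin]] by blast

text \<open>[D, h] = D + \<alpha> commutes with D, so the Leibniz rule gives [D^(k+1), h] = (k+1)
  D^k (D + \<alpha>). Writing the power as \<open>Suc k\<close> avoids k - 1.\<close>

lemma Dk_h:
  assumes "v \<in> carrier M"
  shows "(D ^^ Suc k) (h v) = h ((D ^^ Suc k) v) \<oplus> of_nat (Suc k) \<odot> ((D ^^ Suc k) v \<oplus> \<alpha> \<odot> (D ^^ k) v)"
proof (induction k)
  case 0
  then show ?case using assms D_h by simp
next
  case (Suc k)
  let ?u = "(D ^^ Suc k) v" and ?z = "(D ^^ Suc (Suc k)) v \<oplus> \<alpha> \<odot> (D ^^ Suc k) v"
  have u: "?u \<in> carrier M" "(D ^^ k) v \<in> carrier M" "D ((D ^^ k) v) \<in> carrier M"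
    using assms Dk_in D.closed by blast+
  have z: "?z \<in> carrier M" using assms D.closed by simp
  have "(D ^^ Suc (Suc k)) (h v)
      = D (h ?u \<oplus> of_nat (Suc k) \<odot> (?u \<oplus> \<alpha> \<odot> (D ^^ k) v))"
    using Suc.IH by simp
  also have "\<dots> = D (h ?u) \<oplus> of_nat (Suc k) \<odot> ?z"
    using u by (simp add: D.add D.smult)
  also have "\<dots> = h (D ?u) \<oplus> (D ?u \<oplus> \<alpha> \<odot> ?u) \<oplus> of_nat (Suc k) \<odot> ?z"
    by (simp only: D_h[OF u(1)])
  also have "\<dots> = h (D ?u) \<oplus> (?z \<oplus> of_nat (Suc k) \<odot> ?z)"
    using u z by (simp add: a_assoc)
  also have "?z \<oplus> of_nat (Suc k) \<odot> ?z = of_nat (Suc (Suc k)) \<odot> ?z"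
    using smult_add_left[OF z, of 1 "of_nat (Suc k)"] z by simp
  finally show ?case by simp
qed

text \<open>One factor h costs at most one factor D: for D^k h^(j+1) w with j + 1 < k, the terms of
  \<open>Dk_h\<close> contain D^k or D^(k-1) applied to h^j w, and j < k - 1 lets the induction
  hypothesis kill both.\<close>

lemma Dk_hj_zero:
  assumes "w \<in> carrier M" "D w = \<zero>" "j < k"
  shows "(D ^^ k) ((h ^^ j) w) = \<zero>"
  using assms(3)
proof (induction j arbitrary: k)
  case 0
  then obtain k' where "k = Suc k'" by (cases k) auto
  then show ?case
    using assms(2) clin.zero[OF clin_funpow[OF D_clin]] by (simp add: funpow_Suc_right del: funpow.simps)
next
  case (Suc j)
  then obtain k' where k: "k = Suc k'" "j < k'" by (cases k) auto
  then show ?case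
    using Dk_h[of "(h ^^ j) w" k'] Suc.IH[of k] Suc.IH[of k'] assms(1) h.zero by simp
qed

text \<open>By \<open>Dk_hj_zero\<close> only the term with \<alpha> D^k survives in
  \<open>Dk_h\<close>; passing from k to k + 1 contributes the factor (k+1) \<alpha>.\<close>

lemma Dk_hk:
  assumes "w \<in> carrier M" "D w = \<zero>"
  shows "(D ^^ k) ((h ^^ k) w) = (\<alpha> ^ k * fact k) \<odot> w"
proof (induction k)
  case 0
  then show ?case using assms by simp
next
  case (Suc k)
  have "(D ^^ Suc k) ((h ^^ k) w) = \<zero>" by (rule Dk_hj_zero[OF assms]) simp
  then show ?case
    using Dk_h[of "(h ^^ k) w" k] Suc assms(1) h.zero
    by (simp add: smult_smult) (simp add: algebra_simps)
qed

end

section \<open>Families of such operators: spanning and independence\<close>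

locale shift_family = cspace M
  for M :: "(complex, 'm, 'x) module_scheme" (structure) +
  fixes D h :: "'i \<Rightarrow> 'm \<Rightarrow> 'm" and \<alpha> :: "'i \<Rightarrow> complex"
  assumes D_clin: "clin M M (D i)" and h_clin: "clin M M (h i)"
    and D_D: "v \<in> carrier M \<Longrightarrow> D i (D j v) = D j (D i v)"
    and D_h_self: "v \<in> carrier M \<Longrightarrow> D i (h i v) = h i (D i v) \<oplus> (D i v \<oplus> \<alpha> i \<odot> v)"
    and D_h_other: "v \<in> carrier M \<Longrightarrow> i \<noteq> j \<Longrightarrow> D i (h j v) = h j (D i v)"
    and nonzero: "\<alpha> i \<noteq> 0"
    and nilpotent: "v \<in> carrier M \<Longrightarrow> \<exists>k. (D i ^^ k) v = \<zero>"
begin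

sublocale shift_pair M "D i" "h i" "\<alpha> i" for i
  by (intro shift_pair.intro shift_pair_axioms.intro cspace_axioms D_clin h_clin D_h_self)

definition "kers = {v \<in> carrier M. \<forall>i. D i v = \<zero>}"

text \<open>The list fixes the order of the factors, its head acting last; spanning and independence
  are proved by recursion on it, one index at a time.\<close>

definition "hpow l m = foldr (\<lambda>i. h i ^^ m i) l"

lemma hpow_Cons: "hpow (i # l) m v = (h i ^^ m i) (hpow l m v)"
  by (simp add: hpow_def)

lemma hpow_Nil [simp]: "hpow [] m v = v"
  by (simp add: hpow_def)

lemma hpow_cong: "(\<And>i. i \<in> set l \<Longrightarrow> m i = m' i) \<Longrightarrow> hpow l m v = hpow l m' v"
  by (induction l) (simp_all add: hpow_Cons)

lemma hpow_clin: "clin M M (hpow l m)"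
proof (induction l)
  case Nil
  then show ?case using clin_id[OF cspace_axioms] by (simp add: hpow_def id_def)
next
  case (Cons i l)
  then show ?case
    using clin_comp[OF Cons clin_funpow[OF h_clin[of i], of "m i"]]
    by (simp add: hpow_Cons[symmetric, abs_def] hpow_def o_def)
qed

lemma hpow_in [simp]: "v \<in> carrier M \<Longrightarrow> hpow l m v \<in> carrier M"
  using clin.closed[OF hpow_clin] by blast

lemma kers_submodule: "submodule kers complex_field M"
  by (rule subspaceI) (auto simp: kers_def D.add D.smult D.zero)

lemma kersD: "v \<in> kers \<Longrightarrow> v \<in> carrier M" "v \<in> kers \<Longrightarrow> D i v = \<zero>"
  by (simp_all add: kers_def)

lemma D_hk_other: "v \<in> carrier M \<Longrightarrow> i \<noteq> j \<Longrightarrow> D i ((h j ^^ k) v) = (h j ^^ k) (D i v)"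
  by (induction k) (simp_all add: D_h_other)

lemma D_hpow_other: "v \<in> carrier M \<Longrightarrow> i \<notin> set l \<Longrightarrow> D i (hpow l m v) = hpow l m (D i v)"
  by (induction l) (simp_all add: hpow_Cons D_hk_other)

lemma D_Dk: "v \<in> carrier M \<Longrightarrow> D i ((D j ^^ k) v) = (D j ^^ k) (D i v)"
proof (induction k)
  case (Suc k)
  then show ?case using D_D[of "(D j ^^ k) v" i j] by simp
qed simp

text \<open>
  If \<open>k + 1\<close> applications of \<open>D\<^sub>i\<close> kill \<open>v\<close>, then \<open>k\<close> of them kill \<open>v - h\<^sub>i\<^sup>k u\<close> where
  \<open>u = D\<^sub>i\<^sup>k v / (k! \<alpha>\<^sub>i\<^sup>k)\<close>.
\<close>

lemma hpow_generate:
  assumes "distinct l" "submodule S complex_field M" "\<And>m w. w \<in> kers \<Longrightarrow> hpow l m w \<in> S"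
    "v \<in> carrier M" "\<And>j. j \<notin> set l \<Longrightarrow> D j v = \<zero>"
  shows "v \<in> S"
  using assms
proof (induction l arbitrary: S v)
  case Nil
  then have "v \<in> kers" by (simp add: kers_def)
  then show ?case using Nil(3)[of v] by simp
next
  case (Cons i l)
  note S = submoduleE(5)[OF Cons.prems(2)] subspace_smult[OF Cons.prems(2)]
    subspace_zero[OF Cons.prems(2)]
  \<comment> \<open>The target subspace \<open>S\<close> is kept general in the induction because
    the hypothesis for \<open>l\<close> is applied to the preimage of \<open>S\<close> under
    h_i^k.\<close>
  have hk: "(h i ^^ k) u \<in> S" if "u \<in> carrier M" "\<And>j. j \<notin> set l \<Longrightarrow> D j u = \<zero>" for u k
  proof -
    have "u \<in> {u \<in> carrier M. (h i ^^ k) u \<in> S}"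
    proof (rule Cons.IH)
      show "submodule {u \<in> carrier M. (h i ^^ k) u \<in> S} complex_field M"
        by (rule clin.vimage_submodule[OF clin_funpow[OF h_clin] Cons.prems(2)])
      fix m w assume w: "w \<in> kers"
      \<comment> \<open>The list is distinct, so i does not occur in \<open>l\<close>, and the
        exponent at i can be set to k without affecting the inner factors.\<close>
      have "hpow l (m(i := k)) w = hpow l m w"
        using Cons.prems(1) by (intro hpow_cong) auto
      then have eq: "hpow (i # l) (m(i := k)) w = (h i ^^ k) (hpow l m w)"
        by (simp add: hpow_Cons)
      then show "hpow l m w \<in> {u \<in> carrier M. (h i ^^ k) u \<in> S}"
        using Cons.prems(3)[OF w, of "m(i := k)", unfolded eq] kersD(1)[OF w] by simp
    qed (use that Cons.prems in auto)
    then show ?thesis by simp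
  qed
  have "v \<in> S" if "(D i ^^ k) v = \<zero>" "v \<in> carrier M" "\<And>j. j \<notin> set (i # l) \<Longrightarrow> D j v = \<zero>" for k v
    using that
  proof (induction k arbitrary: v)
    case 0
    then show ?case using S(3) by simp
  next
    case (Suc k)
    let ?u = "(D i ^^ k) v"
    let ?c = "1 / (\<alpha> i ^ k * fact k)"
    let ?w = "?c \<odot> (h i ^^ k) ?u"
    have u: "?u \<in> carrier M" "D i ?u = \<zero>" using Suc.prems by auto
    \<comment> \<open>Outside \<open>i # l\<close> the vector u inherits the vanishing from v, since
      the D_j commute; for j = i it is D_i^(k+1) v = 0.\<close>
    have Du: "D j ?u = \<zero>" if "j \<notin> set l" for j
    proof (cases "j = i")
      case False
      then show ?thesis
        using Suc.prems(3)[of j] that D_Dk[OF Suc.prems(2)] clin.zero[OF clin_funpow[OF D_clin]] by simp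
    qed (use u in simp)
    have w: "?w \<in> S" using S(2) hk[OF u(1) Du] by simp
    have "(D i ^^ k) ?w = (?c * (\<alpha> i ^ k * fact k)) \<odot> ?u"
      using clin.smult[OF clin_funpow[OF D_clin], of "(h i ^^ k) ?u"] Dk_hk[OF u] u(1)
      by (simp add: smult_smult)
    also have "\<dots> = ?u"
      using nonzero[of i] u by simp
    finally have "(D i ^^ k) (v \<ominus> ?w) = \<zero>"
      using u Suc.prems by (simp add: clin.diff[OF clin_funpow[OF D_clin]] diff_eq_zero_iff)
    moreover have "D j (v \<ominus> ?w) = \<zero>" if "j \<notin> set (i # l)" for j
      using that Suc.prems(2,3) u Du
      by (simp add: D.diff D.smult D_hk_other clin.zero[OF clin_funpow[OF h_clin]] diff_eq_zero_iff)
    ultimately have "v \<ominus> ?w \<in> S" using Suc.prems u by (intro Suc.IH) simp_all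
    then have "(v \<ominus> ?w) \<oplus> ?w \<in> S" using S(1) w by blast
    moreover have "(v \<ominus> ?w) \<oplus> ?w = v"
      using Suc.prems u by (simp add: a_minus_def a_assoc l_neg)
    ultimately show ?case by simp
  qed
  then show ?case using nilpotent[OF Cons.prems(4)] Cons.prems(4,5) by blast
qed

text \<open>
  For the independence, apply \<open>D\<^sub>i\<^sup>k\<close> where \<open>k\<close> is the largest exponent of \<open>h\<^sub>i\<close> with a nonzero
  coefficient: this removes all terms with a smaller exponent.
\<close>

lemma hpow_independent:
  assumes "distinct l" "finite J" "\<And>m. m \<in> J \<Longrightarrow> w m \<in> kers"
    "\<And>m m'. m \<in> J \<Longrightarrow> m' \<in> J \<Longrightarrow> (\<And>i. i \<in> set l \<Longrightarrow> m i = m' i) \<Longrightarrow> m = m'"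
    "(\<Oplus>m\<in>J. hpow l m (w m)) = \<zero>" "m \<in> J"
  shows "w m = \<zero>"
  using assms
proof (induction l arbitrary: J w m)
  case Nil
  \<comment> \<open>Any two exponents agree vacuously on the empty list, so the separation
    hypothesis leaves a single term.\<close>
  then have "J = {m}" by auto
  then show ?case using Nil(3,5) kersD(1) by simp
next
  case (Cons i l)
  note w = kersD[OF Cons.prems(3)]
  \<comment> \<open>Zero coefficients are discarded so that the largest exponent of h_i is attained
    at a nonzero coefficient, which the induction hypothesis then refutes.\<close>
  define J' where "J' = {m \<in> J. w m \<noteq> \<zero>}"
  have "J' = {}"
  proof (rule ccontr)
    assume ne: "J' \<noteq> {}"
    have fin: "finite J'" using Cons.prems(2) by (simp add: J'_def)
    define k where "k = Max ((\<lambda>m. m i) ` J')"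
    have le: "m i \<le> k" if "m \<in> J'" for m using that fin by (simp add: k_def)
    have "k \<in> (\<lambda>m. m i) ` J'" unfolding k_def using fin ne by simp
    then obtain n where n: "n \<in> J'" "n i = k" by auto
    define J'' where "J'' = {m \<in> J'. m i = k}"
    let ?c = "\<alpha> i ^ k * fact k"
    have J'J: "m \<in> J" if "m \<in> J'" for m using that by (simp add: J'_def)
    have Dh: "(D i ^^ k) (hpow (i # l) m (w m)) = (if m i = k then hpow l m (?c \<odot> w m) else \<zero>)"
      if m: "m \<in> J'" for m
    proof -
      have "D i (hpow l m (w m)) = \<zero>"
        using w[OF J'J[OF m]] Cons.prems(1) clin.zero[OF hpow_clin] by (simp add: D_hpow_other)
      then show ?thesis
        using Dk_hj_zero[of "hpow l m (w m)" i "m i" k] Dk_hk[of "hpow l m (w m)" i k] le[OF m]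
          w(1)[OF J'J[OF m]] clin.smult[OF hpow_clin]
        by (auto simp: hpow_Cons)
    qed
    have "\<zero> = (\<Oplus>m\<in>J. hpow (i # l) m (w m))" using Cons.prems(5) by simp
    also have "\<dots> = (\<Oplus>m\<in>J'. hpow (i # l) m (w m))"
      using w Cons.prems(2) clin.zero[OF hpow_clin, of "i # l"]
      by (intro add.finprod_mono_neutral_cong_right) (auto simp: J'_def)
    finally have "(D i ^^ k) (\<Oplus>m\<in>J'. hpow (i # l) m (w m)) = \<zero>"
      using clin.zero[OF clin_funpow[OF D_clin]] by simp
    then have "(\<Oplus>m\<in>J'. (D i ^^ k) (hpow (i # l) m (w m))) = \<zero>"
      using w J'J by (subst (asm) clin.finsum[OF clin_funpow[OF D_clin]]) auto
    also have "(\<Oplus>m\<in>J'. (D i ^^ k) (hpow (i # l) m (w m))) = (\<Oplus>m\<in>J''. hpow l m (?c \<odot> w m))"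
      using w J'J Cons.prems(2) fin Dh
      by (intro add.finprod_mono_neutral_cong_right) (auto simp: J''_def)
    finally have "?c \<odot> w n = \<zero>"
    proof (intro Cons.IH[of J'' "\<lambda>m. ?c \<odot> w m" n])
      \<comment> \<open>On \<open>J''\<close> the exponent at i is constantly k, so its members are
        still told apart by their values on \<open>l\<close>.\<close>
      fix m m' assume m: "m \<in> J''" "m' \<in> J''" "\<And>j. j \<in> set l \<Longrightarrow> m j = m' j"
      then have "m j = m' j" if "j \<in> set (i # l)" for j
        using that by (auto simp: J''_def)
      then show "m = m'"
        using m by (intro Cons.prems(4)) (auto simp: J''_def J'_def)
    qed (use Cons.prems n fin subspace_smult[OF kers_submodule] in \<open>auto simp: J''_def J'_def\<close>)
    then have "(1 / ?c) \<odot> (?c \<odot> w n) = \<zero>" by simp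
    then have "w n = \<zero>" using w(1)[OF J'J[OF n(1)]] nonzero[of i] by (simp add: smult_smult)
    then show False using n by (simp add: J'_def)
  qed
  then show ?case using Cons.prems(6) by (auto simp: J'_def)
qed

end

section \<open>Unique expansions\<close>

locale full_shift_family = shift_family M D h \<alpha>
  for M :: "(complex, 'm, 'x) module_scheme" (structure) and D h :: "'i \<Rightarrow> 'm \<Rightarrow> 'm" and \<alpha> +
  fixes l :: "'i list"
  assumes l: "distinct l" "set l = UNIV"
begin

text \<open>The coefficients form one function on all exponents, and \<open>J\<close> is merely some
  finite set containing its support. Uniqueness is then plain equality of functions, and supports of
  different expansions can be enlarged to a common set.\<close>

definition "expansion v w \<longleftrightarrow> (\<forall>m. w m \<in> kers) \<and>
  (\<exists>J. finite J \<and> (\<forall>m. m \<notin> J \<longrightarrow> w m = \<zero>) \<and> v = (\<Oplus>m\<in>J. hpow l m (w m)))"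

lemma expansion_superset:
  assumes "finite J" "J \<subseteq> J'" "finite J'" "\<And>m. m \<notin> J \<Longrightarrow> w m = \<zero>" "\<And>m. w m \<in> kers"
  shows "(\<Oplus>m\<in>J. hpow l m (w m)) = (\<Oplus>m\<in>J'. hpow l m (w m))"
  using assms kersD(1)[OF assms(5)] clin.zero[OF hpow_clin]
  by (intro add.finprod_mono_neutral_cong_left) auto

lemma expansion_add:
  assumes "expansion v w" "expansion v' w'"
  shows "expansion (v \<oplus> v') (\<lambda>m. w m \<oplus> w' m)"
proof -
  obtain J where J: "finite J" "\<And>m. m \<notin> J \<Longrightarrow> w m = \<zero>" "v = (\<Oplus>m\<in>J. hpow l m (w m))"
    using assms(1) by (auto simp: expansion_def)
  obtain J' where J': "finite J'" "\<And>m. m \<notin> J' \<Longrightarrow> w' m = \<zero>" "v' = (\<Oplus>m\<in>J'. hpow l m (w' m))"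
    using assms(2) by (auto simp: expansion_def)
  have w: "w m \<in> kers" "w' m \<in> kers" for m using assms by (auto simp: expansion_def)
  have "v = (\<Oplus>m\<in>J \<union> J'. hpow l m (w m))" "v' = (\<Oplus>m\<in>J \<union> J'. hpow l m (w' m))"
    using J J' w expansion_superset by auto
  then have "v \<oplus> v' = (\<Oplus>m\<in>J \<union> J'. hpow l m (w m) \<oplus> hpow l m (w' m))"
    using w kersD(1) by (subst finsum_addf) auto
  also have "\<dots> = (\<Oplus>m\<in>J \<union> J'. hpow l m (w m \<oplus> w' m))"
    using w kersD(1) clin.add[OF hpow_clin] by (intro finsum_cong') auto
  finally have "v \<oplus> v' = (\<Oplus>m\<in>J \<union> J'. hpow l m (w m \<oplus> w' m))" .
  moreover have "w m \<oplus> w' m = \<zero>" if "m \<notin> J \<union> J'" for m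
    using that J(2) J'(2) by simp
  ultimately show ?thesis
    unfolding expansion_def using J(1) J'(1) w submoduleE(5)[OF kers_submodule] by blast
qed

lemma expansion_smult:
  assumes "expansion v w" shows "expansion (c \<odot> v) (\<lambda>m. c \<odot> w m)"
proof -
  obtain J where J: "finite J" "\<And>m. m \<notin> J \<Longrightarrow> w m = \<zero>" "v = (\<Oplus>m\<in>J. hpow l m (w m))"
    using assms(1) by (auto simp: expansion_def)
  have w: "w m \<in> kers" for m using assms by (auto simp: expansion_def)
  have "c \<odot> v = (\<Oplus>m\<in>J. c \<odot> hpow l m (w m))"
    unfolding J(3) using J w kersD(1) by (intro finsum_smult_ldistr) auto
  also have "\<dots> = (\<Oplus>m\<in>J. hpow l m (c \<odot> w m))"
    using w kersD(1) clin.smult[OF hpow_clin] by (intro finsum_cong') auto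
  finally show ?thesis
    unfolding expansion_def using J w subspace_smult[OF kers_submodule]
    by (auto intro!: exI[of _ J])
qed

lemma expansion_single:
  assumes "u \<in> kers" shows "expansion (hpow l m u) (\<lambda>m'. if m' = m then u else \<zero>)"
proof -
  show ?thesis
    unfolding expansion_def using assms kersD(1) subspace_zero[OF kers_submodule]
    by (auto intro!: exI[of _ "{m}"])
qed

lemma expansion_exists:
  assumes "v \<in> carrier M" shows "\<exists>w. expansion v w"
proof -
  have "v \<in> {v \<in> carrier M. \<exists>w. expansion v w}"
  proof (rule hpow_generate[OF l(1)])
    have "\<exists>w. expansion \<zero> w"
      using expansion_single[of \<zero>] subspace_zero[OF kers_submodule]
        clin.zero[OF hpow_clin] by auto
    then show "submodule {v \<in> carrier M. \<exists>w. expansion v w} complex_field M"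
      using expansion_add expansion_smult by (intro subspaceI) (auto; blast)+
    show "hpow l m w \<in> {v \<in> carrier M. \<exists>w. expansion v w}" if "w \<in> kers" for m w
      using that expansion_single kersD(1) by auto
  qed (use assms l in simp_all)
  then show ?thesis by blast
qed

text \<open>The difference of two expansions of \<open>v\<close> is an expansion of zero, to which
  \<open>hpow_independent\<close> applies; exponents agreeing on the list are equal because it
  contains every index.\<close>

lemma expansion_unique:
  assumes "expansion v w" "expansion v w'" "v \<in> carrier M"
  shows "w = w'"
proof
  fix m
  have w: "w m \<in> kers" "w' m \<in> kers" for m using assms by (auto simp: expansion_def)
  have "expansion (v \<oplus> (- 1) \<odot> v) (\<lambda>m. w m \<oplus> (- 1) \<odot> w' m)"
    by (intro expansion_add expansion_smult assms)
  moreover have "v \<oplus> (- 1) \<odot> v = \<zero>"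
    using diff_eq_smult[OF assms(3,3)] diff_eq_zero_iff[OF assms(3,3)] by simp
  ultimately obtain J where J: "finite J" "\<And>m. m \<notin> J \<Longrightarrow> w m \<oplus> (- 1) \<odot> w' m = \<zero>"
      "(\<Oplus>m\<in>J. hpow l m (w m \<oplus> (- 1) \<odot> w' m)) = \<zero>"
    unfolding expansion_def by auto
  have "w m \<oplus> (- 1) \<odot> w' m = \<zero>"
  proof (cases "m \<in> J")
    case True
    show ?thesis
      by (rule hpow_independent[OF l(1) J(1) _ _ J(3) True])
        (use w l submoduleE(5)[OF kers_submodule] subspace_smult[OF kers_submodule] in auto)
  qed (use J in auto)
  then show "w m = w' m"
    using diff_eq_smult[of "w m" "w' m"] diff_eq_zero_iff[of "w m" "w' m"] w kersD(1) by simp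
qed

end

section \<open>Derivations of the polynomial ring\<close>

lemma cpoly_induct [case_names zero single add]:
  assumes "P 0" "\<And>m c. P (Poly_Mapping.single m c)" "\<And>p q. P p \<Longrightarrow> P q \<Longrightarrow> P (p + q)"
  shows "P (p :: 'n cpoly)"
proof -
  interpret fspace "free_space UNIV :: (complex, 'n cpoly) module" UNIV
    by (rule free_space_fspace)
  have "p \<in> carrier (free_space UNIV)" by (simp add: carrier_eq)
  then show ?thesis by (induction rule: induct) (use assms in auto)
qed

lemma const_simps [simp]: "const 0 = 0" "const 1 = 1"
  by (simp_all add: const_def)

lemma const_add: "const (c + d) = const c + const d"
  by (simp add: const_def single_add)

lemma const_mult: "const (c * d) = const c * const d"
  by (simp add: const_def mult_single)

lemma single_eq_const_mult: "Poly_Mapping.single m c = const c * Poly_Mapping.single m 1"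
  by (simp add: const_def mult_single)

lemma partial_single:
  "partial i (Poly_Mapping.single m c)
    = Poly_Mapping.single (m - Poly_Mapping.single i 1) (of_nat (Poly_Mapping.lookup m i) * c)"
  by (simp add: partial_def)

lemma partial_add: "partial i (p + q) = partial i p + partial i q"
  unfolding partial_def
  by (rule setsum_keys_plus_distrib) (simp_all add: single_add distrib_left)

lemma partial_zero [simp]: "partial i 0 = 0"
  by (simp add: partial_def)

lemma partial_smult: "partial i (const c * p) = const c * partial i p"
  by (induction p rule: cpoly_induct)
    (simp_all add: distrib_left partial_add const_def mult_single partial_single mult.left_commute)

lemma partial_mult_single:
  "partial i (Poly_Mapping.single m c * Poly_Mapping.single m' c')
    = partial i (Poly_Mapping.single m c) * Poly_Mapping.single m' c'
      + Poly_Mapping.single m c * partial i (Poly_Mapping.single m' c')"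
proof -
  \<comment> \<open>Subtraction of exponents is truncated, so the shift requires a positive exponent
    of t_i; for exponent 0 the coefficient \<open>of_nat (Poly_Mapping.lookup m i)\<close> is 0 and
    both sides vanish.\<close>
  have shift: "k - Poly_Mapping.single i 1 + k' = k + k' - Poly_Mapping.single i 1"
    if "Poly_Mapping.lookup k i \<noteq> 0" for k k' :: "'a \<Rightarrow>\<^sub>0 nat"
    using that by (intro poly_mapping_eqI) (auto simp: lookup_add lookup_minus lookup_single when_def)
  have "Poly_Mapping.single (m - Poly_Mapping.single i 1 + m') (of_nat (Poly_Mapping.lookup m i) * c * c')
      = Poly_Mapping.single (m + m' - Poly_Mapping.single i 1) (of_nat (Poly_Mapping.lookup m i) * c * c')"
    using shift[of m m'] by (cases "Poly_Mapping.lookup m i = 0") auto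
  moreover have "Poly_Mapping.single (m + (m' - Poly_Mapping.single i 1)) (c * (of_nat (Poly_Mapping.lookup m' i) * c'))
      = Poly_Mapping.single (m + m' - Poly_Mapping.single i 1) (c * (of_nat (Poly_Mapping.lookup m' i) * c'))"
    using shift[of m' m] by (cases "Poly_Mapping.lookup m' i = 0") (auto simp: add.commute)
  ultimately show ?thesis
    by (simp add: partial_single mult_single single_add[symmetric] lookup_add algebra_simps)
qed

lemma partial_mult: "partial i (p * q) = partial i p * q + p * partial i q"
proof (induction p rule: cpoly_induct)
  case (single m c)
  show ?case
  proof (induction q rule: cpoly_induct)
    case (single m' c')
    then show ?case by (rule partial_mult_single)
  qed (simp_all add: distrib_left partial_add add_ac)
qed (simp_all add: distrib_right partial_add add_ac)

lemma partial_derivation: "is_derivation (partial i)"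
  unfolding is_derivation_def by (intro conjI allI partial_add partial_smult partial_mult)

lemma Wn_simps [simp]:
  "carrier Wn = {D. is_derivation D}"
  "\<zero>\<^bsub>Wn\<^esub> = (\<lambda>p. 0)"
  "D \<oplus>\<^bsub>Wn\<^esub> E = (\<lambda>p. D p + E p)"
  "c \<odot>\<^bsub>Wn\<^esub> D = (\<lambda>p. const c * D p)"
  "bracket Wn D E = (\<lambda>p. D (E p) - E (D p))"
  by (simp_all add: Wn_def)

lemma derivationD:
  assumes "is_derivation D"
  shows "D (p + q) = D p + D q" "D (const c * p) = const c * D p" "D (p * q) = D p * q + p * D q"
  using assms unfolding is_derivation_def by blast+

lemma derivation_zero: "is_derivation D \<Longrightarrow> D 0 = 0"
  using derivationD(2)[of D 0 0] by simp

lemma derivation_diff: "is_derivation D \<Longrightarrow> D (p - q) = D p - D q"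
  using derivationD(1)[of D "p - q" q] by simp

lemma derivation_const: assumes "is_derivation D" shows "D (const c) = 0"
proof -
  have "D 1 = D 1 + D 1" using derivationD(3)[OF assms, of 1 1] by simp
  then show ?thesis using derivationD(2)[OF assms, of c 1] by simp
qed

lemma derivation_closed:
  assumes "is_derivation D" "is_derivation E"
  shows "is_derivation (\<lambda>p. D p + E p)" "is_derivation (\<lambda>p. q * D p)"
    "is_derivation (\<lambda>p. D (E p) - E (D p))"
  unfolding is_derivation_def
  by (intro conjI allI;
      simp add: derivationD(1,3)[OF assms(1)] derivationD(1,3)[OF assms(2)] derivation_const[OF assms(1)]
        derivation_const[OF assms(2)] derivation_diff[OF assms(1)] derivation_diff[OF assms(2)]
        derivation_zero[OF assms(1)] derivation_zero[OF assms(2)] algebra_simps)+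

lemma derivation_null: "is_derivation (\<lambda>p. 0)"
  by (simp add: is_derivation_def)

lemma Wn_cspace: "cspace Wn"
  by (rule cspace_fieldsI)
    (auto simp: derivation_null derivation_closed const_add const_mult distrib_left distrib_right
       mult.assoc add_ac fun_eq_iff)

lemma Wn_lie_algebra: "lie_algebra Wn"
proof (intro lie_algebra.intro lie_algebra_axioms.intro)
  show "module complex_field Wn" using Wn_cspace by (simp add: cspace_def)
qed (auto simp: derivation_closed derivationD derivation_diff derivation_const algebra_simps fun_eq_iff)

text \<open>The variables generate the polynomial ring: the Leibniz rule carries agreement from them
  to powers and monomials, and linearity to all polynomials. Equalities in W_n thus reduce to a
  check on variables.\<close>

lemma derivation_eqI:
  assumes D: "is_derivation D" and E: "is_derivation E" and eq: "\<And>i. D (var i) = E (var i)"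
  shows "D = E"
proof
  have mult: "D (p * q) = E (p * q)" if "D p = E p" "D q = E q" for p q
    using that by (simp add: derivationD(3)[OF D] derivationD(3)[OF E])
  have monom: "D (Poly_Mapping.single (Poly_Mapping.single i k) 1) = E (Poly_Mapping.single (Poly_Mapping.single i k) 1)"
    for i k
  proof (induction k)
    case 0
    then show ?case using derivation_const[OF D, of 1] derivation_const[OF E, of 1] by simp
  next
    case (Suc k)
    have "Poly_Mapping.single (Poly_Mapping.single i (Suc k)) 1
        = var i * Poly_Mapping.single (Poly_Mapping.single i k) 1"
      by (simp add: var_def mult_single single_add[symmetric])
    then show ?case using mult[OF eq Suc] by simp
  qed
  have "D (Poly_Mapping.single m 1) = E (Poly_Mapping.single m 1)" for m
  proof (induction m rule: update_induct)
    case const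
    then show ?case using derivation_const[OF D, of 1] derivation_const[OF E, of 1] by simp
  next
    case (update m i k)
    have "Poly_Mapping.update i k m = Poly_Mapping.single i k + m"
      using update(1) by (intro poly_mapping_eqI)
        (auto simp: lookup_update lookup_add lookup_single in_keys_iff when_def)
    then have "Poly_Mapping.single (Poly_Mapping.update i k m) 1
        = Poly_Mapping.single (Poly_Mapping.single i k) 1 * (Poly_Mapping.single m 1 :: 'a cpoly)"
      by (simp add: mult_single)
    then show ?case using mult[OF monom update(3)] by simp
  qed
  then have "D (Poly_Mapping.single m c) = E (Poly_Mapping.single m c)" for m c
    by (subst (1 2) single_eq_const_mult) (simp add: derivationD(2)[OF D] derivationD(2)[OF E])
  then show "D p = E p" for p
    by (induction p rule: cpoly_induct)
      (simp_all add: derivation_zero D E derivationD(1)[OF D] derivationD(1)[OF E])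
qed

lemma partial_var: "partial i (var j) = const (if i = j then 1 else 0)"
  by (simp add: var_def partial_single const_def lookup_single when_def)

text \<open>The commutator of two derivations is a derivation, and this one vanishes on variables
  because their partial derivatives are constants.\<close>

lemma partial_commute: "partial i (partial j p) = partial j (partial i p)"
proof -
  have "(\<lambda>p. partial i (partial j p) - partial j (partial i p)) = (\<lambda>p. 0)"
    by (rule derivation_eqI)
      (simp_all add: derivation_closed partial_derivation derivation_null partial_var
         derivation_const)
  then show ?thesis by (simp add: fun_eq_iff)
qed

lemma euler_derivation: "is_derivation (euler i)"
  using derivation_closed(2)[OF partial_derivation partial_derivation, of "var i" i]
  by (simp add: euler_def[abs_def])

text \<open>The source of the commutation rules between D_i and h_j in the shift operators.\<close>

lemma bracket_partial_euler:
  "bracket Wn (partial i) (euler j) = (if i = j then partial i else \<zero>\<^bsub>Wn\<^esub>)"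
  by (auto simp: euler_def fun_eq_iff partial_mult partial_var partial_commute[of i j])

lemma partial_locally_nilpotent: "\<exists>r. (partial i ^^ r) p = 0"
proof (induction p rule: cpoly_induct)
  case zero
  show ?case by (rule exI[of _ 0]) simp
next
  case (single m c)
  \<comment> \<open>A monomial of degree k in t_i dies after k + 1 derivatives, the last of which
    produces the coefficient 0.\<close>
  have "\<forall>m c. Poly_Mapping.lookup m i = k \<longrightarrow> (partial i ^^ Suc k) (Poly_Mapping.single m c) = 0" for k
  proof (induction k)
    case 0
    then show ?case by (simp add: partial_single)
  next
    case (Suc k)
    then show ?case
      by (auto simp: funpow_Suc_right partial_single lookup_minus simp del: funpow.simps)
  qed
  then show ?case by blast
next
  case (add p q)
  then obtain r s where rs: "(partial i ^^ r) p = 0" "(partial i ^^ s) q = 0" by blast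
  have zero: "(partial i ^^ k) 0 = 0" for k by (induction k) simp_all
  have "(partial i ^^ k) (p + q) = (partial i ^^ k) p + (partial i ^^ k) q" for k
    by (induction k) (simp_all add: partial_add)
  moreover have "(partial i ^^ (s + r)) p = 0" "(partial i ^^ (r + s)) q = 0"
    using rs zero by (simp_all add: funpow_add)
  then have "(partial i ^^ (r + s)) p = 0" "(partial i ^^ (r + s)) q = 0"
    by (simp_all add: add.commute)
  ultimately show ?case by (metis add.right_neutral)
qed

text \<open>A derivation is determined by its values on the finitely many variables, and r brackets
  with \<open>partial i\<close> change the value at t_j into its r-th derivative. Local nilpotency
  on polynomials therefore transfers to W_n.\<close>

lemma ad_partial_locally_nilpotent:
  fixes i :: "'n::finite"
  assumes "is_derivation D"
  shows "\<exists>r. (bracket Wn (partial i) ^^ r) D = \<zero>\<^bsub>Wn\<^esub>"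
proof -
  define ad where "ad = bracket Wn (partial i)"
  have ad: "ad E = (\<lambda>p. partial i (E p) - E (partial i p))" for E
    by (simp add: ad_def)
  let ?D = "\<lambda>r. (ad ^^ r) D"
  have der: "is_derivation (?D r)" for r
    by (induction r) (simp_all add: ad assms derivation_closed partial_derivation)
  \<comment> \<open>In a bracket with E the subtracted term is E applied to the derivative of t_j, a
    constant, so it vanishes.\<close>
  have val: "?D r (var j) = (partial i ^^ r) (D (var j))" for r j
  proof (induction r)
    case (Suc r)
    then show ?case using derivation_const[OF der[of r]] by (simp add: ad[of "?D r"] partial_var)
  qed simp
  have "\<forall>j. \<exists>r. (partial i ^^ r) (D (var j)) = 0"
    by (intro allI partial_locally_nilpotent)
  then obtain r where r: "\<forall>j. (partial i ^^ r j) (D (var j)) = 0"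
    using choice[of "\<lambda>j r. (partial i ^^ r) (D (var j)) = 0"] by blast
  \<comment> \<open>The sum serves as a common upper bound of the finitely many exponents.\<close>
  let ?r = "\<Sum>j\<in>UNIV. r j"
  have zero: "(partial i ^^ k) 0 = 0" for k by (induction k) simp_all
  have "(partial i ^^ ?r) (D (var j)) = 0" for j
  proof -
    have "?r = (?r - r j) + r j" using member_le_sum[of j UNIV r] by simp
    then have "(partial i ^^ ?r) (D (var j)) = (partial i ^^ (?r - r j)) ((partial i ^^ r j) (D (var j)))"
      by (metis comp_apply funpow_add)
    then show ?thesis by (simp add: r zero)
  qed
  then have "?D ?r = \<zero>\<^bsub>Wn\<^esub>"
    using val by (intro derivation_eqI der) (simp_all add: derivation_null)
  then show ?thesis unfolding ad_def by blast
qed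

section \<open>The abelian subalgebra\<close>

lemma Delta_simps [simp]:
  "carrier Delta = lin_span Wn (range partial)" "ring.add Delta = ring.add Wn" "\<zero>\<^bsub>Delta\<^esub> = \<zero>\<^bsub>Wn\<^esub>"
  "module.smult Delta = module.smult Wn" "bracket Delta = bracket Wn"
  by (simp_all add: Delta_def)

lemma partial_in: "range partial \<subseteq> carrier Wn"
  by (auto simp: partial_derivation)

lemma Delta_in_Wn: "x \<in> carrier Delta \<Longrightarrow> x \<in> carrier Wn"
  using cspace.lin_span_in[OF Wn_cspace partial_in] by simp

lemma partial_in_Delta: "partial i \<in> carrier Delta"
  using cspace.lin_span_superset[OF Wn_cspace, of "range partial"] by auto

lemma Delta_induct [consumes 1, case_names partial zero add smult]:
  assumes "x \<in> carrier Delta" "\<And>i. P (partial i)" "P \<zero>\<^bsub>Wn\<^esub>"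
    "\<And>x y. x \<in> carrier Wn \<Longrightarrow> y \<in> carrier Wn \<Longrightarrow> P x \<Longrightarrow> P y \<Longrightarrow> P (x \<oplus>\<^bsub>Wn\<^esub> y)"
    "\<And>c x. x \<in> carrier Wn \<Longrightarrow> P x \<Longrightarrow> P (c \<odot>\<^bsub>Wn\<^esub> x)"
  shows "P x"
proof (rule cspace.lin_span_induct[OF Wn_cspace, where P = P])
  show "x \<in> lin_span Wn (range partial)" using assms(1) by simp
qed (use assms partial_in in auto)

lemma Delta_bracket_zero:
  assumes "x \<in> carrier Delta" "y \<in> carrier Delta"
  shows "bracket Wn x y = \<zero>\<^bsub>Wn\<^esub>"
proof -
  interpret lie_algebra Wn by (rule Wn_lie_algebra)
  have eq: "bracket Wn x (partial j) = \<zero>\<^bsub>Wn\<^esub>" for j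
    using assms(1)
    by (induction rule: Delta_induct)
      (auto simp: partial_commute fun_eq_iff derivation_zero partial_derivation partial_add partial_smult)
  have x: "is_derivation x" using Delta_in_Wn[OF assms(1)] by simp
  show ?thesis
    using assms(2)
  proof (induction rule: Delta_induct)
    case (partial j)
    show ?case by (rule eq)
  qed (use x in \<open>auto simp: fun_eq_iff derivationD derivation_zero\<close>)
qed

lemma Delta_cspace: "cspace Delta"
proof -
  have "submodule (lin_span Wn (range partial)) complex_field Wn"
    by (rule cspace.lin_span_submodule[OF Wn_cspace partial_in])
  then show ?thesis
    unfolding Delta_def using submodule.submodule_is_module[of _ complex_field Wn] Wn_cspace
    by (simp add: cspace_def)
qed

lemma Delta_lie_algebra: "lie_algebra Delta"
proof -
  interpret W: lie_algebra Wn by (rule Wn_lie_algebra)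
  interpret Dl: cspace Delta by (rule Delta_cspace)
  show ?thesis
  proof (intro lie_algebra.intro lie_algebra_axioms.intro Dl.module_axioms)
    show "bracket Delta x y \<in> carrier Delta" if "x \<in> carrier Delta" "y \<in> carrier Delta" for x y
      using Delta_bracket_zero[OF that] Dl.zero_closed by (simp del: Wn_simps)
  qed (simp_all add: Delta_in_Wn[simplified Delta_simps] W.bracket_add_left W.bracket_add_right
     W.bracket_smult_left W.bracket_smult_right W.bracket_self W.jacobi del: Wn_simps)
qed

lemma Delta_subalgebra: "lie_subalgebra Wn Delta"
  by (intro lie_subalgebra.intro lie_subalgebra_axioms.intro enveloping.intro Wn_lie_algebra Delta_lie_algebra)
    (use Delta_in_Wn in auto)

lemma lookup_const_mult: "Poly_Mapping.lookup (const c * p) 0 = c * Poly_Mapping.lookup p 0"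
proof -
  interpret fspace "free_space UNIV :: (complex, 'a cpoly) module" UNIV
    by (rule free_space_fspace)
  have "const c * p = c \<odot>\<^bsub>free_space UNIV\<^esub> p"
  proof (induction p rule: cpoly_induct)
    case zero
    then show ?case using smult_zero_right[of c] by (simp add: zero_eq)
  next
    case (single m d)
    then show ?case by (simp add: smult_single const_def mult_single)
  next
    case (add p q)
    then show ?case using smult_add_right[of p q c] by (simp add: add_eq carrier_eq distrib_left)
  qed
  then show ?thesis by simp
qed

lemma phi_partial: "phi a (partial i) = a i"
proof -
  have "a k * Poly_Mapping.lookup (partial i (var k)) 0 = (if i = k then a k else 0)" for k
    by (simp add: partial_var const_def)
  then show ?thesis by (simp add: phi_def)
qed

lemma phi_add: "phi a (x \<oplus>\<^bsub>Wn\<^esub> y) = phi a x + phi a y"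
  by (simp add: phi_def lookup_add distrib_left sum.distrib)

lemma phi_smult: "phi a (c \<odot>\<^bsub>Wn\<^esub> x) = c * phi a x"
  by (simp add: phi_def lookup_const_mult sum_distrib_left mult.left_commute)

lemma phi_zero: "phi a \<zero>\<^bsub>Wn\<^esub> = 0"
  by (simp add: phi_def)

lemma one_dim_simps [simp]: "carrier (one_dim a) = UNIV" "\<zero>\<^bsub>one_dim a\<^esub> = 0"
    "x \<oplus>\<^bsub>one_dim a\<^esub> y = x + y" "c \<odot>\<^bsub>one_dim a\<^esub> x = c * x" "act (one_dim a) d z = phi a d * z"
  by (simp_all add: one_dim_def)

lemma one_dim_cspace: "cspace (one_dim a)"
  by (rule cspace_fieldsI) (simp_all add: algebra_simps)

lemma one_dim_lie_module: "lie_module Delta (one_dim a)"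
proof -
  interpret cspace "one_dim a" by (rule one_dim_cspace)
  interpret Dl: cspace Delta by (rule Delta_cspace)
  show ?thesis
  proof (rule lie_moduleI[OF Delta_lie_algebra one_dim_cspace])
    show "clin (one_dim a) (one_dim a) (act (one_dim a) x)" for x
      by unfold_locales (simp_all add: algebra_simps)
    show "clin Delta (one_dim a) (\<lambda>x. act (one_dim a) x v)" for v
      by unfold_locales (simp_all add: algebra_simps phi_add phi_smult del: Wn_simps)
    show "act (one_dim a) (bracket Delta x y) v
        = act (one_dim a) x (act (one_dim a) y v) \<ominus>\<^bsub>one_dim a\<^esub> act (one_dim a) y (act (one_dim a) x v)"
      if "x \<in> carrier Delta" "y \<in> carrier Delta" for x y v
      using Delta_bracket_zero[OF that] 
      by (simp add: diff_eq_smult phi_zero del: Wn_simps)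
  qed
qed

declare Wn_simps [simp del] Delta_simps [simp del]

section \<open>Whittaker modules\<close>

text \<open>For a sum, the larger of the two exponents works. This reduces local nilpotency to the
  generator of Q and to pure tensors.\<close>

lemma clin_nilpotent_submodule:
  assumes "clin M M f"
  shows "submodule {v \<in> carrier M. \<exists>k. (f ^^ k) v = \<zero>\<^bsub>M\<^esub>} complex_field M"
proof (rule cspace.subspaceI)
  show "cspace M" using assms by (rule clin.axioms(1))
next
  interpret clin M M f by fact
  have pow: "clin M M (f ^^ k)" for k by (rule clin_funpow[OF assms])
  have le: "(f ^^ k') v = \<zero>\<^bsub>M\<^esub>" if "(f ^^ k) v = \<zero>\<^bsub>M\<^esub>" "k \<le> k'" for k k' v
  proof -
    have "(f ^^ (k' - k)) ((f ^^ k) v) = (f ^^ k') v"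
      using that(2) by (metis comp_apply funpow_add le_add_diff_inverse2)
    then show ?thesis using that clin.zero[OF pow] by simp
  qed
  fix v w assume "v \<in> {v \<in> carrier M. \<exists>k. (f ^^ k) v = \<zero>\<^bsub>M\<^esub>}"
    "w \<in> {v \<in> carrier M. \<exists>k. (f ^^ k) v = \<zero>\<^bsub>M\<^esub>}"
  then obtain k k' where k: "v \<in> carrier M" "w \<in> carrier M" "(f ^^ k) v = \<zero>\<^bsub>M\<^esub>" "(f ^^ k') w = \<zero>\<^bsub>M\<^esub>"
    by auto
  have "(f ^^ max k k') (v \<oplus>\<^bsub>M\<^esub> w) = \<zero>\<^bsub>M\<^esub>"
    using k le[OF k(3), of "max k k'"] le[OF k(4), of "max k k'"] clin.add[OF pow] by simp
  then show "v \<oplus>\<^bsub>M\<^esub> w \<in> {v \<in> carrier M. \<exists>k. (f ^^ k) v = \<zero>\<^bsub>M\<^esub>}" using k by blast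
next
  show "\<zero>\<^bsub>M\<^esub> \<in> {v \<in> carrier M. \<exists>k. (f ^^ k) v = \<zero>\<^bsub>M\<^esub>}"
    using abelian_monoid.zero_closed[of M] clin.axioms(1)[OF assms]
    by (auto intro!: exI[of _ 0] simp: cspace_def module_def abelian_group_def)
next
  show "c \<odot>\<^bsub>M\<^esub> v \<in> {v \<in> carrier M. \<exists>k. (f ^^ k) v = \<zero>\<^bsub>M\<^esub>}"
    if "v \<in> {v \<in> carrier M. \<exists>k. (f ^^ k) v = \<zero>\<^bsub>M\<^esub>}" for c v
    using that clin.smult[OF clin_funpow[OF assms]] cspace.smult_in[OF clin.axioms(1)[OF assms]]
      cspace.smult_zero_right[OF clin.axioms(1)[OF assms]] by auto metis
qed auto

definition shifted ::
  "('n::finite \<Rightarrow> complex) \<Rightarrow> ('n der, 'm) act_module \<Rightarrow> 'n der \<Rightarrow> 'm \<Rightarrow> 'm" where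
  "shifted a M x v = act M x v \<ominus>\<^bsub>M\<^esub> phi a x \<odot>\<^bsub>M\<^esub> v"

lemma partial_in_Wn [simp]: "partial i \<in> carrier Wn" and euler_in_Wn [simp]: "euler i \<in> carrier Wn"
  by (simp_all add: Wn_simps partial_derivation euler_derivation)

lemma bracket_partial_partial: "bracket Wn (partial i) (partial j) = \<zero>\<^bsub>Wn\<^esub>" for i :: "'n::finite"
  by (rule Delta_bracket_zero) (rule partial_in_Delta)+

locale Wn_module = lie_module Wn M for a :: "'n::finite \<Rightarrow> complex" and M :: "('n der, 'm) act_module" (structure)
begin

abbreviation "S i \<equiv> shifted a M (partial i)"

lemma shifted_clin: "x \<in> carrier Wn \<Longrightarrow> clin M M (shifted a M x)"
  unfolding shifted_def[abs_def]
  by (intro clin_diff act_clin clin_smult clin_id M.cspace_axioms)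

lemma shifted_in [simp]: "x \<in> carrier Wn \<Longrightarrow> v \<in> carrier M \<Longrightarrow> shifted a M x v \<in> carrier M"
  using clin.closed[OF shifted_clin] .

lemma act_zero: "v \<in> carrier M \<Longrightarrow> act M \<zero>\<^bsub>Wn\<^esub> v = \<zero>"
  using act_smult_left[of "\<zero>\<^bsub>Wn\<^esub>" v 0] act_closed[of "\<zero>\<^bsub>Wn\<^esub>" v] by simp

lemma act_swap:
  assumes "x \<in> carrier Wn" "y \<in> carrier Wn" "v \<in> carrier M"
  shows "act M x (act M y v) = act M y (act M x v) \<oplus> act M (bracket Wn x y) v"
proof -
  have "act M y (act M x v) \<oplus> (act M x (act M y v) \<ominus> act M y (act M x v)) = act M x (act M y v)"
    using assms by (intro M.add_diff_cancel) (simp_all add: act_closed)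
  then show ?thesis using act_bracket[OF assms] by simp
qed

text \<open>Scalars commute with \<open>x\<close>, so the commutator of D_i with \<open>x\<close> is
  that of \<open>partial i\<close> with \<open>x\<close>.\<close>

lemma S_act:
  assumes "x \<in> carrier Wn" "v \<in> carrier M"
  shows "S i (act M x v) = act M x (S i v) \<oplus> act M (bracket Wn (partial i) x) v"
proof -
  have c: "bracket Wn (partial i) x \<in> carrier Wn" using assms bracket_closed by simp
  have "act M x (S i v) = act M x (act M (partial i) v) \<ominus> a i \<odot> act M x v"
    unfolding shifted_def phi_partial
    using assms clin.diff[OF act_clin] by (simp add: act_closed act_smult_right)
  then show ?thesis
    using assms act_swap[of "partial i" x v] c unfolding shifted_def phi_partial
    by (simp add: M.minus_eq M.a_ac act_closed)
qed

lemma S_S: "v \<in> carrier M \<Longrightarrow> S i (S j v) = S j (S i v)"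
proof -
  assume v: "v \<in> carrier M"
  interpret Si: clin M M "S i" by (rule shifted_clin) simp
  have 1: "S i (act M (partial j) v) = act M (partial j) (S i v)"
    using v S_act[of "partial j" v i] by (simp add: bracket_partial_partial act_zero act_closed)
  have "S i (S j v) = S i (act M (partial j) v) \<ominus> a j \<odot> S i v"
    using v by (simp add: shifted_def[of a M "partial j"] phi_partial Si.diff Si.smult act_closed)
  then show ?thesis by (simp add: 1 shifted_def[of a M "partial j"] phi_partial)
qed

text \<open>By the Leibniz rule D_i^(r+s) (x v) is a combination of terms ad^p(x) D_i^q v with p + q
  = r + s, so p \<ge> r or q \<ge> s in each. Induction on r + s avoids binomial coefficients: one
  application of \<open>S_act\<close> lowers r or s by one.\<close>

lemma S_pow_act:
  assumes "(bracket Wn (partial i) ^^ r) x = \<zero>\<^bsub>Wn\<^esub>" "(S i ^^ s) v = \<zero>"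
    "x \<in> carrier Wn" "v \<in> carrier M"
  shows "(S i ^^ (r + s)) (act M x v) = \<zero>"
proof -
  have pow: "clin M M (S i ^^ k)" for k by (rule clin_funpow[OF shifted_clin]) simp
  have "\<forall>r s x v. r + s = N \<longrightarrow> (bracket Wn (partial i) ^^ r) x = \<zero>\<^bsub>Wn\<^esub> \<longrightarrow> (S i ^^ s) v = \<zero>
      \<longrightarrow> x \<in> carrier Wn \<longrightarrow> v \<in> carrier M \<longrightarrow> (S i ^^ N) (act M x v) = \<zero>" for N
  proof (induction N)
    case 0
    then show ?case by (simp add: act_zero)
  next
    case (Suc N)
    show ?case
    proof (intro allI impI)
      fix r s x v
      assume rs: "r + s = Suc N" and x0: "(bracket Wn (partial i) ^^ r) x = \<zero>\<^bsub>Wn\<^esub>"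
        and v0: "(S i ^^ s) v = \<zero>" and x: "x \<in> carrier Wn" and v: "v \<in> carrier M"
      show "(S i ^^ Suc N) (act M x v) = \<zero>"
      proof (cases "r = 0 \<or> s = 0")
        case True
        then have "act M x v = \<zero>"
          using x0 v0 act_zero[OF v] clin.zero[OF act_clin[OF x]] by auto
        then show ?thesis using clin.zero[OF pow] by (simp del: funpow.simps)
      next
        case False
        then obtain r' s' where r': "r = Suc r'" "s = Suc s'" by (meson not0_implies_Suc)
        have c: "bracket Wn (partial i) x \<in> carrier Wn" using x bracket_closed by simp
        have "(S i ^^ N) (act M x (S i v)) = \<zero>"
          using Suc.IH[rule_format, of r s' x "S i v"] rs r' x0 v0 x v
          by (simp add: funpow_Suc_right del: funpow.simps)
        moreover have "(S i ^^ N) (act M (bracket Wn (partial i) x) v) = \<zero>"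
          using Suc.IH[rule_format, of r' s "bracket Wn (partial i) x" v] rs r' x0 v0 c v
          by (simp add: funpow_Suc_right del: funpow.simps)
        ultimately show ?thesis
          using S_act[OF x v, of i] clin.add[OF pow, of "act M x (S i v)" "act M (bracket Wn (partial i) x) v"] x v c
          by (simp add: funpow_Suc_right act_closed del: funpow.simps)
      qed
    qed
  qed
  then show ?thesis using assms by blast
qed

lemma Delta_whittaker:
  assumes "w \<in> whittaker_vectors a M" "x \<in> carrier Delta"
  shows "act M x w = phi a x \<odot> w"
proof -
  have w: "w \<in> carrier M" "act M (partial i) w = a i \<odot> w" for i
    using assms(1) by (auto simp: whittaker_vectors_def)
  show ?thesis
    using assms(2)
    by (induction rule: Delta_induct)
      (simp_all add: w phi_partial phi_zero act_zero phi_add phi_smult act_add_left act_smult_left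
         M.smult_add_left M.smult_smult)
qed

lemma shifted_left_clin:
  assumes "v \<in> carrier M" shows "clin Wn M (\<lambda>x. shifted a M x v)"
proof -
  have "shifted a M (x \<oplus>\<^bsub>Wn\<^esub> y) v = shifted a M x v \<oplus> shifted a M y v"
    if "x \<in> carrier Wn" "y \<in> carrier Wn" for x y
    using that assms
    by (simp add: shifted_def act_add_left phi_add M.smult_add_left M.diff_eq_smult M.smult_add_right
        M.a_ac act_closed)
  moreover have "shifted a M (c \<odot>\<^bsub>Wn\<^esub> x) v = c \<odot> shifted a M x v" if "x \<in> carrier Wn" for c x
    using that assms
    by (simp add: shifted_def act_smult_left phi_smult M.smult_smult M.diff_eq_smult M.smult_add_right
        act_closed mult.commute)
  ultimately show ?thesis
    using assms by unfold_locales simp_all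
qed

text \<open>
  The definition of Whittaker modules asks for one exponent for all elements of \<^const>\<open>Delta\<close>. Since
  \<open>y - \<phi> y\<close> is a linear combination of the commuting \<open>D\<^sub>i\<close>, each application of it lowers one of
  the exponents \<open>k i\<close>.
\<close>

lemma shifted_uniformly_nilpotent:
  assumes "v \<in> carrier M" "\<And>i. (S i ^^ k i) v = \<zero>" "y \<in> carrier Delta"
  shows "(shifted a M y ^^ (\<Sum>i\<in>UNIV. k i)) v = \<zero>"
  using assms(1,2)
proof (induction "\<Sum>i\<in>UNIV. k i" arbitrary: k v)
  case 0
  then have "k i = 0" for i by simp
  \<comment> \<open>All exponents are 0, so v itself vanishes; any index, here
    \<open>undefined\<close>, shows it.\<close>
  then have "v = \<zero>" using 0(3)[of undefined] by simp
  then show ?case using 0(1)[symmetric] by simp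
next
  case (Suc N)
  have y: "y \<in> carrier Wn" using assms(3) by (rule Delta_in_Wn)
  interpret p: clin M M "shifted a M y ^^ N" by (rule clin_funpow[OF shifted_clin[OF y]])
  interpret l: clin Wn M "\<lambda>x. shifted a M x v" by (rule shifted_left_clin[OF Suc.prems(1)])
  have partial: "(shifted a M y ^^ N) (S i v) = \<zero>" for i
  proof (cases "k i")
    case 0
    then have "v = \<zero>" using Suc.prems(2)[of i] by simp
    then show ?thesis using p.zero clin.zero[OF shifted_clin[of "partial i"]] by simp
  next
    case (Suc ki)
    \<comment> \<open>Lowering the exponent at i accounts for the factor D_i already applied; the
      other exponents stay valid because the D_j commute.\<close>
    let ?k = "k(i := ki)"
    have "sum k UNIV = Suc (sum ?k UNIV)"
      using Suc by (simp add: sum.remove[of UNIV i])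
    then have N: "N = sum ?k UNIV" using \<open>Suc N = _\<close> by simp
    have "(S j ^^ ?k j) (S i v) = \<zero>" for j
    proof (cases "j = i")
      case True
      then show ?thesis using Suc.prems(2)[of i] Suc by (simp add: funpow_Suc_right del: funpow.simps)
    next
      case False
      have "(S j ^^ m) (S i v) = S i ((S j ^^ m) v)" for m
      proof (induction m)
        case (Suc m)
        then show ?case using S_S[of "(S j ^^ m) v" j i] clin.closed[OF clin_funpow[OF shifted_clin]] \<open>v \<in> carrier M\<close>
          by simp
      qed simp
      then show ?thesis using False \<open>\<And>i. (S i ^^ k i) v = _\<close> clin.zero[OF shifted_clin[of "partial i"]] by simp
    qed
    then show ?thesis unfolding N using \<open>v \<in> carrier M\<close> by (intro Suc.hyps(1)[OF N]) simp_all
  qed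
  \<comment> \<open>The operator \<open>shifted a M x\<close> depends linearly on x, so the claim
    for each \<open>partial i\<close> extends to all of \<open>Delta\<close>, in particular to x =
    y.\<close>
  have "(shifted a M y ^^ N) (shifted a M x v) = \<zero>" if "x \<in> carrier Delta" for x
    using that
    by (induction rule: Delta_induct) (simp_all add: partial l.add l.smult l.zero p.add p.smult p.zero)
  then show ?case
    using assms(3) by (simp add: Suc.hyps(2)[symmetric] funpow_Suc_right del: funpow.simps)
qed

end

locale whittaker = Wn_module a M
  for a :: "'n::{finite,linorder} \<Rightarrow> complex" and M :: "('n der, 'm) act_module" (structure) +
  assumes nonzero: "a i \<noteq> 0"
    and locally_nilpotent: "v \<in> carrier M \<Longrightarrow> \<exists>k. (S i ^^ k) v = \<zero>"
begin

abbreviation "idx \<equiv> sorted_list_of_set (UNIV :: 'n set)"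

text \<open>The index list is the increasing one of \<open>euler_monomial\<close>, so
  \<open>hpow\<close> uses the same order of factors.\<close>

sublocale full_shift_family M S "\<lambda>i. act M (euler i)" a idx
proof (intro full_shift_family.intro shift_family.intro full_shift_family_axioms.intro
    shift_family_axioms.intro M.cspace_axioms)
  fix i j v assume v: "v \<in> carrier M"
  show "S i (act M (euler i) v) = act M (euler i) (S i v) \<oplus> (S i v \<oplus> a i \<odot> v)"
  proof -
    have "S i v \<oplus> a i \<odot> v = act M (partial i) v"
      using v by (simp add: shifted_def phi_partial M.minus_eq M.a_assoc M.l_neg act_closed)
    then show ?thesis using S_act[of "euler i" v i] v bracket_partial_euler[of i i] by simp
  qed
  show "S i (act M (euler j) v) = act M (euler j) (S i v)" if "i \<noteq> j"
    using S_act[of "euler j" v i] v bracket_partial_euler[of i j] that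
    by (simp add: act_zero act_closed)
qed (simp_all add: S_S shifted_clin act_clin nonzero locally_nilpotent)

lemma kers_eq: "kers = whittaker_vectors a M"
  unfolding kers_def whittaker_vectors_def
  by (auto simp: shifted_def phi_partial M.diff_eq_zero_iff act_closed)

end

lemma whittakerI:
  assumes "lie_module Wn M" "\<And>i. a i \<noteq> 0" "\<And>v i. v \<in> carrier M \<Longrightarrow> \<exists>k. (shifted a M (partial i) ^^ k) v = \<zero>\<^bsub>M\<^esub>"
  shows "whittaker a M"
  using assms by (simp add: whittaker_def whittaker_axioms_def Wn_module_def)

text \<open>One direction specialises x to \<open>partial i\<close>. The other takes the sum of the
  finitely many exponents for the \<open>partial i\<close> as a uniform exponent on
  \<open>Delta\<close>.\<close>

lemma whittaker_module_iff:
  assumes "\<And>i. a i \<noteq> 0"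
  shows "whittaker_module a M \<longleftrightarrow> whittaker a M"
proof
  assume M: "whittaker_module a M"
  then have eq: "(\<lambda>u. act M x u \<ominus>\<^bsub>M\<^esub> phi a x \<odot>\<^bsub>M\<^esub> u) = shifted a M x" for x
    by (simp add: shifted_def fun_eq_iff)
  show "whittaker a M"
  proof (rule whittakerI)
    show "\<exists>k. (shifted a M (partial i) ^^ k) v = \<zero>\<^bsub>M\<^esub>" if "v \<in> carrier M" for v i
      using M that partial_in_Delta[of i] unfolding whittaker_module_def eq by blast
  qed (use M assms in \<open>auto simp: whittaker_module_def\<close>)
next
  assume "whittaker a M"
  then interpret whittaker a M .
  have eq: "(\<lambda>u. act M x u \<ominus>\<^bsub>M\<^esub> phi a x \<odot>\<^bsub>M\<^esub> u) = shifted a M x" for x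
    by (simp add: shifted_def fun_eq_iff)
  have "\<exists>k. \<forall>x\<in>carrier Delta. (shifted a M x ^^ k) v = \<zero>\<^bsub>M\<^esub>" if v: "v \<in> carrier M" for v
  proof -
    have "\<forall>i. \<exists>k. (S i ^^ k) v = \<zero>\<^bsub>M\<^esub>" using locally_nilpotent[OF v] by blast
    then obtain k where "\<forall>i. (S i ^^ k i) v = \<zero>\<^bsub>M\<^esub>"
      using choice[of "\<lambda>i k. (S i ^^ k) v = \<zero>\<^bsub>M\<^esub>"] by blast
    then show ?thesis using shifted_uniformly_nilpotent[OF v] by blast
  qed
  then show "whittaker_module a M"
    unfolding whittaker_module_def eq using lie_module_axioms by blast
qed

section \<open>Endomorphism algebras\<close>

lemma compose_apply: "compose A g f x = (if x \<in> A then g (f x) else undefined)"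
  by (simp add: compose_def)

locale operator_space = cspace M for R :: "'r set" and M :: "('r, 'm) act_module" +
  assumes operator_clin: "r \<in> R \<Longrightarrow> clin M M (act M r)"
begin

abbreviation "E \<equiv> opposite (End_algebra R M)"

lemma E_simps: "carrier E = act_hom R M M" "f \<otimes>\<^bsub>E\<^esub> g = compose (carrier M) g f"
    "\<one>\<^bsub>E\<^esub> = (\<lambda>x\<in>carrier M. x)" "\<zero>\<^bsub>E\<^esub> = (\<lambda>x\<in>carrier M. \<zero>\<^bsub>M\<^esub>)"
    "f \<oplus>\<^bsub>E\<^esub> g = (\<lambda>x\<in>carrier M. f x \<oplus>\<^bsub>M\<^esub> g x)" "c \<odot>\<^bsub>E\<^esub> f = (\<lambda>x\<in>carrier M. c \<odot>\<^bsub>M\<^esub> f x)"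
  by (simp_all add: opposite_def End_algebra_def)

lemma act_in: "r \<in> R \<Longrightarrow> x \<in> carrier M \<Longrightarrow> act M r x \<in> carrier M"
  using clin.closed[OF operator_clin] .

lemma endo_clin: "f \<in> act_hom R M M \<Longrightarrow> clin M M f"
  by (rule act_hom_clin) (simp_all add: cspace_axioms)

lemma endo_in: "f \<in> act_hom R M M \<Longrightarrow> x \<in> carrier M \<Longrightarrow> f x \<in> carrier M"
  using clin.closed[OF endo_clin] .

text \<open>The algebra laws below are equations between functions, so arguments off the carrier
  have to be covered too.\<close>

lemma endo_ext: "f \<in> act_hom R M M \<Longrightarrow> x \<notin> carrier M \<Longrightarrow> f x = undefined"
  by (auto simp: act_hom_def PiE_iff extensional_def)

lemma compose_hom:
  assumes "f \<in> act_hom R M M" "g \<in> act_hom R M M" shows "compose (carrier M) g f \<in> act_hom R M M"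
  unfolding compose_def
  by (rule act_hom_restrictI[OF clin_comp[OF endo_clin[OF assms(1)] endo_clin[OF assms(2)]]])
    (simp_all add: act_homD[OF assms(1)] act_homD[OF assms(2)] endo_in[OF assms(1)] act_in)

lemma id_hom: "(\<lambda>x\<in>carrier M. x) \<in> act_hom R M M"
  by (rule act_hom_restrictI[OF clin_id]) (simp_all add: cspace_axioms act_in)

lemma zero_hom: "(\<lambda>x\<in>carrier M. \<zero>\<^bsub>M\<^esub>) \<in> act_hom R M M"
  by (rule act_hom_restrictI[OF clin_zero])
    (simp_all add: cspace_axioms act_in clin.zero[OF operator_clin])

lemma add_hom:
  assumes "f \<in> act_hom R M M" "g \<in> act_hom R M M"
  shows "(\<lambda>x\<in>carrier M. f x \<oplus>\<^bsub>M\<^esub> g x) \<in> act_hom R M M"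
  by (rule act_hom_restrictI[OF clin_add[OF endo_clin endo_clin]])
    (simp_all add: assms act_homD[OF assms(1)] act_homD[OF assms(2)] endo_in[OF assms(1)]
      endo_in[OF assms(2)] act_in clin.add[OF operator_clin])

lemma smult_hom:
  assumes "f \<in> act_hom R M M" shows "(\<lambda>x\<in>carrier M. c \<odot>\<^bsub>M\<^esub> f x) \<in> act_hom R M M"
  by (rule act_hom_restrictI[OF clin_smult[OF endo_clin]])
    (simp_all add: assms act_homD[OF assms] endo_in[OF assms] act_in clin.smult[OF operator_clin])

lemma E_cspace: "cspace E"
  by (rule cspace_fieldsI)
    (auto simp: E_simps add_hom zero_hom smult_hom endo_in endo_ext a_ac fun_eq_iff
      smult_add_left smult_add_right smult_smult)

lemma E_complex_algebra: "complex_algebra E"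
proof -
  interpret E: cspace E by (rule E_cspace)
  have "ring E"
  proof (rule ringI)
    show "Group.monoid E"
      by (rule monoidI)
        (auto simp: E_simps compose_hom id_hom endo_in endo_ext fun_eq_iff compose_apply)
  qed (auto simp: E.abelian_group_axioms E_simps endo_in fun_eq_iff compose_apply
      clin.add[OF endo_clin])
  then show ?thesis
    unfolding complex_algebra_def complex_algebra_axioms_def
    using E.module_axioms
    by (auto simp: E_simps endo_in fun_eq_iff compose_apply clin.smult[OF endo_clin])
qed

end

section \<open>The universal Whittaker module\<close>

text \<open>The inverse of the bijection f to f(1 tensor 1) from Hom(Q, M) onto Wh(M). It is the
  description inside \<open>Wh\<close>, so that h acts on w as \<open>Qhom a M w\<close> evaluated
  at h(1 tensor 1).\<close>

definition Qhom :: "('n::finite \<Rightarrow> complex) \<Rightarrow> ('n der, 'm) act_module \<Rightarrow> 'm \<Rightarrow> 'n qtype \<Rightarrow> 'm" where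
  "Qhom a M w = (THE f. f \<in> act_hom (carrier Wn) (Qa a) M \<and> f (q_tensor a \<one>\<^bsub>UEA Wn\<^esub> 1) = w)"

context
  fixes a :: "'n::{finite,linorder} \<Rightarrow> complex"
begin

interpretation I: lie_induction Wn Delta "one_dim a"
proof (intro lie_induction.intro enveloping_module.intro enveloping.intro)
  show "lie_subalgebra Wn (Delta :: 'n der lie)" by (rule Delta_subalgebra)
  show "lie_module Delta (one_dim a)" by (rule one_dim_lie_module)
  show "lie_algebra (Delta :: 'n der lie)" by (rule Delta_lie_algebra)
qed

private abbreviation (input) "Q \<equiv> Qa a"
private abbreviation (input) "W \<equiv> carrier (Wn :: 'n der lie)"
private abbreviation (input) "q0 \<equiv> q_tensor a \<one>\<^bsub>UEA Wn\<^esub> 1"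

lemma Q_lie_module: "lie_module Wn Q"
  unfolding Qa_def by (rule I.ind_lie_module)

interpretation Q: lie_module Wn Q by (rule Q_lie_module)

lemma Q_simps: "carrier Q = carrier I.T.T" "module.smult Q = module.smult I.T.T" "q_tensor a = I.T.pure"
  unfolding Qa_def q_tensor_def by simp_all

lemma q_tensor_in [simp]: "u \<in> carrier (UEA Wn) \<Longrightarrow> q_tensor a u z \<in> carrier Q"
  unfolding Q_simps by simp

lemma q0_in [simp]: "q0 \<in> carrier Q"
  by simp

lemma q_tensor_smult: "u \<in> carrier (UEA Wn) \<Longrightarrow> q_tensor a u z = z \<odot>\<^bsub>Q\<^esub> q_tensor a u 1"
  using I.T.pure_smult_right[of u 1 z] by (simp add: Q_simps)

lemma act_q_tensor:
  "x \<in> W \<Longrightarrow> u \<in> carrier (UEA Wn) \<Longrightarrow> act Q x (q_tensor a u z) = q_tensor a (uea_incl Wn x \<otimes>\<^bsub>UEA Wn\<^esub> u) z"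
  using I.act_ind_pure[of x u z] unfolding Q_simps Qa_def by simp

text \<open>As an element of U(\<open>Delta\<close>), \<open>partial i\<close> can be moved across
  the tensor sign, where it acts on the one dimensional module by a_i.\<close>

lemma partial_q0: "act Q (partial i) q0 = a i \<odot>\<^bsub>Q\<^esub> q0"
proof -
  let ?s = "uea_incl Delta (partial i)"
  have s: "?s \<in> carrier (UEA Delta)" using I.K.incl_in[OF partial_in_Delta] .
  have "I.uea_map ?s = uea_incl Wn (partial i)"
    unfolding uea_incl_def by (rule I.uea_map_cls) (rule I.K.letter_in[OF partial_in_Delta])
  then have "act Q (partial i) q0 = I.T.pure (act I.R ?s \<one>\<^bsub>UEA Wn\<^esub>) 1"
    using act_q_tensor[of "partial i" "\<one>\<^bsub>UEA Wn\<^esub>" 1] by (simp add: Q_simps(3))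
  also have "\<dots> = I.T.pure \<one>\<^bsub>UEA Wn\<^esub> (act I.NU ?s 1)"
    by (rule I.T.pure_balanced) (simp_all add: s)
  also have "act I.NU ?s 1 = a i"
    using I.N.uact_incl[OF partial_in_Delta, of 1 i] by (simp add: phi_partial)
  finally show ?thesis
    using q_tensor_smult[of "\<one>\<^bsub>UEA Wn\<^esub>" "a i"] by (simp add: Q_simps(3))
qed

lemma Q_generated:
  assumes "submodule S complex_field Q" "\<And>x z. x \<in> W \<Longrightarrow> z \<in> S \<Longrightarrow> act Q x z \<in> S"
    "q0 \<in> S" "z \<in> carrier Q"
  shows "z \<in> S"
proof (rule I.ind_generated[folded Qa_def, OF assms(1,2) _ assms(4)])
  show "I.T.pure \<one>\<^bsub>UEA Wn\<^esub> m \<in> S" for m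
    using q_tensor_smult[of "\<one>\<^bsub>UEA Wn\<^esub>" m] Q.M.subspace_smult[OF assms(1,3), of m]
    by (simp add: Q_simps(3))
qed

lemma Qhom_unique:
  assumes "cspace M" "f \<in> act_hom W Q M" "g \<in> act_hom W Q M" "f q0 = g q0"
  shows "f = g"
proof (rule I.ind_hom_unique[folded Qa_def, OF assms(1-3)])
  interpret f: clin Q M f by (rule act_hom_clin[OF assms(2) Q.M.cspace_axioms assms(1)])
  interpret g: clin Q M g by (rule act_hom_clin[OF assms(3) Q.M.cspace_axioms assms(1)])
  show "f (I.T.pure \<one>\<^bsub>UEA Wn\<^esub> m) = g (I.T.pure \<one>\<^bsub>UEA Wn\<^esub> m)" for m
    using q_tensor_smult[of "\<one>\<^bsub>UEA Wn\<^esub>" m] assms(4)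
    by (simp add: f.smult[OF q0_in] g.smult[OF q0_in] flip: Q_simps(3))
qed

text \<open>The linear map z to z w on the one dimensional module is
  \<open>Delta\<close>-equivariant because \<open>w\<close> is a Whittaker vector; the universal
  property of the induced module extends it to Q.\<close>

lemma Qhom_exists:
  assumes "lie_module Wn M" "w \<in> whittaker_vectors a M"
  shows "\<exists>f\<in>act_hom W Q M. f q0 = w"
proof -
  interpret M: Wn_module a M by (intro Wn_module.intro assms(1))
  have w: "w \<in> carrier M" using assms(2) by (simp add: whittaker_vectors_def)
  interpret O: cspace "one_dim a" by (rule one_dim_cspace)
  have "clin (one_dim a) M (\<lambda>z. z \<odot>\<^bsub>M\<^esub> w)"
    using w by unfold_locales (simp_all add: M.M.smult_add_left M.M.smult_smult)
  then have "\<exists>f\<in>act_hom W Q M. \<forall>m\<in>carrier (one_dim a). f (I.T.pure \<one>\<^bsub>UEA Wn\<^esub> m) = m \<odot>\<^bsub>M\<^esub> w"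
    unfolding Qa_def
  proof (rule I.ind_hom_exists[OF assms(1)])
    show "act (one_dim a) k m \<odot>\<^bsub>M\<^esub> w = act M k (m \<odot>\<^bsub>M\<^esub> w)" if "k \<in> carrier Delta" for k m
      using M.Delta_whittaker[OF assms(2) that] w Delta_in_Wn[OF that]
      by (simp add: M.act_smult_right M.M.smult_smult mult.commute)
  qed
  then obtain f where "f \<in> act_hom W Q M" "f q0 = 1 \<odot>\<^bsub>M\<^esub> w"
    unfolding Q_simps(3) by auto
  then show ?thesis using w by auto
qed

lemma euler_monomial_eq:
  "q_tensor a (euler_monomial m) 1 = foldr (\<lambda>i. act Q (euler i) ^^ m i) (sorted_list_of_set UNIV) q0"
proof -
  let ?U = "UEA (Wn :: 'n der lie)"
  let ?\<iota> = "\<lambda>i. uea_incl Wn (euler i) :: ('n der fword \<Rightarrow>\<^sub>0 complex) set"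
  have i: "?\<iota> i \<in> carrier ?U" for i by simp
  \<comment> \<open>Powers in U(W_n) split off their last factor, which is absorbed into u; hence u
    stays arbitrary in the induction.\<close>
  have pow: "q_tensor a ((?\<iota> i [^]\<^bsub>?U\<^esub> k) \<otimes>\<^bsub>?U\<^esub> u) 1 = (act Q (euler i) ^^ k) (q_tensor a u 1)"
    if "u \<in> carrier ?U" for u and k :: nat and i
    using that
  proof (induction k arbitrary: u)
    case (Suc k)
    then show ?case
      using i[of i] Suc.IH[of "?\<iota> i \<otimes>\<^bsub>?U\<^esub> u"]
      by (simp add: I.U.m_assoc act_q_tensor funpow_Suc_right del: funpow.simps)
  qed simp
  have "foldr (\<lambda>i u. (?\<iota> i [^]\<^bsub>?U\<^esub> m i) \<otimes>\<^bsub>?U\<^esub> u) l \<one>\<^bsub>?U\<^esub> \<in> carrier ?U \<and>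
    q_tensor a (foldr (\<lambda>i u. (?\<iota> i [^]\<^bsub>?U\<^esub> m i) \<otimes>\<^bsub>?U\<^esub> u) l \<one>\<^bsub>?U\<^esub>) 1
      = foldr (\<lambda>i. act Q (euler i) ^^ m i) l q0" for l
    by (induction l) (simp_all add: pow)
  then show ?thesis unfolding euler_monomial_def by blast
qed

end

locale universal_whittaker =
  fixes a :: "'n::{finite,linorder} \<Rightarrow> complex"
  assumes nonzero: "a i \<noteq> 0"
begin

abbreviation (input) "Q \<equiv> Qa a"
abbreviation (input) "W \<equiv> carrier (Wn :: 'n der lie)"
abbreviation (input) "q0 \<equiv> q_tensor a \<one>\<^bsub>UEA Wn\<^esub> 1"

sublocale Q: Wn_module a Q
  by (intro Wn_module.intro Q_lie_module)

lemma q0_whittaker: "q0 \<in> whittaker_vectors a Q"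
  by (simp add: whittaker_vectors_def partial_q0)

text \<open>The vectors killed by a power of D_i form a W_n-submodule, by \<open>S_pow_act\<close>
  and \<open>ad_partial_locally_nilpotent\<close>; it contains the generator, which D_i itself
  kills.\<close>

sublocale Q: whittaker a Q
proof (rule whittakerI[OF Q_lie_module nonzero])
  fix z i assume z: "z \<in> carrier Q"
  let ?S = "{v \<in> carrier Q. \<exists>k. (Q.S i ^^ k) v = \<zero>\<^bsub>Q\<^esub>}"
  have "z \<in> ?S"
  proof (rule Q_generated[OF _ _ _ z])
    show "submodule ?S complex_field Q"
      by (rule clin_nilpotent_submodule[OF Q.shifted_clin]) simp
    show "act Q x v \<in> ?S" if x: "x \<in> W" and v: "v \<in> ?S" for x v
    proof -
      obtain r where "(bracket Wn (partial i) ^^ r) x = \<zero>\<^bsub>Wn\<^esub>"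
        using ad_partial_locally_nilpotent[of x i] x by (auto simp: Wn_simps(1))
      then show ?thesis
        using Q.S_pow_act[where i = i and r = r and x = x] x v Q.act_closed by blast
    qed
    have "(Q.S i ^^ 1) q0 = \<zero>\<^bsub>Q\<^esub>"
      by (simp add: shifted_def partial_q0 phi_partial Q.M.diff_eq_zero_iff)
    then show "q0 \<in> ?S" by (simp del: funpow.simps) blast
  qed
  then show "\<exists>k. (Q.S i ^^ k) z = \<zero>\<^bsub>Q\<^esub>" by blast
qed

lemma Qhom:
  assumes "lie_module Wn M" "w \<in> whittaker_vectors a M"
  shows "Qhom a M w \<in> act_hom W Q M" "Qhom a M w q0 = w"
proof -
  interpret M: Wn_module a M by (intro Wn_module.intro assms(1))
  obtain f where f: "f \<in> act_hom W Q M" "f q0 = w" using Qhom_exists[OF assms] by blast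
  have "Qhom a M w \<in> act_hom W Q M \<and> Qhom a M w q0 = w"
    unfolding Qhom_def
    by (rule theI[of _ f]) (use f Qhom_unique[OF M.M.cspace_axioms] in auto)
  then show "Qhom a M w \<in> act_hom W Q M" "Qhom a M w q0 = w" by auto
qed

lemma hom_whittaker_vectors:
  assumes "f \<in> act_hom W M N" "lie_module Wn M" "lie_module Wn N" "w \<in> whittaker_vectors a M"
  shows "f w \<in> whittaker_vectors a N"
proof -
  interpret M: lie_module Wn M by fact
  interpret N: lie_module Wn N by fact
  interpret f: clin M N f by (rule act_hom_clin[OF assms(1) M.M.cspace_axioms N.M.cspace_axioms])
  show ?thesis
    using assms(4) act_homD[OF assms(1), of "partial _" w, symmetric] f.smult
    by (auto simp: whittaker_vectors_def)
qed

lemma Qhom_eqI: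
  assumes "lie_module Wn M" "f \<in> act_hom W Q M" shows "Qhom a M (f q0) = f"
proof -
  interpret M: lie_module Wn M by fact
  have "f q0 \<in> whittaker_vectors a M"
    by (rule hom_whittaker_vectors[OF assms(2) Q_lie_module assms(1) q0_whittaker])
  from Qhom[OF assms(1) this] show ?thesis
    by (intro Qhom_unique[OF M.M.cspace_axioms _ assms(2)])
qed

lemma hom_compose:
  assumes "f \<in> act_hom R M N" "g \<in> act_hom R N P" "cspace M" "cspace N" "cspace P"
    "\<And>r x. r \<in> R \<Longrightarrow> x \<in> carrier M \<Longrightarrow> act M r x \<in> carrier M"
  shows "compose (carrier M) g f \<in> act_hom R M P"
proof -
  have f: "clin M N f" by (rule act_hom_clin[OF assms(1,3,4)])
  show ?thesis
    unfolding compose_def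
    by (rule act_hom_restrictI[OF clin_comp[OF f act_hom_clin[OF assms(2,4,5)]]])
      (simp_all add: act_homD[OF assms(1)] act_homD[OF assms(2)] assms(6) clin.closed[OF f])
qed

text \<open>Both sides, as functions of \<open>q\<close>, are homomorphisms with value
  \<open>f w\<close> at the generator.\<close>

lemma Qhom_naturality:
  assumes "f \<in> act_hom W M N" "lie_module Wn M" "lie_module Wn N" "w \<in> whittaker_vectors a M"
    "q \<in> carrier Q"
  shows "f (Qhom a M w q) = Qhom a N (f w) q"
proof -
  interpret M: lie_module Wn M by fact
  interpret N: lie_module Wn N by fact
  have "compose (carrier Q) f (Qhom a M w) \<in> act_hom W Q N"
    by (rule hom_compose[OF Qhom(1)[OF assms(2,4)] assms(1)])
      (simp_all add: Q.M.cspace_axioms M.M.cspace_axioms N.M.cspace_axioms Q.act_closed)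
  from Qhom_eqI[OF assms(3) this] have "Qhom a N (f w) = compose (carrier Q) f (Qhom a M w)"
    by (simp add: compose_def Qhom[OF assms(2,4)])
  then show ?thesis using assms(5) by (simp add: compose_def)
qed

sublocale QE: operator_space W Q
  by (intro operator_space.intro operator_space_axioms.intro Q.M.cspace_axioms Q.act_clin)

abbreviation "H \<equiv> Ha a"

lemma H_eq: "H = QE.E" by (simp add: Ha_def)

lemmas H_simps = QE.E_simps[folded H_eq]

sublocale H: complex_algebra H
  unfolding H_eq by (rule QE.E_complex_algebra)

lemma H_cspace: "cspace H" unfolding H_eq by (rule QE.E_cspace)

lemma Q_right_simps [simp]: "carrier (Q_right a) = carrier Q" "ring.add (Q_right a) = ring.add Q"
    "\<zero>\<^bsub>Q_right a\<^esub> = \<zero>\<^bsub>Q\<^esub>" "module.smult (Q_right a) = module.smult Q" "act (Q_right a) h q = h q"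
  by (simp_all add: Q_right_def)

lemma Q_right_cspace: "cspace (Q_right a)"
  unfolding Q_right_def by (intro cspace_with_act Q.M.cspace_axioms)

lemma Q_right_clin: "clin Q M f \<Longrightarrow> clin (Q_right a) M f"
  unfolding Q_right_def by (rule clin_with_act_left)

lemma Q_right_clin': "clin Q Q f \<Longrightarrow> clin (Q_right a) (Q_right a) f"
  unfolding Q_right_def by (intro clin_with_act_left clin_with_act_right)

lemma H_clin: "h \<in> carrier H \<Longrightarrow> clin Q Q h"
  using QE.endo_clin by (simp add: H_simps)

lemma Q_right_module: "right_module H (Q_right a)"
proof -
  interpret Qr: cspace "Q_right a" by (rule Q_right_cspace)
  interpret Hc: cspace H by (rule H_cspace)
  have "bilinear_action H (Q_right a)"
  proof (rule bilinear_actionI[OF H_cspace Q_right_cspace])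
    show "clin (Q_right a) (Q_right a) (act (Q_right a) h)" if "h \<in> carrier H" for h
      using Q_right_clin'[OF H_clin[OF that]] by (rule clin_cong) simp
    show "clin H (Q_right a) (\<lambda>h. act (Q_right a) h q)" if "q \<in> carrier (Q_right a)" for q
      using that by unfold_locales (simp_all add: H_simps QE.endo_in)
  qed
  then show ?thesis
    unfolding right_module_def right_module_axioms_def
    using H.complex_algebra_axioms by (simp add: H_simps compose_def)
qed

lemma hom_hpow:
  assumes "f \<in> act_hom W M N" "whittaker a M" "whittaker a N" "v \<in> carrier M"
  shows "f (shift_family.hpow (\<lambda>i. act M (euler i)) l m v)
    = shift_family.hpow (\<lambda>i. act N (euler i)) l m (f v)"
proof -
  interpret M: whittaker a M by fact
  interpret N: whittaker a N by fact
  have pow: "f ((act M (euler i) ^^ k) v) = (act N (euler i) ^^ k) (f v)" if "v \<in> carrier M" for i k v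
    using that by (induction k) (simp_all add: act_homD[OF assms(1)])
  show ?thesis
    using assms(4) by (induction l) (simp_all add: M.hpow_Cons N.hpow_Cons pow)
qed

lemma euler_monomial_hpow: "q_tensor a (euler_monomial m) 1 = Q.hpow Q.idx m q0"
  unfolding Q.hpow_def by (rule euler_monomial_eq)

lemma H_apply_hpow: "h \<in> carrier H \<Longrightarrow> h (Q.hpow l m q0) = Q.hpow l m (h q0)"
  using hom_hpow[of h Q Q q0] Q.whittaker_axioms by (simp add: H_simps)

lemma H_q0: "h \<in> carrier H \<Longrightarrow> h q0 \<in> Q.kers"
  using hom_whittaker_vectors[OF _ Q_lie_module Q_lie_module q0_whittaker]
  by (simp add: H_simps Q.kers_eq)

section \<open>The basis of Q over H\<close>

lemma euler_basis: "right_module_basis H (Q_right a) UNIV (\<lambda>m. q_tensor a (euler_monomial m) 1)"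
  unfolding right_module_basis_def euler_monomial_hpow
proof (intro conjI allI ballI impI)
  show "right_module H (Q_right a)" by (rule Q_right_module)
  \<comment> \<open>An endomorphism commutes with the h_i, so \<open>c j\<close> applied to the j-th
    basis element is h^j applied to the Whittaker vector \<open>c j q0\<close>: a right
    H-combination is an expansion.\<close>
  have sum_eq: "(\<Oplus>\<^bsub>Q_right a\<^esub>j\<in>J. act (Q_right a) (c j) (Q.hpow Q.idx j q0))
      = (\<Oplus>\<^bsub>Q\<^esub>j\<in>J. Q.hpow Q.idx j (c j q0))" if "c \<in> J \<rightarrow> carrier H" for J c
  proof -
    have "(\<Oplus>\<^bsub>Q_right a\<^esub>j\<in>J. act (Q_right a) (c j) (Q.hpow Q.idx j q0))
      = (\<Oplus>\<^bsub>Q\<^esub>j\<in>J. act (Q_right a) (c j) (Q.hpow Q.idx j q0))"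
      using clin.finsum[OF Q_right_clin[OF clin_id[OF Q.M.cspace_axioms]],
          of "\<lambda>j. act (Q_right a) (c j) (Q.hpow Q.idx j q0)" J] that
      by (auto simp: H_simps QE.endo_in Pi_iff)
    also have "\<dots> = (\<Oplus>\<^bsub>Q\<^esub>j\<in>J. Q.hpow Q.idx j (c j q0))"
      using that by (intro Q.M.finsum_cong') (auto simp: H_apply_hpow H_simps QE.endo_in Pi_iff)
    finally show ?thesis .
  qed
  show "\<exists>J c. finite J \<and> J \<subseteq> UNIV \<and> c \<in> J \<rightarrow> carrier H \<and>
      x = (\<Oplus>\<^bsub>Q_right a\<^esub>j\<in>J. act (Q_right a) (c j) (Q.hpow Q.idx j q0))"
    if x: "x \<in> carrier (Q_right a)" for x
  proof -
    obtain w where "Q.expansion x w" using Q.expansion_exists[of x] x by auto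
    then obtain J where J: "\<And>m. w m \<in> Q.kers" "finite J" "x = (\<Oplus>\<^bsub>Q\<^esub>j\<in>J. Q.hpow Q.idx j (w j))"
      unfolding Q.expansion_def by blast
    \<comment> \<open>Each coefficient, being a Whittaker vector of Q, is the value at the generator
      of an element of H.\<close>
    have c: "Qhom a Q (w j) \<in> carrier H" "Qhom a Q (w j) q0 = w j" for j
      using Qhom[OF Q_lie_module] J(1) by (simp_all add: H_simps Q.kers_eq)
    show ?thesis
      by (rule exI[of _ J], rule exI[of _ "\<lambda>j. Qhom a Q (w j)"], subst sum_eq) (simp_all add: J(2,3) c)
  qed
  fix J c j
  assume "finite J \<and> J \<subseteq> UNIV \<and> c \<in> J \<rightarrow> carrier H \<and>
      (\<Oplus>\<^bsub>Q_right a\<^esub>j\<in>J. act (Q_right a) (c j) (Q.hpow Q.idx j q0)) = \<zero>\<^bsub>Q_right a\<^esub>" and j: "j \<in> J"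
  then have J: "finite J" "c \<in> J \<rightarrow> carrier H" "(\<Oplus>\<^bsub>Q\<^esub>j\<in>J. Q.hpow Q.idx j (c j q0)) = \<zero>\<^bsub>Q\<^esub>"
    using sum_eq by auto
  \<comment> \<open>Independence makes \<open>c j\<close> vanish on the generator of Q, and
    therefore everywhere.\<close>
  have "c j q0 = \<zero>\<^bsub>Q\<^esub>"
    by (rule Q.hpow_independent[OF Q.l(1) J(1) _ _ J(3) j]) (use J(2) H_q0 Q.l in auto)
  then show "c j = \<zero>\<^bsub>H\<^esub>"
    using J(2) j by (intro Qhom_unique[OF Q.M.cspace_axioms])
      (auto simp: H_simps QE.zero_hom)
qed (auto simp: Q.hpow_in)

section \<open>The functor of Whittaker vectors\<close>

lemma Wh_simps: "carrier (Wh a M) = whittaker_vectors a M" "ring.add (Wh a M) = ring.add M"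
    "\<zero>\<^bsub>Wh a M\<^esub> = \<zero>\<^bsub>M\<^esub>" "module.smult (Wh a M) = module.smult M"
    "act (Wh a M) h w = Qhom a M w (h q0)"
  by (simp_all add: Wh_def Qhom_def)

lemma Wh_cspace: assumes "whittaker a M" shows "cspace (Wh a M)"
proof -
  interpret M: whittaker a M by fact
  have "module complex_field (M\<lparr>carrier := whittaker_vectors a M\<rparr>)"
    using submodule.submodule_is_module[OF M.kers_submodule M.M.module_axioms] by (simp add: M.kers_eq)
  then show ?thesis unfolding Wh_def by (intro cspace_with_act cspaceI)
qed

lemma Wh_act_in:
  assumes "whittaker a M" "w \<in> whittaker_vectors a M" "h \<in> carrier H"
  shows "Qhom a M w (h q0) \<in> whittaker_vectors a M"
proof -
  interpret M: whittaker a M by fact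
  show ?thesis
    using assms(2,3) H_q0[OF assms(3)]
    by (intro hom_whittaker_vectors[OF Qhom(1) Q_lie_module])
      (simp_all add: M.lie_module_axioms Q.kers_eq)
qed

text \<open>The vector h w corresponds to the homomorphism of \<open>w\<close> composed with
  \<open>h\<close>. This yields both the associativity of the H-action on Wh(M) and the balancedness
  of the evaluation map.\<close>

lemma Qhom_act:
  assumes "whittaker a M" "w \<in> whittaker_vectors a M" "h \<in> carrier H" "q \<in> carrier Q"
  shows "Qhom a M (Qhom a M w (h q0)) q = Qhom a M w (h q)"
proof -
  interpret M: whittaker a M by fact
  have "h q = Qhom a Q (h q0) q"
    using Qhom_eqI[OF Q_lie_module] assms(3) by (simp add: H_simps)
  then show ?thesis
    using Qhom_naturality[OF Qhom(1)[OF M.lie_module_axioms assms(2)] Q_lie_module M.lie_module_axioms _ assms(4)]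
      H_q0[OF assms(3)] by (simp add: Q.kers_eq)
qed

text \<open>Sums and scalar multiples of the homomorphisms attached to Whittaker vectors have the
  right value at the generator, so uniqueness identifies them.\<close>

lemma Qhom_clin:
  assumes "whittaker a M" "q \<in> carrier Q" shows "clin (Wh a M) M (\<lambda>w. Qhom a M w q)"
proof -
  interpret M: whittaker a M by fact
  interpret V: cspace "Wh a M" by (rule Wh_cspace[OF assms(1)])
  note hom = Qhom[OF M.lie_module_axioms]
  have cl: "clin Q M (Qhom a M w)" if "w \<in> whittaker_vectors a M" for w
    by (rule act_hom_clin[OF hom(1)[OF that] Q.M.cspace_axioms M.M.cspace_axioms])
  show ?thesis
  proof unfold_locales
    fix w w' c assume w: "w \<in> carrier (Wh a M)"
    then have w1: "w \<in> whittaker_vectors a M" by (simp add: Wh_simps)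
    show "Qhom a M w q \<in> carrier M" using clin.closed[OF cl[OF w1] assms(2)] .
    have "c \<odot>\<^bsub>M\<^esub> w \<in> whittaker_vectors a M" using V.smult_in[OF w] by (simp add: Wh_simps)
    then have "Qhom a M (c \<odot>\<^bsub>M\<^esub> w) = (\<lambda>q\<in>carrier Q. c \<odot>\<^bsub>M\<^esub> Qhom a M w q)"
      using w1
      by (intro Qhom_unique[OF M.M.cspace_axioms hom(1) act_hom_restrictI[OF clin_smult[OF cl]]])
        (simp_all add: hom Q.act_closed act_homD[OF hom(1)] M.act_smult_right clin.closed[OF cl])
    then show "Qhom a M (c \<odot>\<^bsub>Wh a M\<^esub> w) q = c \<odot>\<^bsub>M\<^esub> Qhom a M w q" using assms(2) by (simp add: Wh_simps)
    assume w': "w' \<in> carrier (Wh a M)"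
    then have w1': "w' \<in> whittaker_vectors a M" by (simp add: Wh_simps)
    have "w \<oplus>\<^bsub>M\<^esub> w' \<in> whittaker_vectors a M" using V.add.m_closed[OF w w'] by (simp add: Wh_simps)
    then have "Qhom a M (w \<oplus>\<^bsub>M\<^esub> w') = (\<lambda>q\<in>carrier Q. Qhom a M w q \<oplus>\<^bsub>M\<^esub> Qhom a M w' q)"
      using w1 w1'
      by (intro Qhom_unique[OF M.M.cspace_axioms hom(1) act_hom_restrictI[OF clin_add[OF cl cl]]])
        (simp_all add: hom Q.act_closed act_homD[OF hom(1)] M.act_add_right clin.closed[OF cl])
    then show "Qhom a M (w \<oplus>\<^bsub>Wh a M\<^esub> w') q = Qhom a M w q \<oplus>\<^bsub>M\<^esub> Qhom a M w' q"
      using assms(2) by (simp add: Wh_simps)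
  qed
qed

lemma Wh_left_module: assumes "whittaker a M" shows "left_module H (Wh a M)"
proof -
  interpret M: whittaker a M by fact
  interpret V: cspace "Wh a M" by (rule Wh_cspace[OF assms])
  interpret Hc: cspace H by (rule H_cspace)
  have "bilinear_action H (Wh a M)"
  proof (rule bilinear_actionI[OF H_cspace V.cspace_axioms])
    show "clin (Wh a M) (Wh a M) (act (Wh a M) h)" if "h \<in> carrier H" for h
    proof -
      interpret c: clin "Wh a M" M "\<lambda>w. Qhom a M w (h q0)"
        using that by (intro Qhom_clin[OF assms]) (simp add: H_simps QE.endo_in)
      show ?thesis
        using that Wh_act_in[OF assms] c.add c.smult by unfold_locales (auto simp: Wh_simps)
    qed
    show "clin H (Wh a M) (\<lambda>h. act (Wh a M) h w)" if "w \<in> carrier (Wh a M)" for w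
    proof -
      have w: "w \<in> whittaker_vectors a M" using that by (simp add: Wh_simps)
      interpret c: clin Q M "Qhom a M w"
        by (rule act_hom_clin[OF Qhom(1)[OF M.lie_module_axioms w] Q.M.cspace_axioms M.M.cspace_axioms])
      show ?thesis
        using Wh_act_in[OF assms w]
        by unfold_locales (simp_all add: Wh_simps(1,2,4,5), simp_all add: H_simps QE.endo_in c.add c.smult)
    qed
  qed
  moreover have "act (Wh a M) \<one>\<^bsub>H\<^esub> w = w" if "w \<in> carrier (Wh a M)" for w
    using that Qhom[OF M.lie_module_axioms] by (simp add: Wh_simps H_simps)
  \<comment> \<open>In H the product of h and g is g after h, the order reversal that turns
    precomposition into a left action.\<close>
  moreover have "act (Wh a M) (h \<otimes>\<^bsub>H\<^esub> g) w = act (Wh a M) h (act (Wh a M) g w)"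
    if "h \<in> carrier H" "g \<in> carrier H" "w \<in> carrier (Wh a M)" for h g w
    using that Qhom_act[OF assms, of w g "h q0"] by (simp add: Wh_simps H_simps compose_def QE.endo_in)
  ultimately show ?thesis
    unfolding left_module_def left_module_axioms_def using H.complex_algebra_axioms by blast
qed

lemma finite_dim_Wh: "whittaker a M \<Longrightarrow>
  finite_dim (Wh a M) \<longleftrightarrow> finite_dim (M\<lparr>carrier := whittaker_vectors a M\<rparr>)"
proof -
  assume M: "whittaker a M"
  let ?N = "M\<lparr>carrier := whittaker_vectors a M\<rparr>"
  have N: "cspace ?N" by (rule cspace_cong[OF Wh_cspace[OF M]]) (simp_all add: Wh_simps)
  have "clin ?N (Wh a M) (\<lambda>x. x)" "clin (Wh a M) ?N (\<lambda>x. x)"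
    using clin_id[OF N] clin_id[OF Wh_cspace[OF M]] N Wh_cspace[OF M]
    by (simp_all add: clin_def clin_axioms_def Wh_simps)
  then show ?thesis
    using clin.finite_dim_image[of ?N "Wh a M" "\<lambda>x. x"] clin.finite_dim_image[of "Wh a M" ?N "\<lambda>x. x"]
    by (auto simp: Wh_simps)
qed

lemma Omega_iff: "M \<in> Omega a \<longleftrightarrow> whittaker a M \<and> finite_dim (Wh a M)"
  using finite_dim_Wh[of M] whittaker_module_iff[of a M] nonzero by (auto simp: Omega_def)

lemma Wh_H_mod: "M \<in> Omega a \<Longrightarrow> Wh a M \<in> H_mod a"
  using Wh_left_module by (auto simp: Omega_iff H_mod_def)

lemma Wh_map_hom:
  assumes "whittaker a M" "whittaker a N" "f \<in> act_hom W M N"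
  shows "Wh_map a M N f \<in> act_hom (carrier H) (Wh a M) (Wh a N)"
proof -
  interpret M: whittaker a M by fact
  interpret N: whittaker a N by fact
  interpret f: clin M N f by (rule act_hom_clin[OF assms(3) M.M.cspace_axioms N.M.cspace_axioms])
  interpret WM: cspace "Wh a M" by (rule Wh_cspace[OF assms(1)])
  interpret WN: cspace "Wh a N" by (rule Wh_cspace[OF assms(2)])
  have in_M: "w \<in> carrier M" if "w \<in> whittaker_vectors a M" for w
    using that by (simp add: whittaker_vectors_def)
  have "clin (Wh a M) (Wh a N) f"
    using hom_whittaker_vectors[OF assms(3) M.lie_module_axioms N.lie_module_axioms]
    by unfold_locales (simp_all add: Wh_simps in_M f.add f.smult)
  then show ?thesis
    unfolding Wh_map_def
    using Wh_act_in[OF assms(1)]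
      Qhom_naturality[OF assms(3) M.lie_module_axioms N.lie_module_axioms]
    by (intro act_hom_restrictI) (simp_all add: Wh_simps H_simps QE.endo_in)
qed

lemma Wh_functor:
  "module_functor (Omega a :: ('n der, 'm) act_module set) W (H_mod a) (carrier H) (Wh a) (Wh_map a)"
  unfolding module_functor_def
proof (intro conjI ballI)
  fix M :: "('n der, 'm) act_module" assume M: "M \<in> Omega a"
  show "Wh a M \<in> H_mod a" by (rule Wh_H_mod[OF M])
  have sub: "w \<in> carrier M" if "w \<in> carrier (Wh a M)" for w
    using that by (simp add: Wh_simps whittaker_vectors_def)
  show "Wh_map a M M (\<lambda>x\<in>carrier M. x) = (\<lambda>y\<in>carrier (Wh a M). y)"
    using sub by (auto simp: Wh_map_def restrict_def fun_eq_iff)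
  fix N :: "('n der, 'm) act_module" assume N: "N \<in> Omega a"
  show "Wh_map a M N f \<in> act_hom (carrier H) (Wh a M) (Wh a N)" if "f \<in> act_hom W M N" for f
    using M N that by (intro Wh_map_hom) (simp_all add: Omega_iff)
  fix P :: "('n der, 'm) act_module" and f g
  assume P: "P \<in> Omega a" and f: "f \<in> act_hom W M N" and g: "g \<in> act_hom W N P"
  have "lie_module Wn M" "lie_module Wn N"
    using M N by (simp_all add: Omega_def whittaker_module_def)
  then have "f w \<in> carrier (Wh a N)" if "w \<in> carrier (Wh a M)" for w
    using hom_whittaker_vectors[OF f] that by (simp add: Wh_simps)
  then show "Wh_map a M P (compose (carrier M) g f)
      = compose (carrier (Wh a M)) (Wh_map a N P g) (Wh_map a M N f)"
    using sub by (auto simp: Wh_map_def compose_def restrict_def fun_eq_iff)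
qed

end

section \<open>The tensor functor\<close>

locale H_module = universal_whittaker a + V: left_module "Ha a" V
  for a :: "'n::{finite,linorder} \<Rightarrow> complex" and V :: "('n qtype \<Rightarrow> 'n qtype, 'v) act_module"
begin

sublocale VS: cspace V by (rule cspaceI) (rule V.M.module_axioms)

lemma V_act_clin: "h \<in> carrier H \<Longrightarrow> clin V V (act V h)"
  by unfold_locales (simp_all add: V.act_closed V.act_add_right V.act_smult_right)

lemma V_act_left_clin: "v \<in> carrier V \<Longrightarrow> clin H V (\<lambda>h. act V h v)"
  using H_cspace
  by (simp add: clin_def clin_axioms_def VS.cspace_axioms V.act_closed V.act_add_left V.act_smult_left)

sublocale T: balanced_pair H "Q_right a" V
  by (intro balanced_pair.intro balanced_pair_axioms.intro Q_right_cspace VS.cspace_axioms)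
    (simp_all add: clin.closed[OF H_clin] V.act_closed)

abbreviation "QV \<equiv> QT a V"

lemma QV_simps: "carrier QV = carrier T.T" "ring.add QV = ring.add T.T" "\<zero>\<^bsub>QV\<^esub> = \<zero>\<^bsub>T.T\<^esub>"
    "module.smult QV = module.smult T.T"
    "act QV x = tensor_map H (Q_right a) V (act Q x) (\<lambda>v. v)"
  by (simp_all add: QT_def)

lemma QV_clin: "clin T.T M f \<Longrightarrow> clin QV M f"
  unfolding QT_def by (rule clin_with_act_left)

lemma QV_clin': "clin M T.T f \<Longrightarrow> clin M QV f"
  unfolding QT_def by (rule clin_with_act_right)

lemma QV_cspace: "cspace QV"
  unfolding QT_def by (intro cspace_with_act T.Q.cspace_axioms)

lemma T_clin: "clin QV M f \<Longrightarrow> clin T.T M f"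
  unfolding QT_def clin_def clin_axioms_def using T.Q.cspace_axioms by auto

lemma pure_in [simp]: "q \<in> carrier Q \<Longrightarrow> v \<in> carrier V \<Longrightarrow> T.pure q v \<in> carrier QV"
  by (simp add: QV_simps)

lemma QV_induct [consumes 1, case_names zero pure add]:
  assumes "z \<in> carrier QV" "P \<zero>\<^bsub>QV\<^esub>" "\<And>q v. q \<in> carrier Q \<Longrightarrow> v \<in> carrier V \<Longrightarrow> P (T.pure q v)"
    "\<And>z w. z \<in> carrier QV \<Longrightarrow> w \<in> carrier QV \<Longrightarrow> P z \<Longrightarrow> P w \<Longrightarrow> P (z \<oplus>\<^bsub>QV\<^esub> w)"
  shows "P z"
  using T.tensor_induct[of z P] assms unfolding QV_simps by simp

lemma QV_clin_eqI:
  assumes "clin QV M f" "clin QV M g" "\<And>q v. q \<in> carrier Q \<Longrightarrow> v \<in> carrier V \<Longrightarrow> f (T.pure q v) = g (T.pure q v)"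
    "z \<in> carrier QV"
  shows "f z = g z"
  using T.clin_eqI[OF T_clin[OF assms(1)] T_clin[OF assms(2)]] assms(3,4) by (simp add: QV_simps)

lemma pure_clin_left: "v \<in> carrier V \<Longrightarrow> clin Q QV (\<lambda>q. T.pure q v)"
  using T.pure_add_left[where y = v] T.pure_smult_left[where y = v] QV_cspace Q.M.cspace_axioms
  by (simp add: clin_def clin_axioms_def) (simp add: QV_simps)

lemma pure_clin_right: "q \<in> carrier Q \<Longrightarrow> clin V QV (\<lambda>v. T.pure q v)"
  using T.pure_add_right[of q] T.pure_smult_right[of q] QV_cspace VS.cspace_axioms
  by (simp add: clin_def clin_axioms_def) (simp add: QV_simps)

lemma pure_H: "h \<in> carrier H \<Longrightarrow> q \<in> carrier Q \<Longrightarrow> v \<in> carrier V \<Longrightarrow> T.pure (h q) v = T.pure q (act V h v)"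
  using T.pure_balanced[of h q v] by simp

text \<open>Elements of H are homomorphisms, so the action of W_n on Q commutes with them and
  descends to the tensor product.\<close>

lemma
  shows act_QV_pure: "x \<in> W \<Longrightarrow> q \<in> carrier Q \<Longrightarrow> v \<in> carrier V \<Longrightarrow>
      act QV x (T.pure q v) = T.pure (act Q x q) v"
    and QV_lie_module: "lie_module Wn QV"
proof -
  have "clin Q (Q_right a) (\<lambda>q. q)"
    unfolding Q_right_def by (intro clin_with_act_right clin_id Q.M.cspace_axioms)
  note to_right = clin_comp[OF _ this] and diff = clin.diff[OF this]
  have f: "clin (Q_right a) (Q_right a) (act Q x)" if "x \<in> W" for x
    using Q_right_clin'[OF Q.act_clin[OF that]] .
  have f': "clin Wn (Q_right a) (\<lambda>x. act Q x q)" if "q \<in> carrier (Q_right a)" for q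
    using that by (intro to_right clin.intro clin_axioms.intro Wn_cspace Q.M.cspace_axioms)
      (simp_all add: Q.act_closed Q.act_add_left Q.act_smult_left)
  have commute: "act Q x (act (Q_right a) h q) = act (Q_right a) h (act Q x q)"
    if "x \<in> W" "h \<in> carrier H" "q \<in> carrier (Q_right a)" for x h q
    using that act_homD[of h W Q Q x q] by (simp add: H_simps)
  have bracket: "act Q (bracket Wn x y) q = act Q x (act Q y q) \<ominus>\<^bsub>Q_right a\<^esub> act Q y (act Q x q)"
    if "x \<in> W" "y \<in> W" "q \<in> carrier (Q_right a)" for x y q
    using that by (simp add: Q.act_bracket Q.act_closed diff)
  show "act QV x (T.pure q v) = T.pure (act Q x q) v" if "x \<in> W" "q \<in> carrier Q" "v \<in> carrier V"
    unfolding QV_simps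
    by (rule tensor_act_pure[where f = "act Q", OF T.balanced_pair_axioms Wn_lie_algebra f f' commute bracket]) (simp_all add: that)
  show "lie_module Wn QV"
    unfolding QT_def
    by (rule tensor_lie_module[where f = "act Q", OF T.balanced_pair_axioms Wn_lie_algebra f f' commute bracket])
qed

sublocale QV: Wn_module a QV
  by (intro Wn_module.intro QV_lie_module)

lemma pure_hom: "v \<in> carrier V \<Longrightarrow> (\<lambda>q\<in>carrier Q. T.pure q v) \<in> act_hom W Q QV"
  by (rule act_hom_restrictI[OF pure_clin_left]) (simp_all add: act_QV_pure Q.act_closed)

text \<open>For fixed v the map q to q tensor v is a homomorphism, so D_i^k (q tensor v) = (D_i^k q)
  tensor v, and local nilpotency is inherited from Q.\<close>

sublocale QV: whittaker a QV
proof (rule whittakerI[OF QV_lie_module nonzero])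
  fix z i assume z: "z \<in> carrier QV"
  let ?S = "{v \<in> carrier QV. \<exists>k. (QV.S i ^^ k) v = \<zero>\<^bsub>QV\<^esub>}"
  have S: "submodule ?S complex_field QV"
    by (rule clin_nilpotent_submodule[OF QV.shifted_clin]) simp
  have shift: "(QV.S i ^^ k) (T.pure q v) = T.pure ((Q.S i ^^ k) q) v" if v: "v \<in> carrier V" and "q \<in> carrier Q" for k q v
  proof -
    interpret p: clin Q QV "\<lambda>q. T.pure q v" by (rule pure_clin_left[OF v])
    have "QV.S i (T.pure q v) = T.pure (Q.S i q) v" if "q \<in> carrier Q" for q
      using that v by (simp add: shifted_def act_QV_pure p.diff p.smult Q.act_closed)
    then show ?thesis using that by (induction k) simp_all
  qed
  have pure: "T.pure q v \<in> ?S" if "q \<in> carrier Q" "v \<in> carrier V" for q v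
  proof -
    obtain k where "(Q.S i ^^ k) q = \<zero>\<^bsub>Q\<^esub>" using Q.locally_nilpotent[OF \<open>q \<in> carrier Q\<close>] by blast
    then have "(QV.S i ^^ k) (T.pure q v) = \<zero>\<^bsub>QV\<^esub>"
      using shift[of v q k] that clin.zero[OF pure_clin_left] by simp
    then show ?thesis using that by auto
  qed
  have "z \<in> ?S"
    using z
    by (rule QV_induct[of z "\<lambda>z. z \<in> ?S"])
      (rule QV.M.subspace_zero[OF S], rule pure,
        simp_all only: QV.M.submoduleE(5)[OF S])
  then show "\<exists>k. (QV.S i ^^ k) z = \<zero>\<^bsub>QV\<^esub>" by blast
qed

abbreviation "\<theta> v \<equiv> T.pure q0 v"

lemma theta_whittaker: "v \<in> carrier V \<Longrightarrow> \<theta> v \<in> whittaker_vectors a QV"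
  using hom_whittaker_vectors[OF pure_hom Q_lie_module QV_lie_module q0_whittaker] by simp

lemma Qhom_theta: "v \<in> carrier V \<Longrightarrow> q \<in> carrier Q \<Longrightarrow> Qhom a QV (\<theta> v) q = T.pure q v"
  using Qhom_eqI[OF QV_lie_module pure_hom, of v] by simp

end

section \<open>Expansions along homomorphisms, and the coefficient at exponent zero\<close>

context universal_whittaker
begin

text \<open>A homomorphism preserves Whittaker vectors and commutes with the h_i, so an expansion is
  transported coefficient by coefficient.\<close>

lemma expansion_hom:
  assumes "f \<in> act_hom W M N" "whittaker a M" "whittaker a N"
    "full_shift_family.expansion M (\<lambda>i. shifted a M (partial i)) (\<lambda>i. act M (euler i))
      (sorted_list_of_set UNIV) v w"
  shows "full_shift_family.expansion N (\<lambda>i. shifted a N (partial i)) (\<lambda>i. act N (euler i))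
    (sorted_list_of_set UNIV) (f v) (\<lambda>m. f (w m))"
proof -
  interpret M: whittaker a M by fact
  interpret N: whittaker a N by fact
  interpret f: clin M N f by (rule act_hom_clin[OF assms(1) M.M.cspace_axioms N.M.cspace_axioms])
  have "M.expansion v w" by (rule assms(4))
  then obtain J where J: "\<And>m. w m \<in> M.kers" "finite J" "\<And>m. m \<notin> J \<Longrightarrow> w m = \<zero>\<^bsub>M\<^esub>"
      "v = (\<Oplus>\<^bsub>M\<^esub>j\<in>J. M.hpow M.idx j (w j))"
    unfolding M.expansion_def by blast
  have w: "w m \<in> carrier M" for m using M.kersD(1)[OF J(1)] .
  have kers: "f (w m) \<in> N.kers" for m
    using hom_whittaker_vectors[OF assms(1) M.lie_module_axioms N.lie_module_axioms] J(1)
    by (simp add: M.kers_eq N.kers_eq)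
  have "f v = (\<Oplus>\<^bsub>N\<^esub>j\<in>J. f (M.hpow M.idx j (w j)))"
    unfolding J(4) using w by (intro f.finsum) simp
  also have "\<dots> = (\<Oplus>\<^bsub>N\<^esub>j\<in>J. N.hpow N.idx j (f (w j)))"
    using w by (intro N.M.finsum_cong') (auto simp: hom_hpow[OF assms(1-3)])
  finally show ?thesis
    unfolding N.expansion_def using J(2,3) kers f.zero by (intro conjI allI exI[of _ J]) simp_all
qed

text \<open>If f v = 0, transporting the expansion of v gives an expansion of 0, so by uniqueness f
  kills every coefficient of v. The image of f is a subspace containing all h^m w with w a Whittaker
  vector of \<open>N\<close>, and these span \<open>N\<close>.\<close>

lemma hom_bij:
  assumes "f \<in> act_hom W M N" "whittaker a M" "whittaker a N"
    and inj: "\<And>w. w \<in> whittaker_vectors a M \<Longrightarrow> f w = \<zero>\<^bsub>N\<^esub> \<Longrightarrow> w = \<zero>\<^bsub>M\<^esub>"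
    and surj: "whittaker_vectors a N \<subseteq> f ` whittaker_vectors a M"
  shows "bij_betw f (carrier M) (carrier N)"
proof -
  interpret M: whittaker a M by fact
  interpret N: whittaker a N by fact
  interpret f: clin M N f by (rule act_hom_clin[OF assms(1) M.M.cspace_axioms N.M.cspace_axioms])
  have "inj_on f (carrier M)"
  proof (rule f.inj_onI)
    fix v assume v: "v \<in> carrier M" "f v = \<zero>\<^bsub>N\<^esub>"
    obtain w where w: "M.expansion v w" using M.expansion_exists[OF v(1)] by blast
    have fw: "N.expansion \<zero>\<^bsub>N\<^esub> (\<lambda>m. f (w m))"
      using expansion_hom[OF assms(1-3) w] v(2) by simp
    have "N.expansion (f v) (\<lambda>m. f (w m))" using fw v(2) by simp
    moreover have "N.expansion \<zero>\<^bsub>N\<^esub> (\<lambda>m. \<zero>\<^bsub>N\<^esub>)"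
      using N.expansion_smult[OF fw, of 0] N.kersD(1) fw by (simp add: N.expansion_def)
    ultimately have "(\<lambda>m. f (w m)) = (\<lambda>m. \<zero>\<^bsub>N\<^esub>)"
      using N.expansion_unique v(2) by simp
    then have "f (w m) = \<zero>\<^bsub>N\<^esub>" for m by (simp add: fun_eq_iff)
    then have w0: "w m = \<zero>\<^bsub>M\<^esub>" for m
      using inj w by (simp add: M.expansion_def M.kers_eq)
    then show "v = \<zero>\<^bsub>M\<^esub>"
      using w clin.zero[OF M.hpow_clin] by (auto simp: M.expansion_def)
  qed
  moreover have "v \<in> f ` carrier M" if v: "v \<in> carrier N" for v
  proof -
    have sub: "submodule (f ` carrier M) complex_field N"
    proof (rule N.M.subspaceI)
      show "\<zero>\<^bsub>N\<^esub> \<in> f ` carrier M" using f.zero by (metis M.M.zero_closed imageI)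
      show "x \<oplus>\<^bsub>N\<^esub> y \<in> f ` carrier M" if "x \<in> f ` carrier M" "y \<in> f ` carrier M" for x y
        using that f.add by (auto simp flip: f.add)
      show "c \<odot>\<^bsub>N\<^esub> x \<in> f ` carrier M" if "x \<in> f ` carrier M" for c x
        using that by (auto simp flip: f.smult)
    qed auto
    have gen: "N.hpow N.idx m w \<in> f ` carrier M" if w: "w \<in> N.kers" for m w
    proof -
      obtain u where u: "u \<in> M.kers" "w = f u" using w surj by (auto simp: M.kers_eq N.kers_eq)
      show ?thesis
        unfolding u(2) hom_hpow[OF assms(1-3) M.kersD(1)[OF u(1)], symmetric]
        by (intro imageI M.hpow_in M.kersD(1)[OF u(1)])
    qed
    show ?thesis
    proof (rule N.hpow_generate[OF N.l(1) sub _ v])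
      show "N.hpow N.idx m w \<in> f ` carrier M" if "w \<in> N.kers" for m w by (rule gen[OF that])
      show "N.S j v = \<zero>\<^bsub>N\<^esub>" if "j \<notin> set N.idx" for j using that N.l(2) by blast
    qed
  qed
  ultimately show ?thesis unfolding bij_betw_def by auto
qed

text \<open>
  \<open>head q\<close> is the coefficient of \<open>h\<^sup>0 \<otimes> 1\<close> in the expansion of \<open>q\<close> in the basis of part (a). It is
  \<open>H\<close>-linear in \<open>q\<close>, so \<open>q \<otimes> v \<mapsto> head q \<cdot> v\<close> is a well defined left inverse of \<open>v \<mapsto> 1 \<otimes> v\<close>.
\<close>

definition "coef q = (THE w. Q.expansion q w)"

lemma coef_eq: "q \<in> carrier Q \<Longrightarrow> Q.expansion q w \<Longrightarrow> coef q = w"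
  unfolding coef_def using Q.expansion_unique by blast

lemma coef_expansion: "q \<in> carrier Q \<Longrightarrow> Q.expansion q (coef q)"
  using Q.expansion_exists coef_eq by blast

definition "head q = Qhom a Q (coef q (\<lambda>_. 0))"

lemma coef_kers: "q \<in> carrier Q \<Longrightarrow> coef q m \<in> Q.kers"
  using coef_expansion by (auto simp: Q.expansion_def)

lemma head_in: "q \<in> carrier Q \<Longrightarrow> head q \<in> carrier H"
  unfolding head_def using Qhom(1)[OF Q_lie_module] coef_kers by (simp add: H_simps Q.kers_eq)

lemma head_q0: "q \<in> carrier Q \<Longrightarrow> head q q0 = coef q (\<lambda>_. 0)"
  unfolding head_def using Qhom(2)[OF Q_lie_module] coef_kers by (simp add: Q.kers_eq)

lemma H_eqI: "h \<in> carrier H \<Longrightarrow> g \<in> carrier H \<Longrightarrow> h q0 = g q0 \<Longrightarrow> h = g"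
  by (rule Qhom_unique[OF Q.M.cspace_axioms]) (simp_all add: H_simps)

lemma hpow_zero: "Q.hpow l (\<lambda>_. 0) v = v"
  by (induction l) (simp_all add: Q.hpow_Cons)

text \<open>1 tensor 1 is a Whittaker vector and h^0 is the identity, so it is its own coefficient
  at exponent 0.\<close>

lemma head_one: "head q0 = \<one>\<^bsub>H\<^esub>"
proof -
  have "coef q0 = (\<lambda>m'. if m' = (\<lambda>_. 0) then q0 else \<zero>\<^bsub>Q\<^esub>)"
    using Q.expansion_single[of q0 "\<lambda>_. 0"] q0_whittaker
    by (intro coef_eq) (simp_all add: hpow_zero Q.kers_eq)
  then show ?thesis
    by (intro H_eqI head_in) (simp_all add: head_q0, simp_all add: H_simps QE.id_hom)
qed

lemma head_clin: "clin Q H head"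
proof (intro clin.intro clin_axioms.intro Q.M.cspace_axioms H_cspace)
  interpret Hc: cspace H by (rule H_cspace)
  fix q q' c assume q: "q \<in> carrier Q"
  show "head q \<in> carrier H" by (rule head_in[OF q])
  have in_H: "c \<odot>\<^bsub>H\<^esub> head q \<in> carrier H" using head_in[OF q] by simp
  have "coef (c \<odot>\<^bsub>Q\<^esub> q) = (\<lambda>m. c \<odot>\<^bsub>Q\<^esub> coef q m)"
    using q by (intro coef_eq Q.expansion_smult coef_expansion) simp_all
  then show "head (c \<odot>\<^bsub>Q\<^esub> q) = c \<odot>\<^bsub>H\<^esub> head q"
    using q in_H by (intro H_eqI head_in) (simp_all add: head_q0, simp_all add: H_simps head_q0)
  assume q': "q' \<in> carrier Q"
  have in_H: "head q \<oplus>\<^bsub>H\<^esub> head q' \<in> carrier H" using head_in[OF q] head_in[OF q'] by simp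
  have "coef (q \<oplus>\<^bsub>Q\<^esub> q') = (\<lambda>m. coef q m \<oplus>\<^bsub>Q\<^esub> coef q' m)"
    using q q' by (intro coef_eq Q.expansion_add coef_expansion) simp_all
  then show "head (q \<oplus>\<^bsub>Q\<^esub> q') = head q \<oplus>\<^bsub>H\<^esub> head q'"
    using q q' in_H by (intro H_eqI head_in) (simp_all add: head_q0, simp_all add: H_simps head_q0)
qed

lemma head_H:
  assumes "h \<in> carrier H" "q \<in> carrier Q" shows "head (h q) = head q \<otimes>\<^bsub>H\<^esub> h"
proof -
  have h: "h \<in> act_hom W Q Q" using assms by (simp add: H_simps)
  have "Q.expansion (h q) (\<lambda>m. h (coef q m))"
    using expansion_hom[OF h Q.whittaker_axioms Q.whittaker_axioms, of q "coef q"] coef_expansion[OF assms(2)]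
    by simp
  then have "coef (h q) = (\<lambda>m. h (coef q m))"
    using assms clin.closed[OF H_clin] by (intro coef_eq) simp_all
  then show ?thesis
    using assms head_in[OF assms(2)] clin.closed[OF H_clin[OF assms(1)] assms(2)]
    by (intro H_eqI head_in H.m_closed) (simp_all add: head_q0, simp add: H_simps compose_apply head_q0)
qed

end

context H_module
begin

definition "retract = T.lift V (\<lambda>q v. act V (head q) v)"

lemma
  shows retract_clin: "clin QV V retract"
    and retract_theta: "v \<in> carrier V \<Longrightarrow> retract (\<theta> v) = v"
proof -
  have left: "clin (Q_right a) V (\<lambda>q. act V (head q) v)" if "v \<in> carrier V" for v
    using Q_right_clin[OF clin_comp[OF head_clin V_act_left_clin[OF that]]] .
  have right: "clin V V (\<lambda>v. act V (head q) v)" if "q \<in> carrier (Q_right a)" for q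
    using V_act_clin[OF head_in] that by simp
  have bal: "act V (head (act (Q_right a) h q)) v = act V (head q) (act V h v)"
    if "h \<in> carrier H" "q \<in> carrier (Q_right a)" "v \<in> carrier V" for h q v
    using that by (simp add: head_H V.act_mult head_in)
  show "clin QV V retract"
    unfolding retract_def by (intro QV_clin T.lift_clin VS.cspace_axioms left right bal)
  show "retract (\<theta> v) = v" if "v \<in> carrier V"
    using that T.lift_pure[OF VS.cspace_axioms left right bal, of q0 v]
    unfolding retract_def by (simp add: head_one V.act_one)
qed

lemma theta_surj:
  assumes "z \<in> whittaker_vectors a QV" obtains v where "v \<in> carrier V" "z = \<theta> v"
proof -
  interpret th: clin V QV \<theta> by (rule pure_clin_right) simp
  let ?P = "\<lambda>z. \<exists>w. QV.expansion z w \<and> (\<forall>m. w m \<in> \<theta> ` carrier V)"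
  have "?P z" if "z \<in> carrier QV" for z
    using that
  proof (induction rule: QV_induct)
    case zero
    have "QV.expansion (QV.hpow QV.idx (\<lambda>_. 0) \<zero>\<^bsub>QV\<^esub>) (\<lambda>m'. if m' = (\<lambda>_. 0) then \<zero>\<^bsub>QV\<^esub> else \<zero>\<^bsub>QV\<^esub>)"
      using QV.M.subspace_zero[OF QV.kers_submodule]
      by (intro QV.expansion_single) simp
    moreover have "\<zero>\<^bsub>QV\<^esub> \<in> \<theta> ` carrier V" using th.zero by (metis V.M.zero_closed imageI)
    ultimately show ?case using clin.zero[OF QV.hpow_clin] by auto
  next
    case (pure q v)
    have "QV.expansion (T.pure q v) (\<lambda>m. T.pure (coef q m) v)"
      using expansion_hom[OF pure_hom[OF pure(2)] Q.whittaker_axioms QV.whittaker_axioms, of q "coef q"]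
        coef_expansion[OF pure(1)] pure Q.kersD(1)[OF coef_kers[OF pure(1)]]
      by simp
    moreover have "T.pure (coef q m) v \<in> \<theta> ` carrier V" for m
    proof -
      have m: "coef q m \<in> whittaker_vectors a Q" using coef_kers[OF pure(1)] by (simp add: Q.kers_eq)
      let ?h = "Qhom a Q (coef q m)"
      have h: "?h \<in> carrier H" "?h q0 = coef q m"
        using Qhom[OF Q_lie_module m] by (simp_all add: H_simps)
      have "T.pure (coef q m) v = \<theta> (act V ?h v)"
        using pure_H[OF h(1) q0_in pure(2)] h(2) by simp
      then show ?thesis using V.act_closed[OF h(1) pure(2)] by blast
    qed
    ultimately show ?case by blast
  next
    case (add z z')
    then obtain w w' where w: "QV.expansion z w" "QV.expansion z' w'"
      "\<And>m. w m \<in> \<theta> ` carrier V" "\<And>m. w' m \<in> \<theta> ` carrier V" by blast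
    have "w m \<oplus>\<^bsub>QV\<^esub> w' m \<in> \<theta> ` carrier V" for m
    proof -
      obtain v v' where "v \<in> carrier V" "v' \<in> carrier V" "w m = \<theta> v" "w' m = \<theta> v'"
        using w(3)[of m] w(4)[of m] by blast
      then show ?thesis using th.add[of v v'] by (metis V.M.add.m_closed imageI)
    qed
    then show ?case using QV.expansion_add[OF w(1,2)] by blast
  qed
  moreover have z: "z \<in> carrier QV" using assms by (simp add: whittaker_vectors_def)
  ultimately obtain w where w: "QV.expansion z w" "\<And>m. w m \<in> \<theta> ` carrier V" by blast
  have "QV.hpow l (\<lambda>_. 0) z = z" for l by (induction l) (simp_all add: QV.hpow_Cons)
  then have "QV.expansion z (\<lambda>m'. if m' = (\<lambda>_. 0) then z else \<zero>\<^bsub>QV\<^esub>)"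
    using QV.expansion_single[of z "\<lambda>_. 0"] assms by (simp add: QV.kers_eq)
  then have "w = (\<lambda>m'. if m' = (\<lambda>_. 0) then z else \<zero>\<^bsub>QV\<^esub>)"
    using QV.expansion_unique[OF w(1) _ z] by blast
  then have "z \<in> \<theta> ` carrier V" using w(2)[of "\<lambda>_. 0"] by simp
  then show ?thesis using that by blast
qed

lemma theta_clin: "clin V (Wh a QV) \<theta>"
proof -
  interpret th: clin V QV \<theta> by (rule pure_clin_right) simp
  interpret Wh: cspace "Wh a QV" by (rule Wh_cspace[OF QV.whittaker_axioms])
  show ?thesis
    by unfold_locales (simp_all add: Wh_simps theta_whittaker th.add th.smult)
qed

lemma retract_iso: "restrict retract (carrier (Wh a QV)) \<in> act_iso (carrier H) (Wh a QV) V"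
proof -
  interpret r: clin QV V retract by (rule retract_clin)
  interpret Wh: cspace "Wh a QV" by (rule Wh_cspace[OF QV.whittaker_axioms])
  have in_QV: "w \<in> carrier QV" if "w \<in> whittaker_vectors a QV" for w
    using that by (simp add: whittaker_vectors_def)
  have "clin (Wh a QV) V retract"
    by unfold_locales (simp_all add: Wh_simps r.add r.smult in_QV)
  moreover have "retract (act (Wh a QV) h w) = act V h (retract w)"
    if h: "h \<in> carrier H" and w: "w \<in> carrier (Wh a QV)" for h w
  proof -
    obtain v where v: "v \<in> carrier V" "w = \<theta> v" using w theta_surj by (auto simp: Wh_simps)
    have "act (Wh a QV) h w = \<theta> (act V h v)"
      using h v pure_H[OF h q0_in v(1)] clin.closed[OF H_clin[OF h]] by (simp add: Wh_simps Qhom_theta)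
    then show ?thesis using h v by (simp add: retract_theta V.act_closed)
  qed
  ultimately have "restrict retract (carrier (Wh a QV)) \<in> act_hom (carrier H) (Wh a QV) V"
    using Wh_act_in[OF QV.whittaker_axioms] by (intro act_hom_restrictI) (simp_all add: Wh_simps)
  moreover have "bij_betw retract (carrier (Wh a QV)) (carrier V)"
  proof (rule bij_betw_byWitness[where f' = \<theta>])
    show "\<forall>w\<in>carrier (Wh a QV). \<theta> (retract w) = w"
    proof
      fix w assume "w \<in> carrier (Wh a QV)"
      then obtain v where "v \<in> carrier V" "w = \<theta> v" using theta_surj by (auto simp: Wh_simps)
      then show "\<theta> (retract w) = w" by (simp add: retract_theta)
    qed
  qed (use retract_theta theta_whittaker in_QV in \<open>auto simp: Wh_simps\<close>)
  ultimately show ?thesis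
    unfolding act_iso_def by simp
qed

lemma finite_dim_Wh_QV:
  assumes "finite_dim V" shows "finite_dim (Wh a QV)"
proof (rule clin.finite_dim_image[OF theta_clin _ assms])
  show "\<theta> ` carrier V = carrier (Wh a QV)"
    using theta_surj theta_whittaker by (auto simp: Wh_simps elim: theta_surj)
qed

end

context universal_whittaker
begin

lemma H_moduleI: "left_module H V \<Longrightarrow> H_module a V"
  by (intro H_module.intro universal_whittaker_axioms)

lemma QT_Omega:
  assumes "V \<in> H_mod a" shows "QT a V \<in> Omega a"
proof -
  interpret H_module a V using assms by (intro H_moduleI) (simp add: H_mod_def)
  show ?thesis
    using assms finite_dim_Wh_QV QV.whittaker_axioms by (simp add: Omega_iff H_mod_def)
qed

lemma
  assumes "left_module H V" "left_module H V'" "g \<in> act_hom (carrier H) V V'"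
  shows QT_map_hom: "QT_map a V V' g \<in> act_hom W (QT a V) (QT a V')"
    and QT_map_pure: "q \<in> carrier Q \<Longrightarrow> v \<in> carrier V \<Longrightarrow>
      QT_map a V V' g (pure_tensor H (Q_right a) V q v) = pure_tensor H (Q_right a) V' q (g v)"
proof -
  interpret V: H_module a V by (rule H_moduleI) fact
  interpret V': H_module a V' by (rule H_moduleI) fact
  have id: "clin (Q_right a) (Q_right a) (\<lambda>q. q)" by (rule clin_id[OF Q_right_cspace])
  have g: "clin V V' g" by (rule act_hom_clin[OF assms(3) V.VS.cspace_axioms V'.VS.cspace_axioms])
  let ?t = "tensor_map H (Q_right a) V' (\<lambda>q. q) g"
  have t: "clin V.QV V'.QV ?t"
    by (rule V.QV_clin[OF V'.QV_clin'[OF tensor_map_clin[OF V.T.balanced_pair_axioms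
        V'.T.balanced_pair_axioms id _ g act_homD[OF assms(3)]]]]) simp_all
  have t_pure: "?t (V.T.pure q v) = V'.T.pure q (g v)" if "q \<in> carrier Q" "v \<in> carrier V" for q v
    using that by (intro tensor_map_pure[OF V.T.balanced_pair_axioms
        V'.T.balanced_pair_axioms id _ g act_homD[OF assms(3)]]) simp_all
  have "?t (act V.QV x z) = act V'.QV x (?t z)" if "x \<in> W" "z \<in> carrier V.QV" for x z
    by (rule V.QV_clin_eqI[OF clin_comp[OF V.QV.act_clin t] clin_comp[OF t V'.QV.act_clin] _ that(2)])
      (simp_all add: that(1) V.act_QV_pure V'.act_QV_pure t_pure clin.closed[OF g] Q.act_closed)
  then show "QT_map a V V' g \<in> act_hom W (QT a V) (QT a V')"
    unfolding QT_map_def by (intro act_hom_restrictI t) (simp_all add: V.QV.act_closed)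
  show "QT_map a V V' g (V.T.pure q v) = V'.T.pure q (g v)" if "q \<in> carrier Q" "v \<in> carrier V"
    using that by (simp add: QT_map_def t_pure)
qed

lemma H_hom_compose:
  assumes "left_module H V" "left_module H V'" "left_module H V''"
    "f \<in> act_hom (carrier H) V V'" "g \<in> act_hom (carrier H) V' V''"
  shows "compose (carrier V) g f \<in> act_hom (carrier H) V V''"
proof -
  interpret V: H_module a V by (rule H_moduleI) fact
  interpret V': H_module a V' by (rule H_moduleI) fact
  interpret V'': H_module a V'' by (rule H_moduleI) fact
  show ?thesis
    by (rule hom_compose[OF assms(4,5) V.VS.cspace_axioms V'.VS.cspace_axioms V''.VS.cspace_axioms])
      (rule V.V.act_closed)
qed

lemma QT_hom_eqI:
  assumes "left_module H V" "cspace P" "f \<in> act_hom W (QT a V) P" "g \<in> act_hom W (QT a V) P"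
    "\<And>q v. q \<in> carrier Q \<Longrightarrow> v \<in> carrier V \<Longrightarrow>
      f (pure_tensor H (Q_right a) V q v) = g (pure_tensor H (Q_right a) V q v)"
  shows "f = g"
proof -
  interpret V: H_module a V by (rule H_moduleI) fact
  show ?thesis
    by (rule act_hom_ext[OF assms(3,4)], rule V.QV_clin_eqI[OF act_hom_clin[OF assms(3) V.QV_cspace assms(2)]
          act_hom_clin[OF assms(4) V.QV_cspace assms(2)] assms(5)])
qed

lemma QT_functor:
  "module_functor (H_mod a :: ('n qtype \<Rightarrow> 'n qtype, 'v) act_module set) (carrier H) (Omega a) W (QT a) (QT_map a)"
  unfolding module_functor_def
proof (intro conjI ballI)
  fix V :: "('n qtype \<Rightarrow> 'n qtype, 'v) act_module" assume V: "V \<in> H_mod a"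
  show "QT a V \<in> Omega a" by (rule QT_Omega[OF V])
  have lV: "left_module H V" using V by (simp add: H_mod_def)
  interpret V: H_module a V by (rule H_moduleI[OF lV])
  have id: "(\<lambda>x\<in>carrier V. x) \<in> act_hom (carrier H) V V"
    by (rule act_hom_restrictI[OF clin_id]) (simp_all add: V.VS.cspace_axioms V.V.act_closed)
  have id': "(\<lambda>x\<in>carrier (QT a V). x) \<in> act_hom W (QT a V) (QT a V)"
    by (rule act_hom_restrictI[OF clin_id]) (simp_all add: V.QV_cspace V.QV.act_closed)
  show "QT_map a V V (\<lambda>x\<in>carrier V. x) = (\<lambda>y\<in>carrier (QT a V). y)"
    by (rule QT_hom_eqI[OF lV V.QV_cspace QT_map_hom[OF lV lV id] id'])
      (simp_all add: QT_map_pure[OF lV lV id])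
  fix V' :: "('n qtype \<Rightarrow> 'n qtype, 'v) act_module" assume V': "V' \<in> H_mod a"
  have lV': "left_module H V'" using V' by (simp add: H_mod_def)
  interpret V': H_module a V' by (rule H_moduleI[OF lV'])
  show "QT_map a V V' g \<in> act_hom W (QT a V) (QT a V')" if "g \<in> act_hom (carrier H) V V'" for g
    by (rule QT_map_hom[OF lV lV' that])
  fix V'' :: "('n qtype \<Rightarrow> 'n qtype, 'v) act_module" and f g
  assume V'': "V'' \<in> H_mod a" and f: "f \<in> act_hom (carrier H) V V'" and g: "g \<in> act_hom (carrier H) V' V''"
  have lV'': "left_module H V''" using V'' by (simp add: H_mod_def)
  interpret V'': H_module a V'' by (rule H_moduleI[OF lV''])
  have fg: "compose (carrier V) g f \<in> act_hom (carrier H) V V''"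
    by (rule H_hom_compose[OF lV lV' lV'' f g])
  have fV: "f v \<in> carrier V'" if "v \<in> carrier V" for v
    using clin.closed[OF act_hom_clin[OF f V.VS.cspace_axioms V'.VS.cspace_axioms] that] .
  show "QT_map a V V'' (compose (carrier V) g f)
      = compose (carrier (QT a V)) (QT_map a V' V'' g) (QT_map a V V' f)"
    by (rule QT_hom_eqI[OF lV V''.QV_cspace QT_map_hom[OF lV lV'' fg]
          hom_compose[OF QT_map_hom[OF lV lV' f] QT_map_hom[OF lV' lV'' g]
            V.QV_cspace V'.QV_cspace V''.QV_cspace V.QV.act_closed]])
      (simp_all add: compose_apply QT_map_pure[OF lV lV'' fg] QT_map_pure[OF lV lV' f]
        QT_map_pure[OF lV' lV'' g] fV)
qed

definition evaluation :: "('n der, 'm) act_module \<Rightarrow> ('n, 'm) ttype \<Rightarrow> 'm" where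
  "evaluation M = restrict (balanced_pair.lift M (\<lambda>q w. Qhom a M w q)) (carrier (QT a (Wh a M)))"

lemma evaluation:
  assumes "whittaker a M"
  shows evaluation_hom: "evaluation M \<in> act_hom W (QT a (Wh a M)) M"
    and evaluation_pure: "q \<in> carrier Q \<Longrightarrow> w \<in> carrier (Wh a M) \<Longrightarrow>
      evaluation M (pure_tensor H (Q_right a) (Wh a M) q w) = Qhom a M w q"
proof -
  interpret M: whittaker a M by fact
  have lV: "left_module H (Wh a M)" by (rule Wh_left_module[OF assms])
  interpret V: H_module a "Wh a M" by (rule H_moduleI[OF lV])
  let ?b = "\<lambda>q w. Qhom a M w q" let ?f = "V.T.lift M ?b"
  have hom: "Qhom a M w \<in> act_hom W Q M" if "w \<in> carrier (Wh a M)" for w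
    using Qhom(1)[OF M.lie_module_axioms] that by (simp add: Wh_simps)
  have left: "clin (Q_right a) M (\<lambda>q. ?b q w)" if "w \<in> carrier (Wh a M)" for w
    using Q_right_clin[OF act_hom_clin[OF hom[OF that] Q.M.cspace_axioms M.M.cspace_axioms]] .
  have right: "clin (Wh a M) M (?b q)" if "q \<in> carrier (Q_right a)" for q
    using Qhom_clin[OF assms] that by simp
  have bal: "?b (act (Q_right a) h q) w = ?b q (act (Wh a M) h w)"
    if "h \<in> carrier H" "q \<in> carrier (Q_right a)" "w \<in> carrier (Wh a M)" for h q w
    using that Qhom_act[OF assms, of w h q] by (simp add: Wh_simps)
  have f: "clin V.QV M ?f"
    by (intro V.QV_clin V.T.lift_clin M.M.cspace_axioms left right bal)
  have f_pure: "?f (V.T.pure q w) = Qhom a M w q" if "q \<in> carrier Q" "w \<in> carrier (Wh a M)" for q w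
    using V.T.lift_pure[OF M.M.cspace_axioms left right bal, of q w] that by simp
  have "?f (act V.QV x z) = act M x (?f z)" if "x \<in> W" "z \<in> carrier V.QV" for x z
    by (rule V.QV_clin_eqI[OF clin_comp[OF V.QV.act_clin f] clin_comp[OF f M.act_clin] _ that(2)])
      (simp_all add: that(1) V.act_QV_pure f_pure Q.act_closed act_homD[OF hom])
  then show "evaluation M \<in> act_hom W (QT a (Wh a M)) M"
    unfolding evaluation_def by (intro act_hom_restrictI f) (simp_all add: V.QV.act_closed)
  show "evaluation M (V.T.pure q w) = Qhom a M w q" if "q \<in> carrier Q" "w \<in> carrier (Wh a M)"
    using that f_pure by (simp add: evaluation_def)
qed

lemma evaluation_iso:
  assumes "whittaker a M" shows "evaluation M \<in> act_iso W (QT a (Wh a M)) M"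
proof -
  interpret M: whittaker a M by fact
  have lV: "left_module H (Wh a M)" by (rule Wh_left_module[OF assms])
  interpret V: H_module a "Wh a M" by (rule H_moduleI[OF lV])
  have th: "evaluation M (V.\<theta> w) = w" if "w \<in> whittaker_vectors a M" for w
    using evaluation_pure[OF assms q0_in] Qhom(2)[OF M.lie_module_axioms that] that by (simp add: Wh_simps)
  have "bij_betw (evaluation M) (carrier V.QV) (carrier M)"
  proof (rule hom_bij[OF evaluation_hom[OF assms] V.QV.whittaker_axioms assms])
    fix z assume "z \<in> whittaker_vectors a V.QV" and 0: "evaluation M z = \<zero>\<^bsub>M\<^esub>"
    then obtain w where w: "w \<in> carrier (Wh a M)" "z = V.\<theta> w" using V.theta_surj by blast
    then have "w = \<zero>\<^bsub>Wh a M\<^esub>" using th[of w] 0 by (simp add: Wh_simps)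
    then show "z = \<zero>\<^bsub>V.QV\<^esub>" using w clin.zero[OF V.pure_clin_right] by simp
  next
    show "whittaker_vectors a M \<subseteq> evaluation M ` whittaker_vectors a V.QV"
    proof
      fix w assume w: "w \<in> whittaker_vectors a M"
      then have "V.\<theta> w \<in> whittaker_vectors a V.QV" by (intro V.theta_whittaker) (simp add: Wh_simps)
      then show "w \<in> evaluation M ` whittaker_vectors a V.QV" using th[OF w] by (metis imageI)
    qed
  qed
  then show ?thesis using evaluation_hom[OF assms] by (simp add: act_iso_def)
qed

lemma evaluation_natural:
  "natural_iso (Omega a :: ('n der, 'm) act_module set) W W
     (\<lambda>M. QT a (Wh a M)) (\<lambda>M N f. QT_map a (Wh a M) (Wh a N) (Wh_map a M N f))
     (\<lambda>M. M) (\<lambda>M N f. f) evaluation"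
  unfolding natural_iso_def
proof (intro conjI ballI)
  fix M :: "('n der, 'm) act_module" assume M: "M \<in> Omega a"
  then have wM: "whittaker a M" by (simp add: Omega_iff)
  then interpret M: whittaker a M .
  show "evaluation M \<in> act_iso W (QT a (Wh a M)) M" by (rule evaluation_iso[OF wM])
  fix N :: "('n der, 'm) act_module" and f assume N: "N \<in> Omega a" and f: "f \<in> act_hom W M N"
  have wN: "whittaker a N" using N by (simp add: Omega_iff)
  then interpret N: whittaker a N .
  have lM: "left_module H (Wh a M)" and lN: "left_module H (Wh a N)"
    by (rule Wh_left_module[OF wM], rule Wh_left_module[OF wN])
  interpret WM: H_module a "Wh a M" by (rule H_moduleI[OF lM])
  interpret WN: H_module a "Wh a N" by (rule H_moduleI[OF lN])
  have g: "Wh_map a M N f \<in> act_hom (carrier H) (Wh a M) (Wh a N)" by (rule Wh_map_hom[OF wM wN f])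
  show "compose (carrier (QT a (Wh a M))) (evaluation N) (QT_map a (Wh a M) (Wh a N) (Wh_map a M N f))
      = compose (carrier (QT a (Wh a M))) f (evaluation M)"
  proof (rule QT_hom_eqI[OF lM N.M.cspace_axioms
        hom_compose[OF QT_map_hom[OF lM lN g] evaluation_hom[OF wN] WM.QV_cspace WN.QV_cspace N.M.cspace_axioms WM.QV.act_closed]
        hom_compose[OF evaluation_hom[OF wM] f WM.QV_cspace M.M.cspace_axioms N.M.cspace_axioms WM.QV.act_closed]])
    fix q w assume q: "q \<in> carrier Q" and w: "w \<in> carrier (Wh a M)"
    have fw: "Wh_map a M N f w = f w" "f w \<in> carrier (Wh a N)"
      using w hom_whittaker_vectors[OF f M.lie_module_axioms N.lie_module_axioms]
      by (simp_all add: Wh_map_def Wh_simps)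
    show "compose (carrier (QT a (Wh a M))) (evaluation N) (QT_map a (Wh a M) (Wh a N) (Wh_map a M N f)) (WM.T.pure q w)
      = compose (carrier (QT a (Wh a M))) f (evaluation M) (WM.T.pure q w)"
      using q w fw Qhom_naturality[OF f M.lie_module_axioms N.lie_module_axioms _ q, of w]
      by (simp add: compose_apply QT_map_pure[OF lM lN g] evaluation_pure[OF wM] evaluation_pure[OF wN])
        (simp add: Wh_simps)
  qed
qed

definition counit :: "('n qtype \<Rightarrow> 'n qtype, 'v) act_module \<Rightarrow> ('n, 'v) ttype \<Rightarrow> 'v" where
  "counit V = restrict (H_module.retract a V) (carrier (Wh a (QT a V)))"

lemma counit_natural:
  "natural_iso (H_mod a :: ('n qtype \<Rightarrow> 'n qtype, 'v) act_module set) (carrier H) (carrier H)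
     (\<lambda>V. Wh a (QT a V)) (\<lambda>V V' g. Wh_map a (QT a V) (QT a V') (QT_map a V V' g))
     (\<lambda>V. V) (\<lambda>V V' g. g) counit"
  unfolding natural_iso_def
proof (intro conjI ballI)
  fix V :: "('n qtype \<Rightarrow> 'n qtype, 'v) act_module" assume "V \<in> H_mod a"
  then have lV: "left_module H V" by (simp add: H_mod_def)
  interpret V: H_module a V by (rule H_moduleI[OF lV])
  show "counit V \<in> act_iso (carrier H) (Wh a (QT a V)) V"
    unfolding counit_def by (rule V.retract_iso)
  fix V' :: "('n qtype \<Rightarrow> 'n qtype, 'v) act_module" and g
  assume "V' \<in> H_mod a" and g: "g \<in> act_hom (carrier H) V V'"
  then have lV': "left_module H V'" by (simp add: H_mod_def)
  interpret V': H_module a V' by (rule H_moduleI[OF lV'])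
  have gV: "g v \<in> carrier V'" if "v \<in> carrier V" for v
    using clin.closed[OF act_hom_clin[OF g V.VS.cspace_axioms V'.VS.cspace_axioms] that] .
  have "counit V' (Wh_map a (QT a V) (QT a V') (QT_map a V V' g) z) = g (counit V z)"
    if z: "z \<in> carrier (Wh a (QT a V))" for z
  proof -
    obtain v where v: "v \<in> carrier V" "z = V.\<theta> v" using z V.theta_surj by (auto simp: Wh_simps)
    have "Wh_map a (QT a V) (QT a V') (QT_map a V V' g) z = V'.\<theta> (g v)"
      using z v by (simp add: Wh_map_def QT_map_pure[OF lV lV' g])
    then show ?thesis
      using z v V'.theta_whittaker[OF gV[OF v(1)]] gV[OF v(1)]
      by (simp add: counit_def V.retract_theta V'.retract_theta Wh_simps)
  qed
  then show "compose (carrier (Wh a (QT a V))) (counit V') (Wh_map a (QT a V) (QT a V') (QT_map a V V' g))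
      = compose (carrier (Wh a (QT a V))) g (counit V)"
    by (auto simp: compose_def fun_eq_iff)
qed

end

theorem theorem4p8:
  fixes a :: "'n::{finite,linorder} \<Rightarrow> complex"
  assumes "\<And>i. a i \<noteq> 0"
  shows
    "right_module_basis (Ha a) (Q_right a) UNIV
       (\<lambda>m :: 'n \<Rightarrow> nat. q_tensor a (euler_monomial m) 1) \<and>
     module_functor (Omega a :: ('n der, 'm) act_module set) (carrier Wn)
       (H_mod a) (carrier (Ha a)) (Wh a) (Wh_map a) \<and>
     module_functor (H_mod a :: ('n qtype \<Rightarrow> 'n qtype, 'v) act_module set) (carrier (Ha a))
       (Omega a) (carrier Wn) (QT a) (QT_map a) \<and>
     (\<exists>\<eta>. natural_iso (Omega a :: ('n der, 'm) act_module set) (carrier Wn) (carrier Wn)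
       (\<lambda>M. QT a (Wh a M)) (\<lambda>M N f. QT_map a (Wh a M) (Wh a N) (Wh_map a M N f))
       (\<lambda>M. M) (\<lambda>M N f. f) \<eta>) \<and>
     (\<exists>\<epsilon>. natural_iso (H_mod a :: ('n qtype \<Rightarrow> 'n qtype, 'v) act_module set)
       (carrier (Ha a)) (carrier (Ha a))
       (\<lambda>V. Wh a (QT a V)) (\<lambda>V V' g. Wh_map a (QT a V) (QT a V') (QT_map a V V' g))
       (\<lambda>V. V) (\<lambda>V V' g. g) \<epsilon>)"
proof -
  interpret universal_whittaker a by unfold_locales (rule assms)
  show ?thesis
    using euler_basis Wh_functor QT_functor evaluation_natural counit_natural by blast
qed

end
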